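(* Let $G$ be a topological group and let $\Pi_s(G)$ be its universal minimal strongly proximal system. Then the affine dynamical system $(M(\Pi_s(G)),G)$ is irreducible, and it is the universal affine system for irreducible affine $G$-systems; i.e. for any irreducible affine $G$-system $(Q,G)$ there is a unique surjective affine homomorphism $\Theta: M(\Pi_s(G))\to Q$. In particular, if $\Pi_s(G)$ is affinely prime, then $M(\Pi_s(G))$ is, up to affine isomorphism, the only nontrivial irreducible affine $G$-system.
   Context: A dynamical system $(X,G)$ consists of a (nonempty) compact metric space $X$, a topological group $G$, and a continuous homomorphism from $G$ to $\mathrm{Homeo}(X)$, the Polish group of homeomorphisms of $X$ with the compact-open topology; one writes $gx$ for the action of $g\in G$ on $x\in X$. A system is nontrivial if it contains more than one point. A homomorphism of $G$-systems is a continuous map intertwining the $G$-actions; if it is surjective, it is called a factor map and its target is called a factor. $(X,G)$ is minimal if it has no proper (nonempty) closed invariant subset. $M(X)$ is the space of probability measures on $X$ with the weak$^*$ topology inherited from $C(X)^*$, where $C(X)$ is the Banach algebra of real valued continuous functions on $X$; it is a compact metric space with an affine structure, and the $G$-action on $X$ induces a continuous affine action of $G$ on $M(X)$. $(X,G)$ is strongly proximal if for every $\mu\in M(X)$ there are a sequence $g_n\in G$ and a point $x\in X$ such that $\lim g_n\mu=\delta_x$, the point mass at $x$. An affine dynamical system (affine $G$-system) $(Q,G)$ is a dynamical system in which $Q$ is a compact convex metrisable subset of a locally convex topological vector space and $G$ acts on $Q$ as a group of continuous affine maps (each $g\in G$ preserves convex combinations). An affine homomorphism between affine $G$-systems is a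 homomorphism of $G$-systems that is an affine map; an affine isomorphism is a bijective affine homomorphism. $(Q,G)$ is irreducible if whenever $Q'\subset Q$ is a nonempty closed convex $G$-invariant subset, then $Q'=Q$. $(Q,G)$ is affinely prime if every surjective affine homomorphism $\pi:Q\to Q'$ onto a nontrivial affine system $Q'$ is one-to-one. A dynamical system $(X,G)$ is affinely prime if the affine system $(M(X),G)$ is affinely prime. $\Pi_s(G)$ denotes the universal minimal strongly proximal system of $G$, that is, the minimal strongly proximal $G$-system having every minimal strongly proximal $G$-system as a factor; it is taken as known that it exists for any topological group $G$. *)

theory Defs
  imports "HOL-Probability.Giry_Monad" "HOL-Library.Function_Algebras"
begin

text \<open>
  Real-valued functions on a type form a real vector space under pointwise operations. The
  addition is the one of \<^theory>\<open>HOL-Library.Function_Algebras\<close>.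
\<close>

instantiation "fun" :: (type, real_vector) real_vector
begin

definition scaleR_fun :: "real \<Rightarrow> ('a \<Rightarrow> 'b) \<Rightarrow> 'a \<Rightarrow> 'b"
  where "scaleR_fun c f = (\<lambda>x. c *\<^sub>R f x)"

instance
  by standard (simp_all add: scaleR_fun_def fun_eq_iff scaleR_add_right scaleR_add_left)

end


section \<open>Dynamical systems\<close>

text \<open>
  A topological group is a type of class \<^class>\<open>topological_group_add\<close>; its operation is written
  additively but is not assumed to be commutative.

  All notions take a parameter \<open>metr\<close>, which fixes the class of phase spaces. For
  \<^prop>\<open>metr = True\<close> these are the nonempty compact metrisable spaces, and for
  \<^prop>\<open>metr = False\<close> the nonempty compact Hausdorff spaces. Both are needed, because the
  universal minimal strongly proximal system exists for every topological group in the second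
  class, while for many groups (for instance the discrete free group of rank two) it is not
  metrisable.

  Only the restriction of an action to \<^term>\<open>topspace X\<close> is relevant.
\<close>

definition compact_open :: "'a topology \<Rightarrow> 'b topology \<Rightarrow> ('a \<Rightarrow> 'b) topology"
  where "compact_open X Y =
    topology_generated_by {{f. f ` K \<subseteq> U} |K U. compactin X K \<and> openin Y U}"

definition Homeo :: "'a topology \<Rightarrow> ('a \<Rightarrow> 'a) topology"
  where "Homeo X = subtopology (compact_open X X) {f. homeomorphic_map X X f}"

definition dynamical_system ::
    "bool \<Rightarrow> 'x topology \<Rightarrow> ('g::topological_group_add \<Rightarrow> 'x \<Rightarrow> 'x) \<Rightarrow> bool"
  where "dynamical_system metr X a \<longleftrightarrow>
    topspace X \<noteq> {} \<and> compact_space X \<and> Hausdorff_space X \<and> (metr \<longrightarrow> metrizable_space X) \<and>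
    continuous_map euclidean (Homeo X) a \<and>
    (\<forall>g h. \<forall>x\<in>topspace X. a (g + h) x = a g (a h x))"

definition nontrivial :: "'x set \<Rightarrow> bool"
  where "nontrivial S \<longleftrightarrow> (\<exists>x\<in>S. \<exists>y\<in>S. x \<noteq> y)"

definition invariant :: "('g \<Rightarrow> 'x \<Rightarrow> 'x) \<Rightarrow> 'x set \<Rightarrow> bool"
  where "invariant a C \<longleftrightarrow> (\<forall>g. a g ` C \<subseteq> C)"

definition minimal_system ::
    "bool \<Rightarrow> 'x topology \<Rightarrow> ('g::topological_group_add \<Rightarrow> 'x \<Rightarrow> 'x) \<Rightarrow> bool"
  where "minimal_system metr X a \<longleftrightarrow> dynamical_system metr X a \<and>
    (\<forall>C. closedin X C \<and> C \<noteq> {} \<and> invariant a C \<longrightarrow> C = topspace X)"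

definition system_hom ::
    "'x topology \<Rightarrow> ('g \<Rightarrow> 'x \<Rightarrow> 'x) \<Rightarrow> 'y topology \<Rightarrow> ('g \<Rightarrow> 'y \<Rightarrow> 'y) \<Rightarrow> ('x \<Rightarrow> 'y) \<Rightarrow> bool"
  where "system_hom X a Y b f \<longleftrightarrow>
    continuous_map X Y f \<and> (\<forall>g. \<forall>x\<in>topspace X. f (a g x) = b g (f x))"

definition factor_map ::
    "'x topology \<Rightarrow> ('g \<Rightarrow> 'x \<Rightarrow> 'x) \<Rightarrow> 'y topology \<Rightarrow> ('g \<Rightarrow> 'y \<Rightarrow> 'y) \<Rightarrow> ('x \<Rightarrow> 'y) \<Rightarrow> bool"
  where "factor_map X a Y b f \<longleftrightarrow> system_hom X a Y b f \<and> f ` topspace X = topspace Y"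


section \<open>The space of probability measures\<close>

definition borel_algebra :: "'x topology \<Rightarrow> 'x measure"
  where "borel_algebra X = sigma (topspace X) {U. openin X U}"

text \<open>
  On a compact Hausdorff space, ``probability measure'' means regular Borel probability measure.
  On a compact metrisable space regularity is automatic.
\<close>

definition prob_measures :: "'x topology \<Rightarrow> 'x measure set"
  where "prob_measures X = {\<mu>. prob_space \<mu> \<and>
    space \<mu> = topspace X \<and> sets \<mu> = sets (borel_algebra X) \<and>
    (\<forall>A\<in>sets \<mu>. emeasure \<mu> A = (SUP K\<in>{K. compactin X K \<and> K \<subseteq> A}. emeasure \<mu> K))}"

text \<open>
  The dual of \<open>C(X)\<close> is represented by functions on \<^typ>\<open>'x \<Rightarrow> real\<close> that vanish outside \<open>C(X)\<close>.
  The weak-star topology, pointwise convergence on \<open>C(X)\<close>, is then the restriction of the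
  product topology. A measure is identified with its integration functional.
\<close>

definition weak_star :: "(('x \<Rightarrow> real) \<Rightarrow> real) topology"
  where "weak_star = product_topology (\<lambda>_. euclideanreal) UNIV"

definition integration :: "'x topology \<Rightarrow> 'x measure \<Rightarrow> ('x \<Rightarrow> real) \<Rightarrow> real"
  where "integration X \<mu> =
    (\<lambda>f. if continuous_map X euclideanreal f then (\<integral>x. f x \<partial>\<mu>) else 0)"

definition prob_space_of :: "'x topology \<Rightarrow> (('x \<Rightarrow> real) \<Rightarrow> real) set"
  where "prob_space_of X = integration X ` prob_measures X"

definition point_mass :: "'x topology \<Rightarrow> 'x \<Rightarrow> ('x \<Rightarrow> real) \<Rightarrow> real"
  where "point_mass X x = integration X (return (borel_algebra X) x)"

text \<open>
  The induced action is push-forward of measures, see \<open>induced_action_integration\<close> below.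
\<close>

definition induced_action ::
    "('g \<Rightarrow> 'x \<Rightarrow> 'x) \<Rightarrow> 'g \<Rightarrow> (('x \<Rightarrow> real) \<Rightarrow> real) \<Rightarrow> ('x \<Rightarrow> real) \<Rightarrow> real"
  where "induced_action a g \<Lambda> = (\<lambda>f. \<Lambda> (f \<circ> a g))"

lemma measurable_borel_algebra:
  assumes "continuous_map X Y f" "space \<mu> = topspace X" "sets \<mu> = sets (borel_algebra X)"
  shows "f \<in> measurable \<mu> (borel_algebra Y)"
proof -
  have "f \<in> measurable (borel_algebra X) (borel_algebra Y)"
    unfolding borel_algebra_def
  proof (rule measurable_sigma_sets[OF sets_measure_of])
    show "{U. openin Y U} \<subseteq> Pow (topspace Y)" "{U. openin Y U} \<subseteq> Pow (topspace Y)"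
      using openin_subset by auto
    show "f \<in> space (sigma (topspace X) {U. openin X U}) \<rightarrow> topspace Y"
      using continuous_map_funspace[OF assms(1)] by (simp add: space_measure_of_conv)
    fix A assume A: "A \<in> {U. openin Y U}"
    have "f -` A \<inter> topspace X = {x \<in> topspace X. f x \<in> A}" by auto
    then have "openin X (f -` A \<inter> topspace X)"
      using openin_continuous_map_preimage[OF assms(1)] A by simp
    moreover have "{U. openin X U} \<subseteq> Pow (topspace X)"
      using openin_subset by auto
    ultimately show "f -` A \<inter> space (sigma (topspace X) {U. openin X U})
        \<in> sets (sigma (topspace X) {U. openin X U})"
      by (simp add: space_measure_of_conv)
  qed
  then show ?thesis
    using assms(3) by (simp cong: measurable_cong_sets)
qed

lemma induced_action_integration:
  assumes X: "dynamical_system metr X a" and mu: "\<mu> \<in> prob_measures X"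
  shows "induced_action a g (integration X \<mu>) = integration X (distr \<mu> (borel_algebra X) (a g))"
proof
  fix f :: "'a \<Rightarrow> real"
  have "a g \<in> topspace (Homeo X)"
    using X continuous_map_image_subset_topspace[of euclidean "Homeo X" a]
    by (auto simp: dynamical_system_def)
  then have hom: "homeomorphic_map X X (a g)"
    by (simp add: Homeo_def topspace_subtopology)
  then have cont: "continuous_map X X (a g)"
    by (rule homeomorphic_imp_continuous_map)
  have sp: "space \<mu> = topspace X" "sets \<mu> = sets (borel_algebra X)"
    using mu by (auto simp: prob_measures_def)
  have iff: "continuous_map X euclideanreal (f \<circ> a g) \<longleftrightarrow> continuous_map X euclideanreal f"
    using hom continuous_map_compose[OF cont]
    by (metis continuous_compose_quotient_map_eq homeomorphic_map_def)
  show "induced_action a g (integration X \<mu>) f =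
      integration X (distr \<mu> (borel_algebra X) (a g)) f"
  proof (cases "continuous_map X euclideanreal f")
    case True
    have eq: "sets (borel_algebra euclideanreal) = sets (borel :: real measure)"
      by (simp add: borel_algebra_def borel_def)
    have "f \<in> measurable (borel_algebra X) (borel_algebra euclideanreal)"
      using measurable_borel_algebra[OF True, of "borel_algebra X"]
      by (simp add: borel_algebra_def space_measure_of_conv)
    then have "f \<in> borel_measurable (borel_algebra X)"
      using eq by (simp cong: measurable_cong_sets)
    then show ?thesis
      using True iff integral_distr[OF measurable_borel_algebra[OF cont sp], of f]
      by (simp add: induced_action_def integration_def comp_def)
  next
    case False
    then show ?thesis
      using iff by (simp add: induced_action_def integration_def)
  qed
qed


section \<open>Strong proximality\<close>

text \<open>
  Sequences \<open>g\<^sub>n\<close> are replaced by nets when the spaces need not be metrisable; a net in the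
  group enters through the proper filter that it generates.
\<close>

definition strongly_proximal ::
    "bool \<Rightarrow> 'x topology \<Rightarrow> ('g::topological_group_add \<Rightarrow> 'x \<Rightarrow> 'x) \<Rightarrow> bool"
  where "strongly_proximal metr X a \<longleftrightarrow>
    dynamical_system metr X a \<and>
    (\<forall>\<mu>\<in>prob_space_of X. \<exists>x\<in>topspace X.
      if metr
      then \<exists>s::nat \<Rightarrow> 'g.
        limitin weak_star (\<lambda>n. induced_action a (s n) \<mu>) (point_mass X x) sequentially
      else \<exists>F::'g filter. F \<noteq> bot \<and>
        limitin weak_star (\<lambda>g. induced_action a g \<mu>) (point_mass X x) F)"

definition minimal_strongly_proximal ::
    "bool \<Rightarrow> 'x topology \<Rightarrow> ('g::topological_group_add \<Rightarrow> 'x \<Rightarrow> 'x) \<Rightarrow> bool"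
  where "minimal_strongly_proximal metr X a \<longleftrightarrow>
    minimal_system metr X a \<and> strongly_proximal metr X a"

text \<open>
  Universality quantifies over all minimal strongly proximal systems whose points form a subset
  of the type \<^typ>\<open>'g set set\<close>. Up to isomorphism these are all of them. If \<open>Y\<close> is minimal
  and \<open>y\<^sub>0 \<in> Y\<close>, then the orbit of \<open>y\<^sub>0\<close> is dense and \<open>Y\<close> is Hausdorff, so sending \<open>y\<close> to
  the set of all \<open>A \<subseteq> G\<close> with \<open>y\<close> in the closure of \<open>A y\<^sub>0\<close> is injective, and the structure
  of \<open>Y\<close> can be transported along this map.
\<close>

definition universal_minimal_strongly_proximal ::
    "bool \<Rightarrow> 'x topology \<Rightarrow> ('g::topological_group_add \<Rightarrow> 'x \<Rightarrow> 'x) \<Rightarrow> bool"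
  where "universal_minimal_strongly_proximal metr X a \<longleftrightarrow>
    minimal_strongly_proximal metr X a \<and>
    (\<forall>(Y::'g set set topology) b.
      minimal_strongly_proximal metr Y b \<longrightarrow> (\<exists>f. factor_map X a Y b f))"


section \<open>Affine systems\<close>

definition locally_convex_tvs :: "'v::real_vector topology \<Rightarrow> bool"
  where "locally_convex_tvs T \<longleftrightarrow>
    topspace T = UNIV \<and> Hausdorff_space T \<and>
    continuous_map (prod_topology T T) T (\<lambda>(x, y). x + y) \<and>
    continuous_map (prod_topology euclideanreal T) T (\<lambda>(c, x). c *\<^sub>R x) \<and>
    (\<forall>U. openin T U \<and> 0 \<in> U \<longrightarrow> (\<exists>V. openin T V \<and> 0 \<in> V \<and> convex V \<and> V \<subseteq> U))"

definition affine_map_on :: "'v::real_vector set \<Rightarrow> ('v \<Rightarrow> 'w::real_vector) \<Rightarrow> bool"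
  where "affine_map_on Q f \<longleftrightarrow> (\<forall>x\<in>Q. \<forall>y\<in>Q. \<forall>t\<in>{0..1}.
    f ((1 - t) *\<^sub>R x + t *\<^sub>R y) = (1 - t) *\<^sub>R f x + t *\<^sub>R f y)"

definition affine_system ::
    "bool \<Rightarrow> 'v::real_vector topology \<Rightarrow> 'v set \<Rightarrow> ('g::topological_group_add \<Rightarrow> 'v \<Rightarrow> 'v) \<Rightarrow> bool"
  where "affine_system metr T Q a \<longleftrightarrow>
    locally_convex_tvs T \<and> convex Q \<and> dynamical_system metr (subtopology T Q) a \<and>
    (\<forall>g. affine_map_on Q (a g))"

definition irreducible_affine_system ::
    "bool \<Rightarrow> 'v::real_vector topology \<Rightarrow> 'v set \<Rightarrow> ('g::topological_group_add \<Rightarrow> 'v \<Rightarrow> 'v) \<Rightarrow> bool"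
  where "irreducible_affine_system metr T Q a \<longleftrightarrow> affine_system metr T Q a \<and>
    (\<forall>Q'. Q' \<subseteq> Q \<and> Q' \<noteq> {} \<and> closedin (subtopology T Q) Q' \<and> convex Q' \<and> invariant a Q'
      \<longrightarrow> Q' = Q)"

definition affine_hom ::
    "'v::real_vector topology \<Rightarrow> 'v set \<Rightarrow> ('g \<Rightarrow> 'v \<Rightarrow> 'v) \<Rightarrow>
     'w::real_vector topology \<Rightarrow> 'w set \<Rightarrow> ('g \<Rightarrow> 'w \<Rightarrow> 'w) \<Rightarrow> ('v \<Rightarrow> 'w) \<Rightarrow> bool"
  where "affine_hom T Q a T' Q' a' f \<longleftrightarrow>
    system_hom (subtopology T Q) a (subtopology T' Q') a' f \<and> affine_map_on Q f"

definition affine_isomorphism ::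
    "'v::real_vector topology \<Rightarrow> 'v set \<Rightarrow> ('g \<Rightarrow> 'v \<Rightarrow> 'v) \<Rightarrow>
     'w::real_vector topology \<Rightarrow> 'w set \<Rightarrow> ('g \<Rightarrow> 'w \<Rightarrow> 'w) \<Rightarrow> ('v \<Rightarrow> 'w) \<Rightarrow> bool"
  where "affine_isomorphism T Q a T' Q' a' f \<longleftrightarrow>
    affine_hom T Q a T' Q' a' f \<and> bij_betw f Q Q'"

text \<open>
  The affine factors \<open>\<pi> : Q \<rightarrow> Q'\<close> in the next definition range over all locally convex
  topologies on the vector space \<^typ>\<open>('v \<Rightarrow> real) \<Rightarrow> real\<close>. Up to affine isomorphism these are
  all the affine factors of \<open>Q\<close>. The continuous affine functions on \<open>Q'\<close> separate points, and
  such a function \<open>h\<close> is determined by \<open>h \<circ> \<pi>\<close> on \<open>Q\<close>. Hence \<open>Q'\<close> is embedded in the product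
  topology by sending \<open>q\<close> to the map with value \<open>h(q)\<close> at each extension of some \<open>h \<circ> \<pi>\<close> to a
  function on \<^typ>\<open>'v\<close>, and value \<open>0\<close> at all other functions.
\<close>

definition affinely_prime_affine_system ::
    "bool \<Rightarrow> 'v::real_vector topology \<Rightarrow> 'v set \<Rightarrow> ('g::topological_group_add \<Rightarrow> 'v \<Rightarrow> 'v) \<Rightarrow> bool"
  where "affinely_prime_affine_system metr T Q a \<longleftrightarrow> affine_system metr T Q a \<and>
    (\<forall>(T'::(('v \<Rightarrow> real) \<Rightarrow> real) topology) Q' a' \<pi>.
      affine_system metr T' Q' a' \<and> nontrivial Q' \<and>
      affine_hom T Q a T' Q' a' \<pi> \<and> \<pi> ` Q = Q' \<longrightarrow> inj_on \<pi> Q)"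

definition affinely_prime ::
    "bool \<Rightarrow> 'x topology \<Rightarrow> ('g::topological_group_add \<Rightarrow> 'x \<Rightarrow> 'x) \<Rightarrow> bool"
  where "affinely_prime metr X a \<longleftrightarrow> dynamical_system metr X a \<and>
    affinely_prime_affine_system metr weak_star (prob_space_of X) (induced_action a)"

end

(*
  Write a state for a positive normalised linear functional on C(X). By the Riesz representation
  theorem, M(X) is the space of states, so it is compact.

  M(X) is irreducible: strong proximality puts a point mass into every closed invariant set of
  states, minimality then puts all of them there, and their closed convex hull is M(X).

  Conversely, let Q be irreducible. It has an extreme point q. For a state mu on the orbit closure Y
  of q, the barycentre map sends the closed convex invariant set of states generated by mu onto Q, so
  some state in it has barycentre q; as q is extreme, this state is the point mass at q. The point
  mass at q has a neighbourhood base of complements of closed convex sets, so it is even in the orbit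
  closure of mu. Hence Y is minimal and strongly proximal, there is a factor map from the universal
  system X to Y, and the barycentre map gives M(X) -> Q. It is onto by irreducibility. Two such maps
  agree at a preimage of q under their mean, and therefore everywhere by irreducibility of M(X).
*)

theory Submission
  imports Defs
begin

section \<open>Dynamical systems\<close>

text \<open>A state whose barycentre \<open>q\<close> is extreme is a point mass for the following
  reason. Let \<open>h\<close> be continuous and affine with \<open>h q = 0\<close>, bounded by
  \<open>B\<close> in absolute value. Reweighting the state by \<open>1/2 + h/(2B)\<close> and by
  \<open>1/2 - h/(2B)\<close> splits it into two halves; extremality keeps both barycentres at
  \<open>q\<close>, so \<open>h\<close> has variance zero, and such functions separate points. The
  closed convex sets near the point mass are given by \<open>\<nu> u \<ge> e\<close> with
  \<open>u\<close> nonnegative and zero at the point. Imposing the inequality on all translates of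
  \<open>u\<close> makes them invariant, so irreducibility of \<open>Q\<close> applies to them
  without forming a hull. The orbit closure of a single extreme point is used, not the closure of
  all of them: a dense orbit lets points be coded by families of subsets of the group, and these are
  the only carriers on which universality is tested. Separation by linear functionals is used in
  \<open>Q\<close> alone. For states, density of the convex hull of the point masses reduces to a
  least squares problem over finitely many functions.\<close>

lemma dynamical_system_homeo:
  assumes "dynamical_system metr X a"
  shows "homeomorphic_map X X (a g)"
proof -
  have "a g \<in> topspace (Homeo X)"
    using assms continuous_map_image_subset_topspace[of euclidean "Homeo X" a]
    by (auto simp: dynamical_system_def)
  then show ?thesis
    by (simp add: Homeo_def)
qed

lemma dynamical_system_continuous:
  assumes "dynamical_system metr X a"
  shows "continuous_map X X (a g)"
  using dynamical_system_homeo[OF assms] by (rule homeomorphic_imp_continuous_map)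

lemma dynamical_system_in_topspace:
  assumes "dynamical_system metr X a" "x \<in> topspace X"
  shows "a g x \<in> topspace X"
  using continuous_map_funspace[OF dynamical_system_continuous[OF assms(1)]] assms(2) by blast

lemma dynamical_system_add:
  assumes "dynamical_system metr X a" "x \<in> topspace X"
  shows "a (g + h) x = a g (a h x)"
  using assms by (simp add: dynamical_system_def)

text \<open>The definition of a system imposes only \<open>a (g + h) x = a g (a h x)\<close>. Thus
  \<open>a 0\<close> is idempotent on the space, and an injective idempotent map is the
  identity.\<close>

lemma dynamical_system_zero:
  assumes "dynamical_system metr X a" "x \<in> topspace X"
  shows "a 0 x = x"
proof -
  have "a 0 (a 0 x) = a 0 x"
    using dynamical_system_add[OF assms, of 0 0] by simp
  moreover have "inj_on (a 0) (topspace X)"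
    using dynamical_system_homeo[OF assms(1)] by (simp add: homeomorphic_eq_everything_map)
  ultimately show ?thesis
    using assms(2) dynamical_system_in_topspace[OF assms] by (meson inj_onD)
qed

text \<open>In a regular space \<open>x\<close> has a closed, hence compact, neighbourhood
  \<open>K\<close> that \<open>a g\<close> carries into \<open>W\<close>. Carrying \<open>K\<close>
  into \<open>W\<close> is an open condition in the compact-open topology, so it persists for group
  elements near \<open>g\<close>.\<close>

lemma dynamical_system_jointly_continuous:
  assumes X: "dynamical_system metr X a"
  shows "continuous_map (prod_topology euclidean X) X (\<lambda>(g, x). a g x)"
  unfolding continuous_map_atin limitin_def
proof (intro ballI conjI allI impI)
  fix p :: "'b \<times> 'a" assume "p \<in> topspace (prod_topology euclidean X)"
  then obtain g x where p: "p = (g, x)" and x: "x \<in> topspace X" by auto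
  then show "(case p of (g, x) \<Rightarrow> a g x) \<in> topspace X"
    using dynamical_system_in_topspace[OF X] by simp
  fix W assume W: "openin X W \<and> (case p of (g, x) \<Rightarrow> a g x) \<in> W"
  have "compact_space X" "Hausdorff_space X"
    using X by (auto simp: dynamical_system_def)
  then have "regular_space X" by (simp add: compact_Hausdorff_imp_regular_space)
  moreover have "openin X {y \<in> topspace X. a g y \<in> W}"
    using openin_continuous_map_preimage[OF dynamical_system_continuous[OF X]] W by blast
  ultimately obtain U K where U: "openin X U" "closedin X K" "x \<in> U" "U \<subseteq> K"
    "K \<subseteq> {y \<in> topspace X. a g y \<in> W}"
    using W x p unfolding neighbourhood_base_of_closedin[symmetric] neighbourhood_base_of
    by (smt (verit, ccfv_threshold) case_prod_conv mem_Collect_eq)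
  have K: "compactin X K"
    using U(2) \<open>compact_space X\<close> closedin_compact_space by blast
  define N where "N = {h. a h ` K \<subseteq> W}"
  have "openin (compact_open X X) {f. f ` K \<subseteq> W}"
    unfolding compact_open_def using K W by (intro topology_generated_by_Basis) auto
  moreover have "continuous_map euclidean (compact_open X X) a"
    using X by (auto simp: dynamical_system_def Homeo_def continuous_map_in_subtopology)
  ultimately have "openin euclidean {h \<in> topspace euclidean. a h \<in> {f. f ` K \<subseteq> W}}"
    by (rule openin_continuous_map_preimage[rotated])
  then have "openin euclidean N" by (simp add: N_def)
  then have "openin (prod_topology euclidean X) (N \<times> U)"
    using U by (simp add: openin_prod_Times_iff)
  moreover have "p \<in> N \<times> U" using U p by (auto simp: N_def)
  ultimately show "\<forall>\<^sub>F q in atin (prod_topology euclidean X) p. (case q of (g, x) \<Rightarrow> a g x) \<in> W"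
    unfolding eventually_atin using U(4)
    by (intro disjI2 exI[of _ "N \<times> U"]) (auto simp: N_def image_subset_iff subset_iff)
qed

text \<open>Joint continuity and the action laws are easier to verify and to transport than
  continuity into the compact-open topology. The latter follows by the tube argument of Wallace, and
  \<open>a (- g)\<close> inverts \<open>a g\<close>.\<close>

lemma dynamical_systemI:
  assumes "topspace X \<noteq> {}" "compact_space X" "Hausdorff_space X" "metr \<Longrightarrow> metrizable_space X"
    and joint: "continuous_map (prod_topology euclidean X) X (\<lambda>(g, x). a g x)"
    and add: "\<And>g h x. x \<in> topspace X \<Longrightarrow> a (g + h) x = a g (a h x)"
    and zero: "\<And>x. x \<in> topspace X \<Longrightarrow> a 0 x = x"
  shows "dynamical_system metr X a"
proof -
  have cont: "continuous_map X X (a g)" for g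
  proof -
    have "continuous_map X (prod_topology euclidean X) (\<lambda>x. (g, x))"
      by (simp add: continuous_map_pairedI)
    from continuous_map_compose[OF this joint] show ?thesis by (simp add: comp_def)
  qed
  have "homeomorphic_maps X X (a g) (a (- g))" for g
    unfolding homeomorphic_maps_def
    using cont add[of _ g "- g"] add[of _ "- g" g] zero by simp
  then have homeo: "homeomorphic_map X X (a g)" for g
    using homeomorphic_map_maps by blast
  have "continuous_map euclidean (compact_open X X) a"
    unfolding compact_open_def
  proof (rule continuous_on_generated_topo)
    \<comment> \<open>\<open>continuous_on_generated_topo\<close> asks that every value lie in some
      generator; \<open>K = {}\<close> and \<open>U = {}\<close> give one that contains all
      maps.\<close>
    have "{f::'a \<Rightarrow> 'a. f ` {} \<subseteq> {}} \<in> {{f. f ` K \<subseteq> U} |K U. compactin X K \<and> openin X U}"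
      by (intro CollectI exI[of _ "{}"]) simp
    then show "a ` topspace euclidean \<subseteq> \<Union> {{f. f ` K \<subseteq> U} |K U. compactin X K \<and> openin X U}"
      by auto
  next
    fix S assume "S \<in> {{f. f ` K \<subseteq> U} |K U. compactin X K \<and> openin X U}"
    then obtain K U where S: "S = {f. f ` K \<subseteq> U}" and KU: "compactin X K" "openin X U" by blast
    have "\<exists>N. openin euclidean N \<and> g \<in> N \<and> N \<subseteq> {g. a g ` K \<subseteq> U}" if g: "a g ` K \<subseteq> U" for g
    proof -
      have W: "openin (prod_topology euclidean X)
          {p \<in> topspace (prod_topology euclidean X). (\<lambda>(g, x). a g x) p \<in> U}" (is "openin _ ?W")
        using openin_continuous_map_preimage[OF joint] KU by blast
      have g1: "compactin euclidean {g}" by simp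
      have g2: "{g} \<times> K \<subseteq> ?W" using g KU compactin_subset_topspace by fastforce
      obtain N V where N: "openin euclidean N" "openin X V" "{g} \<subseteq> N" "K \<subseteq> V" "N \<times> V \<subseteq> ?W"
        by (rule Wallace_theorem_prod_topology[OF g1 KU(1) W g2])
      have "a h y \<in> U" if "h \<in> N" "y \<in> K" for h y
        using subsetD[OF N(5), of "(h, y)"] subsetD[OF N(4)] that by simp
      then show ?thesis using N(1,3) by (intro exI[of _ N]) auto
    qed
    then have "openin euclidean {g. a g ` K \<subseteq> U}"
      by (subst openin_subopen) blast
    then show "openin euclidean (a -` S \<inter> topspace euclidean)"
      by (simp add: S vimage_def)
  qed
  then have "continuous_map euclidean (Homeo X) a"
    using homeo by (simp add: Homeo_def continuous_map_in_subtopology image_subset_iff)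
  then show ?thesis
    using assms by (simp add: dynamical_system_def)
qed

lemma dynamical_system_subtopology:
  assumes X: "dynamical_system metr X a" and C: "closedin X C" "C \<noteq> {}" "invariant a C"
  shows "dynamical_system metr (subtopology X C) a"
proof (rule dynamical_systemI)
  have sub: "C \<subseteq> topspace X" using C closedin_subset by blast
  show "topspace (subtopology X C) \<noteq> {}" using C sub by auto
  show "compact_space (subtopology X C)"
    using X C closedin_compact_space compact_space_subtopology by (auto simp: dynamical_system_def)
  show "Hausdorff_space (subtopology X C)"
    using X Hausdorff_space_subtopology by (auto simp: dynamical_system_def)
  show "metr \<Longrightarrow> metrizable_space (subtopology X C)"
    using X metrizable_space_subtopology by (auto simp: dynamical_system_def)
  show "continuous_map (prod_topology euclidean (subtopology X C)) (subtopology X C) (\<lambda>(g, x). a g x)"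
    using continuous_map_from_subtopology[OF dynamical_system_jointly_continuous[OF X], of "UNIV \<times> C"] C
    by (force simp: continuous_map_in_subtopology subtopology_Times invariant_def image_subset_iff)
qed (use dynamical_system_add[OF X] dynamical_system_zero[OF X] C in auto)

text \<open>Serves to realise orbit closures and affine factors on the particular types over which
  universality and affine primeness quantify.\<close>

lemma dynamical_system_transport:
  assumes X: "dynamical_system metr X a" and ij: "homeomorphic_maps X Y i j"
    and b: "\<And>g y. y \<in> topspace Y \<Longrightarrow> b g y = i (a g (j y))"
  shows "dynamical_system metr Y b"
proof (rule dynamical_systemI)
  have sp: "X homeomorphic_space Y" using ij unfolding homeomorphic_space_def by blast
  have i: "continuous_map X Y i" and j: "continuous_map Y X j"
    and inv: "\<And>x. x \<in> topspace X \<Longrightarrow> j (i x) = x" "\<And>y. y \<in> topspace Y \<Longrightarrow> i (j y) = y"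
    using ij by (auto simp: homeomorphic_maps_def)
  have jt: "j y \<in> topspace X" if "y \<in> topspace Y" for y
    using continuous_map_funspace[OF j] that by blast
  have it: "i y \<in> topspace Y" if "y \<in> topspace X" for y
    using continuous_map_funspace[OF i] that by blast
  show "topspace Y \<noteq> {}" "compact_space Y" "Hausdorff_space Y" "metr \<Longrightarrow> metrizable_space Y"
    using X homeomorphic_empty_space[OF sp] homeomorphic_compact_space[OF sp]
      homeomorphic_Hausdorff_space[OF sp] homeomorphic_metrizable_space[OF sp]
    by (auto simp: dynamical_system_def)
  have "continuous_map (prod_topology euclidean Y) (prod_topology euclidean X) (\<lambda>(g, y). (g, j y))"
    using j by (simp add: continuous_map_prod_top)
  from continuous_map_compose[OF continuous_map_compose[OF this dynamical_system_jointly_continuous[OF X]] i]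
  show "continuous_map (prod_topology euclidean Y) Y (\<lambda>(g, x). b g x)"
    by (rule continuous_map_eq) (auto simp: b)
  show "b (g + h) y = b g (b h y)" if "y \<in> topspace Y" for g h y
    using that b dynamical_system_add[OF X] jt inv dynamical_system_in_topspace[OF X] it by simp
  show "b 0 y = y" if "y \<in> topspace Y" for y
    using that b dynamical_system_zero[OF X] jt inv by simp
qed

section \<open>States\<close>

text \<open>
  By the Riesz representation theorem below, these are exactly the points of \<^term>\<open>prob_space_of X\<close>.
\<close>

definition states :: "'x topology \<Rightarrow> (('x \<Rightarrow> real) \<Rightarrow> real) set"
  where "states X = {L. (\<forall>f. \<not> continuous_map X euclideanreal f \<longrightarrow> L f = 0) \<and> L (\<lambda>_. 1) = 1 \<and>
    (\<forall>f g. continuous_map X euclideanreal f \<and> continuous_map X euclideanreal g \<longrightarrow>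
      L (\<lambda>x. f x + g x) = L f + L g) \<and>
    (\<forall>c f. continuous_map X euclideanreal f \<longrightarrow> L (\<lambda>x. c * f x) = c * L f) \<and>
    (\<forall>f. continuous_map X euclideanreal f \<and> (\<forall>x\<in>topspace X. 0 \<le> f x) \<longrightarrow> 0 \<le> L f)}"

lemma statesI:
  assumes "\<And>f. \<not> continuous_map X euclideanreal f \<Longrightarrow> L f = 0" "L (\<lambda>_. 1) = 1"
    "\<And>f g. continuous_map X euclideanreal f \<Longrightarrow> continuous_map X euclideanreal g \<Longrightarrow>
      L (\<lambda>x. f x + g x) = L f + L g"
    "\<And>c f. continuous_map X euclideanreal f \<Longrightarrow> L (\<lambda>x. c * f x) = c * L f"
    "\<And>f. continuous_map X euclideanreal f \<Longrightarrow> (\<And>x. x \<in> topspace X \<Longrightarrow> 0 \<le> f x) \<Longrightarrow> 0 \<le> L f"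
  shows "L \<in> states X"
  using assms by (simp add: states_def)

context
  fixes X :: "'x topology" and L
  assumes L: "L \<in> states X"
begin

lemma state_outside: "\<not> continuous_map X euclideanreal f \<Longrightarrow> L f = 0"
  using L by (simp add: states_def)

lemma state_one: "L (\<lambda>_. 1) = 1"
  using L by (simp add: states_def)

lemma state_add:
  "continuous_map X euclideanreal f \<Longrightarrow> continuous_map X euclideanreal g \<Longrightarrow>
    L (\<lambda>x. f x + g x) = L f + L g"
  using L by (simp add: states_def)

lemma state_cmult: "continuous_map X euclideanreal f \<Longrightarrow> L (\<lambda>x. c * f x) = c * L f"
  using L by (simp add: states_def)

lemma state_nonneg:
  "continuous_map X euclideanreal f \<Longrightarrow> (\<And>x. x \<in> topspace X \<Longrightarrow> 0 \<le> f x) \<Longrightarrow> 0 \<le> L f"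
  using L by (simp add: states_def)

lemma state_const: "L (\<lambda>_. c) = c"
  using state_cmult[of "\<lambda>_. 1" c] state_one by simp

lemma state_minus: "continuous_map X euclideanreal f \<Longrightarrow> L (\<lambda>x. - f x) = - L f"
  using state_cmult[of f "-1"] by simp

lemma state_diff:
  "continuous_map X euclideanreal f \<Longrightarrow> continuous_map X euclideanreal g \<Longrightarrow>
    L (\<lambda>x. f x - g x) = L f - L g"
  using state_add[of f "\<lambda>x. - g x"] state_minus[of g] by simp

lemma state_mono:
  assumes "continuous_map X euclideanreal f" "continuous_map X euclideanreal g"
    "\<And>x. x \<in> topspace X \<Longrightarrow> f x \<le> g x"
  shows "L f \<le> L g"
  using state_nonneg[of "\<lambda>x. g x - f x"] state_diff[of g f] assms
  by (simp add: continuous_map_diff)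

text \<open>A state takes total functions as arguments, although only their values on
  \<open>topspace X\<close> matter. Continuity depends on these values alone, so in the
  discontinuous case both functions get the default value 0.\<close>

lemma state_cong:
  assumes "\<And>x. x \<in> topspace X \<Longrightarrow> f x = g x"
  shows "L f = L g"
proof (cases "continuous_map X euclideanreal f")
  case True
  moreover from this have "continuous_map X euclideanreal g"
    using assms by (rule continuous_map_eq)
  ultimately show ?thesis
    using assms by (intro antisym state_mono) auto
next
  case False
  then have "\<not> continuous_map X euclideanreal g"
    using assms continuous_map_eq by metis
  with False show ?thesis by (simp add: state_outside)
qed

lemma state_sum:
  assumes "finite I" "\<And>i. i \<in> I \<Longrightarrow> continuous_map X euclideanreal (f i)"
  shows "L (\<lambda>x. \<Sum>i\<in>I. f i x) = (\<Sum>i\<in>I. L (f i))"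
  using assms
proof (induction I rule: finite_induct)
  case empty
  then show ?case using state_const[of 0] by simp
next
  case (insert i I)
  then show ?case
    using state_add[of "f i" "\<lambda>x. \<Sum>i\<in>I. f i x"] by (simp add: continuous_map_sum)
qed

lemma state_abs_le:
  assumes f: "continuous_map X euclideanreal f" and "\<And>x. x \<in> topspace X \<Longrightarrow> \<bar>f x\<bar> \<le> B"
  shows "\<bar>L f\<bar> \<le> B"
proof -
  have "L f \<le> B"
    using state_mono[of f "\<lambda>_. B"] state_const assms by (simp add: abs_le_iff)
  moreover have "- B \<le> L f"
    using state_mono[of "\<lambda>_. - B" f] state_const assms by (force simp: abs_le_iff)
  ultimately show ?thesis by simp
qed

lemma state_abs_diff_le:
  assumes f: "continuous_map X euclideanreal f" "continuous_map X euclideanreal g"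
    and "\<And>x. x \<in> topspace X \<Longrightarrow> \<bar>f x - g x\<bar> \<le> B"
  shows "\<bar>L f - L g\<bar> \<le> B"
  using state_abs_le[of "\<lambda>x. f x - g x" B] assms by (simp add: state_diff continuous_map_diff)

end

lemma continuous_map_bounded:
  assumes "compact_space X" "continuous_map X euclideanreal f"
  obtains B where "B > 0" "\<And>x. x \<in> topspace X \<Longrightarrow> \<bar>f x\<bar> \<le> B"
proof -
  have "compactin euclideanreal (f ` topspace X)"
    using image_compactin[OF _ assms(2)] assms(1) unfolding compact_space_def by blast
  then have "bounded (f ` topspace X)"
    by (simp add: compact_imp_bounded)
  then obtain B where "\<forall>x\<in>topspace X. \<bar>f x\<bar> \<le> B"
    by (auto simp: bounded_iff)
  then show ?thesis
    by (intro that[of "max B 1"]) force+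
qed

lemma borel_measurable_continuous_map:
  assumes "continuous_map X euclideanreal f"
  shows "f \<in> borel_measurable (borel_algebra X)"
proof -
  have "sets (borel_algebra euclideanreal) = sets (borel :: real measure)"
    by (simp add: borel_algebra_def borel_def)
  moreover have "f \<in> measurable (borel_algebra X) (borel_algebra euclideanreal)"
    using measurable_borel_algebra[OF assms, of "borel_algebra X"]
    by (simp add: borel_algebra_def space_measure_of_conv)
  ultimately show ?thesis by (simp cong: measurable_cong_sets)
qed

lemma space_borel_algebra [simp]: "space (borel_algebra X) = topspace X"
  by (simp add: borel_algebra_def space_measure_of_conv)

lemma point_mass_eq:
  assumes "x \<in> topspace X"
  shows "point_mass X x = (\<lambda>f. if continuous_map X euclideanreal f then f x else 0)"
  using assms
  by (auto simp: point_mass_def integration_def fun_eq_iff integral_return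
      borel_measurable_continuous_map)

lemma point_mass_apply:
  "x \<in> topspace X \<Longrightarrow> continuous_map X euclideanreal f \<Longrightarrow> point_mass X x f = f x"
  by (simp add: point_mass_eq)

lemma point_mass_in_states: "x \<in> topspace X \<Longrightarrow> point_mass X x \<in> states X"
  by (rule statesI) (auto simp: point_mass_eq continuous_map_add continuous_map_real_mult_left)

lemma continuous_map_prob_measures_integrable:
  assumes X: "compact_space X" and mu: "\<mu> \<in> prob_measures X" and f: "continuous_map X euclideanreal f"
  shows "integrable \<mu> f"
proof -
  interpret prob_space \<mu> using mu by (simp add: prob_measures_def)
  have sp: "space \<mu> = topspace X" "sets \<mu> = sets (borel_algebra X)"
    using mu by (auto simp: prob_measures_def)
  obtain B where "\<And>x. x \<in> topspace X \<Longrightarrow> \<bar>f x\<bar> \<le> B"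
    using continuous_map_bounded[OF X f] by blast
  moreover have "f \<in> borel_measurable \<mu>"
    using borel_measurable_continuous_map[OF f] sp(2) by (simp cong: measurable_cong_sets)
  ultimately show ?thesis
    using sp by (intro integrable_const_bound[where B = B]) auto
qed

lemma prob_space_of_subset_states:
  assumes X: "compact_space X"
  shows "prob_space_of X \<subseteq> states X"
proof
  fix L assume "L \<in> prob_space_of X"
  then obtain \<mu> where mu: "\<mu> \<in> prob_measures X" and L: "L = integration X \<mu>"
    by (auto simp: prob_space_of_def)
  interpret prob_space \<mu> using mu by (simp add: prob_measures_def)
  have sp: "space \<mu> = topspace X"
    using mu by (auto simp: prob_measures_def)
  note int = continuous_map_prob_measures_integrable[OF X mu]
  show "L \<in> states X"
    by (rule statesI)
      (auto simp: L integration_def int continuous_map_add continuous_map_real_mult_left sp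
        prob_space[unfolded sp]
        intro!: Bochner_Integration.integral_nonneg)
qed

text \<open>The push-forward of a state. The conditional is there because
  \<open>f \<circ> \<phi>\<close> may be continuous for a discontinuous \<open>f\<close>.\<close>

lemma state_compose:
  assumes L: "L \<in> states X" and \<phi>: "continuous_map X Y \<phi>"
  shows "(\<lambda>f. if continuous_map Y euclideanreal f then L (f \<circ> \<phi>) else 0) \<in> states Y"
proof -
  have cm: "continuous_map X euclideanreal (\<lambda>x. f (\<phi> x))" if "continuous_map Y euclideanreal f" for f
    using continuous_map_compose[OF \<phi> that] by (simp add: comp_def)
  have "\<phi> x \<in> topspace Y" if "x \<in> topspace X" for x
    using continuous_map_funspace[OF \<phi>] that by blast
  then show ?thesis
    by (intro statesI)
      (auto simp: comp_def cm state_one[OF L] continuous_map_add continuous_map_real_mult_left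
        state_add[OF L] state_cmult[OF L] intro!: state_nonneg[OF L])
qed

text \<open>A homeomorphism is a quotient map, so \<open>f \<circ> a g\<close> is continuous exactly
  when \<open>f\<close> is. Therefore \<open>induced_action\<close>, which has no conditional, still
  respects the default value 0.\<close>

lemma induced_action_in_states:
  assumes X: "dynamical_system metr X a" and L: "L \<in> states X"
  shows "induced_action a g L \<in> states X"
proof -
  have "induced_action a g L = (\<lambda>f. if continuous_map X euclideanreal f then L (f \<circ> a g) else 0)"
  proof
    fix f :: "'a \<Rightarrow> real"
    have "continuous_map X euclideanreal (f \<circ> a g) \<longleftrightarrow> continuous_map X euclideanreal f"
      using dynamical_system_homeo[OF X, of g] continuous_map_compose[OF dynamical_system_continuous[OF X]]
      by (metis continuous_compose_quotient_map_eq homeomorphic_map_def)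
    then show "induced_action a g L f = (if continuous_map X euclideanreal f then L (f \<circ> a g) else 0)"
      using state_outside[OF L] by (simp add: induced_action_def)
  qed
  then show ?thesis
    using state_compose[OF L dynamical_system_continuous[OF X]] by simp
qed

lemma induced_action_point_mass:
  assumes X: "dynamical_system metr X a" and x: "x \<in> topspace X"
  shows "induced_action a g (point_mass X x) = point_mass X (a g x)"
proof
  fix f :: "'a \<Rightarrow> real"
  have *: "continuous_map X euclideanreal (f \<circ> a g) \<longleftrightarrow> continuous_map X euclideanreal f"
    using dynamical_system_homeo[OF X, of g] continuous_map_compose[OF dynamical_system_continuous[OF X]]
    by (metis continuous_compose_quotient_map_eq homeomorphic_map_def)
  then show "induced_action a g (point_mass X x) f = point_mass X (a g x) f"
    unfolding induced_action_def point_mass_eq[OF x] point_mass_eq[OF dynamical_system_in_topspace[OF X x]]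
    by simp
qed

lemma scaleR_fun_apply [simp]: "(c *\<^sub>R L) f = c * L f" for L :: "'a \<Rightarrow> real"
  by (simp add: scaleR_fun_def)

lemma convex_states: "convex (states X)"
proof (rule convexI)
  fix L M and u v :: real
  assume LM: "L \<in> states X" "M \<in> states X" and uv: "0 \<le> u" "0 \<le> v" "u + v = 1"
  show "u *\<^sub>R L + v *\<^sub>R M \<in> states X" (is "?K \<in> _")
  proof (rule statesI)
    show "?K (\<lambda>_. 1) = 1"
      using uv by (simp add: state_one[OF LM(1)] state_one[OF LM(2)])
    fix f assume f: "continuous_map X euclideanreal f"
    show "?K (\<lambda>x. f x + g x) = ?K f + ?K g" if "continuous_map X euclideanreal g" for g
      by (simp add: state_add[OF LM(1) f that] state_add[OF LM(2) f that] distrib_left)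
    show "?K (\<lambda>x. c * f x) = c * ?K f" for c
      by (simp add: state_cmult[OF LM(1) f] state_cmult[OF LM(2) f] distrib_left)
    show "0 \<le> ?K f" if "\<And>x. x \<in> topspace X \<Longrightarrow> 0 \<le> f x"
      using uv state_nonneg[OF LM(1) f that] state_nonneg[OF LM(2) f that] by simp
  qed (simp add: state_outside[OF LM(1)] state_outside[OF LM(2)])
qed


section \<open>The weak-star topology\<close>

lemma topspace_weak_star [simp]: "topspace weak_star = UNIV"
  by (simp add: weak_star_def)

lemma weak_star_eq_euclidean: "weak_star = euclidean"
  by (simp add: weak_star_def euclidean_product_topology)

lemma continuous_map_weak_star_iff:
  "continuous_map X weak_star \<phi> \<longleftrightarrow> (\<forall>f. continuous_map X euclideanreal (\<lambda>x. \<phi> x f))"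
  by (simp add: weak_star_def continuous_map_componentwise_UNIV)

lemma continuous_map_weak_star_apply: "continuous_map weak_star euclideanreal (\<lambda>L. L f)"
  using continuous_map_product_coordinates[of f UNIV "\<lambda>_. euclideanreal"] by (simp add: weak_star_def)

lemma Hausdorff_weak_star: "Hausdorff_space weak_star"
  by (simp add: weak_star_def Hausdorff_space_product_topology)

lemma weak_star_neighbourhood:
  assumes "openin weak_star U" "L \<in> U"
  obtains F \<epsilon> where "finite F" "\<epsilon> > 0" "\<forall>M. (\<forall>f\<in>F. \<bar>M f - L f\<bar> < \<epsilon>) \<longrightarrow> M \<in> U"
proof -
  obtain B where B: "L \<in> (\<Pi>\<^sub>E i\<in>UNIV. B i)" "\<And>i. openin euclideanreal (B i)"
    "finite {i. B i \<noteq> UNIV}" "(\<Pi>\<^sub>E i\<in>UNIV. B i) \<subseteq> U"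
    using product_topology_open_contains_basis[where T = "\<lambda>_. euclideanreal" and I = UNIV and U = U and x = L] assms
    unfolding weak_star_def by auto
  define F where "F = {i. B i \<noteq> UNIV}"
  have "\<exists>e>0. ball (L f) e \<subseteq> B f" for f
    using B(1) B(2)[of f] by (auto simp: open_contains_ball)
  then obtain e where e: "\<And>f. e f > 0" "\<And>f. ball (L f) (e f) \<subseteq> B f"
    by metis
  \<comment> \<open>The extra 1 keeps the minimum meaningful when no coordinate is
    constrained.\<close>
  define \<epsilon> where "\<epsilon> = Min (insert 1 (e ` F))"
  have fin: "finite F" using B by (simp add: F_def)
  have "M \<in> U" if M: "\<forall>f\<in>F. \<bar>M f - L f\<bar> < \<epsilon>" for M
  proof -
    have "M f \<in> B f" for f
    proof (cases "f \<in> F")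
      case True
      then have "\<epsilon> \<le> e f" using fin by (auto simp: \<epsilon>_def)
      then have "M f \<in> ball (L f) (e f)"
        using M[rule_format, OF True] by (simp add: dist_real_def abs_minus_commute)
      then show ?thesis using e by blast
    qed (simp add: F_def)
    then show "M \<in> U" using B by auto
  qed
  moreover have "\<epsilon> > 0" using fin e by (auto simp: \<epsilon>_def)
  ultimately show ?thesis using that fin by blast
qed

lemma locally_convex_tvs_weak_star: "locally_convex_tvs weak_star"
  unfolding locally_convex_tvs_def
proof (intro conjI allI impI)
  show "topspace weak_star = (UNIV :: (('a \<Rightarrow> real) \<Rightarrow> real) set)" by simp
  show "Hausdorff_space (weak_star :: (('a \<Rightarrow> real) \<Rightarrow> real) topology)" by (rule Hausdorff_weak_star)
  show "continuous_map (prod_topology weak_star weak_star) (weak_star :: (('a \<Rightarrow> real) \<Rightarrow> real) topology)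
      (\<lambda>(x, y). x + y)"
    unfolding continuous_map_weak_star_iff
    by (auto simp: case_prod_unfold intro!: continuous_map_add
       continuous_map_compose[OF continuous_map_snd continuous_map_weak_star_apply, unfolded comp_def]
       continuous_map_compose[OF continuous_map_fst continuous_map_weak_star_apply, unfolded comp_def])
  show "continuous_map (prod_topology euclideanreal weak_star) (weak_star :: (('a \<Rightarrow> real) \<Rightarrow> real) topology)
      (\<lambda>(c, x). c *\<^sub>R x)"
    unfolding continuous_map_weak_star_iff
    by (auto simp: case_prod_unfold scaleR_fun_def continuous_map_fst intro!: continuous_map_real_mult
       continuous_map_compose[OF continuous_map_snd continuous_map_weak_star_apply, unfolded comp_def])
  fix U :: "(('a \<Rightarrow> real) \<Rightarrow> real) set" assume "openin weak_star U \<and> 0 \<in> U"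
  then obtain F e where F: "finite F" "e > 0" 
    "\<forall>M. (\<forall>f\<in>F. \<bar>M f - (0 :: ('a \<Rightarrow> real) \<Rightarrow> real) f\<bar> < e) \<longrightarrow> M \<in> U"
    using weak_star_neighbourhood[of U 0] by metis
  define V :: "(('a \<Rightarrow> real) \<Rightarrow> real) set" where "V = (\<Inter>f\<in>F. {M. \<bar>M f\<bar> < e})"
  have "openin weak_star {M :: ('a \<Rightarrow> real) \<Rightarrow> real. \<bar>M f\<bar> < e}" for f
    using openin_continuous_map_preimage[OF continuous_map_weak_star_apply, of "{-e<..<e}" f]
    by (simp add: abs_less_iff conj_commute minus_less_iff)
  then have "openin weak_star V"
    unfolding V_def using F(1) openin_topspace[of "weak_star :: (('a \<Rightarrow> real) \<Rightarrow> real) topology"]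
    by (cases "F = {}") (auto intro!: openin_INT2)
  moreover have "convex V"
  proof -
    have "convex {M :: ('a \<Rightarrow> real) \<Rightarrow> real. \<bar>M f\<bar> < e}" for f
    proof (rule convexI)
      fix x y :: "('a \<Rightarrow> real) \<Rightarrow> real" and u v :: real
      assume xy: "x \<in> {M. \<bar>M f\<bar> < e}" "y \<in> {M. \<bar>M f\<bar> < e}" and "0 \<le> u" "0 \<le> v" "u + v = 1"
      then have "u *\<^sub>R x f + v *\<^sub>R y f \<in> ball 0 e"
        by (intro convexD[OF convex_ball]) auto
      then show "u *\<^sub>R x + v *\<^sub>R y \<in> {M. \<bar>M f\<bar> < e}"
        by (simp add: scaleR_fun_def)
    qed
    then show ?thesis unfolding V_def by (intro convex_INT) auto
  qed
  moreover have "0 \<in> V" "V \<subseteq> U" using F by (auto simp: V_def)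
  ultimately show "\<exists>V. openin weak_star V \<and> 0 \<in> V \<and> convex V \<and> V \<subseteq> U" by blast
qed

lemma closedin_states: "closedin weak_star (states X)"
proof -
  have c: "continuous_on UNIV (\<lambda>L :: ('a \<Rightarrow> real) \<Rightarrow> real. L f)" for f
    by (rule continuous_on_product_coordinates)
  let ?C = "continuous_map X euclideanreal"
  have eq: "states X = (\<Inter>f\<in>{f. \<not> ?C f}. {L. L f = 0}) \<inter> {L. L (\<lambda>_. 1) = 1} \<inter>
    (\<Inter>f\<in>{f. ?C f}. \<Inter>g\<in>{g. ?C g}. {L. L (\<lambda>x. f x + g x) = L f + L g}) \<inter>
    (\<Inter>c. \<Inter>f\<in>{f. ?C f}. {L. L (\<lambda>x. c * f x) = c * L f}) \<inter>
    (\<Inter>f\<in>{f. ?C f \<and> (\<forall>x\<in>topspace X. 0 \<le> f x)}. {L. 0 \<le> L f})"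
    unfolding states_def by auto
  have "closed (states X)"
    unfolding eq
    by (intro closed_Int closed_INT ballI closed_Collect_eq closed_Collect_le c continuous_intros)
  then show ?thesis by (simp add: weak_star_eq_euclidean)
qed

text \<open>Banach-Alaoglu in this encoding: each coordinate of a state is bounded by a constant
  depending on \<open>f\<close> only, namely a bound of \<open>f\<close>, or 0 when \<open>f\<close>
  is not continuous. So the states form a closed subset of a Tychonoff product of intervals.\<close>

lemma compactin_states:
  assumes "compact_space X"
  shows "compactin weak_star (states X)"
proof -
  have "\<exists>B. \<forall>L\<in>states X. \<bar>L f\<bar> \<le> B" for f
  proof (cases "continuous_map X euclideanreal f")
    case True
    then show ?thesis
      using continuous_map_bounded[OF assms True] state_abs_le[of _ X f] by metis
  next
    case False
    then show ?thesis using state_outside by (intro exI[of _ 0]) fastforce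
  qed
  then obtain B where B: "\<And>f L. L \<in> states X \<Longrightarrow> \<bar>L f\<bar> \<le> B f" by metis
  have "compactin weak_star (\<Pi>\<^sub>E f\<in>UNIV. {- B f..B f})"
    unfolding weak_star_def compactin_PiE by simp
  moreover have "states X \<subseteq> (\<Pi>\<^sub>E f\<in>UNIV. {- B f..B f})"
    using B by (auto simp: abs_le_iff minus_le_iff)
  ultimately show ?thesis
    using closedin_states closed_compactin by blast
qed

lemma continuous_map_point_mass: "continuous_map X weak_star (point_mass X)"
proof -
  have "continuous_map X euclideanreal (\<lambda>x. point_mass X x f)" for f
  proof (cases "continuous_map X euclideanreal f")
    case True
    then show ?thesis
      by (rule continuous_map_eq) (simp add: point_mass_apply True)
  next
    case False
    have "continuous_map X euclideanreal (\<lambda>x. 0 :: real)" by simp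
    then show ?thesis by (rule continuous_map_eq) (simp add: point_mass_eq False)
  qed
  then show ?thesis by (simp add: continuous_map_weak_star_iff)
qed

section \<open>The Riesz representation theorem\<close>

lemma Urysohn_01:
  assumes "compact_space X" "Hausdorff_space X" "closedin X S" "closedin X T" "S \<inter> T = {}"
  obtains f where "continuous_map X euclideanreal f" "\<And>x. x \<in> topspace X \<Longrightarrow> 0 \<le> f x \<and> f x \<le> (1 :: real)"
    "\<And>x. x \<in> S \<Longrightarrow> f x = 0" "\<And>x. x \<in> T \<Longrightarrow> f x = 1"
proof -
  have "normal_space X"
    using assms compact_Hausdorff_or_regular_imp_normal_space by blast
  then obtain f where f: "continuous_map X (top_of_set {0..1::real}) f" "f ` S \<subseteq> {0}" "f ` T \<subseteq> {1}"
    using Urysohn_lemma[of X S T 0 1] assms by (auto simp: disjnt_def)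
  show ?thesis
    by (rule that[of f]) (use f in \<open>auto simp: continuous_map_in_subtopology image_subset_iff\<close>)
qed

lemma point_separation:
  assumes "compact_space X" "Hausdorff_space X" "x \<in> topspace X" "y \<in> topspace X" "x \<noteq> y"
  obtains f where "continuous_map X euclideanreal f" "f x = 0" "f y = (1 :: real)"
proof -
  have "closedin X {x}" "closedin X {y}"
    using assms by (auto simp: closedin_Hausdorff_singleton)
  then show ?thesis
    using Urysohn_01[OF assms(1,2), of "{x}" "{y}"] assms(5) that by auto
qed

section \<open>From a state to a content on open sets and an outer measure\<close>

lemma add_le_trans: "b \<le> c \<Longrightarrow> a \<le> b + e \<Longrightarrow> a \<le> c + e" for a b c e :: ennreal
  by (meson add_right_mono order_trans)

text \<open>Only vanishing off \<open>U\<close> is required, not support inside \<open>U\<close>;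
  \<open>dominated_truncate\<close> recovers the missing room at a cost of \<open>e\<close>.\<close>

definition dominated :: "'x topology \<Rightarrow> 'x set \<Rightarrow> ('x \<Rightarrow> real) set"
  where "dominated X U = {f. continuous_map X euclideanreal f \<and>
    (\<forall>x\<in>topspace X. 0 \<le> f x \<and> f x \<le> 1) \<and> (\<forall>x\<in>topspace X - U. f x = 0)}"

definition content :: "'x topology \<Rightarrow> (('x \<Rightarrow> real) \<Rightarrow> real) \<Rightarrow> 'x set \<Rightarrow> ennreal"
  where "content X L U = (SUP f\<in>dominated X U. ennreal (L f))"

definition outer_content :: "'x topology \<Rightarrow> (('x \<Rightarrow> real) \<Rightarrow> real) \<Rightarrow> 'x set \<Rightarrow> ennreal"
  where "outer_content X L A = (INF U\<in>{U. openin X U \<and> A \<subseteq> U}. content X L U)"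

definition riesz_measure :: "'x topology \<Rightarrow> (('x \<Rightarrow> real) \<Rightarrow> real) \<Rightarrow> 'x measure"
  where "riesz_measure X L = measure_of (topspace X) {U. openin X U} (outer_content X L)"

context
  fixes X :: "'x topology" and L
  assumes X: "compact_space X" "Hausdorff_space X" and L: "L \<in> states X"
begin

lemma zero_dominated: "(\<lambda>_. 0) \<in> dominated X U"
  by (simp add: dominated_def)

lemma content_upper: "f \<in> dominated X U \<Longrightarrow> ennreal (L f) \<le> content X L U"
  by (auto simp: content_def intro: SUP_upper)

lemma content_mono: "U \<subseteq> V \<Longrightarrow> content X L U \<le> content X L V"
  unfolding content_def by (rule SUP_subset_mono) (auto simp: dominated_def)

lemma dominated_state_nonneg: "f \<in> dominated X U \<Longrightarrow> 0 \<le> L f"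
  using state_nonneg[OF L] by (simp add: dominated_def)

text \<open>\<open>max (f x - e) 0\<close> loses at most \<open>e\<close> under a normalised
  positive functional. It vanishes off the closed set where \<open>f \<ge> e\<close>, which lies in
  \<open>U\<close> because \<open>f\<close> is 0 off \<open>U\<close>.\<close>

lemma dominated_truncate:
  assumes "f \<in> dominated X U" "e > 0"
  obtains f' where "f' \<in> dominated X U" "L f \<le> L f' + e" "\<And>x. x \<in> topspace X \<Longrightarrow> f x \<le> e \<Longrightarrow> f' x = 0"
proof (rule that[of "\<lambda>x. max (f x - e) 0"])
  have f: "continuous_map X euclideanreal f" using assms by (simp add: dominated_def)
  have c: "continuous_map X euclideanreal (\<lambda>x. max (f x - e) 0)"
    by (intro continuous_intros f)
  show "(\<lambda>x. max (f x - e) 0) \<in> dominated X U"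
    using assms c by (auto simp: dominated_def)
  have "L f \<le> L (\<lambda>x. max (f x - e) 0 + e)"
    using c f by (intro state_mono[OF L]) (auto intro: continuous_intros)
  also have "\<dots> = L (\<lambda>x. max (f x - e) 0) + e"
    using state_add[OF L c, of "\<lambda>_. e"] state_const[OF L] by simp
  finally show "L f \<le> L (\<lambda>x. max (f x - e) 0) + e" .
qed auto

text \<open>After truncation \<open>f'\<close> vanishes off a closed set \<open>K\<close> inside
  \<open>U \<union> V\<close>. A Urysohn function \<open>g\<close> that is 0 off \<open>U\<close>
  and 1 on \<open>K - V\<close> splits \<open>f'\<close> into \<open>f' * g\<close>, dominated on
  \<open>U\<close>, and \<open>f' * (1 - g)\<close>, dominated on \<open>V\<close>.\<close>

lemma content_Un:
  assumes U: "openin X U" and V: "openin X V"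
  shows "content X L (U \<union> V) \<le> content X L U + content X L V"
  unfolding content_def[of X L "U \<union> V"]
proof (rule SUP_least)
  fix f assume f: "f \<in> dominated X (U \<union> V)"
  show "ennreal (L f) \<le> content X L U + content X L V"
  proof (rule ennreal_le_epsilon)
    fix e :: real assume "0 < e"
    obtain f' where f': "f' \<in> dominated X (U \<union> V)" "L f \<le> L f' + e"
      "\<And>x. x \<in> topspace X \<Longrightarrow> f x \<le> e \<Longrightarrow> f' x = 0"
      using dominated_truncate[OF f \<open>0 < e\<close>] by blast
    define K where "K = {x \<in> topspace X. f x \<in> {e..}}"
    have cf: "continuous_map X euclideanreal f" "continuous_map X euclideanreal f'"
      using f f' by (auto simp: dominated_def)
    have K: "closedin X K"
      unfolding K_def by (rule closedin_continuous_map_preimage[OF cf(1)]) simp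
    have "K \<subseteq> U \<union> V"
      using f \<open>0 < e\<close> by (force simp: K_def dominated_def)
    then have "(topspace X - U) \<inter> (K - V) = {}" by blast
    then obtain g where g: "continuous_map X euclideanreal g"
      "\<And>x. x \<in> topspace X \<Longrightarrow> 0 \<le> g x \<and> g x \<le> 1"
      "\<And>x. x \<in> topspace X - U \<Longrightarrow> g x = 0" "\<And>x. x \<in> K - V \<Longrightarrow> g x = 1"
      using Urysohn_01[OF X closedin_diff[OF closedin_topspace U] closedin_diff[OF K V]] by blast
    have z: "f' x = 0" if "x \<in> topspace X" "x \<notin> K" for x
      using f'(3)[of x] that by (simp add: K_def)
    have 1: "(\<lambda>x. f' x * g x) \<in> dominated X U"
      using f'(1) cf g by (auto simp: dominated_def continuous_map_real_mult mult_le_one)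
    have 2: "(\<lambda>x. f' x * (1 - g x)) \<in> dominated X V"
    proof -
      have "f' x * (1 - g x) = 0" if "x \<in> topspace X" "x \<notin> V" for x
        using z[of x] g(4)[of x] that by (cases "x \<in> K") auto
      moreover have "continuous_map X euclideanreal (\<lambda>x. f' x * (1 - g x))"
        by (intro continuous_intros cf g)
      moreover have "0 \<le> f' x * (1 - g x) \<and> f' x * (1 - g x) \<le> 1" if "x \<in> topspace X" for x
        using f'(1) g(2)[OF that] that by (auto simp: dominated_def intro!: mult_le_one)
      ultimately show ?thesis by (simp add: dominated_def)
    qed
    have "L f' = L (\<lambda>x. f' x * g x + f' x * (1 - g x))"
      by (simp add: algebra_simps)
    also have "\<dots> = L (\<lambda>x. f' x * g x) + L (\<lambda>x. f' x * (1 - g x))"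
      using 1 2 by (intro state_add[OF L]) (auto simp: dominated_def)
    finally have "L f' = L (\<lambda>x. f' x * g x) + L (\<lambda>x. f' x * (1 - g x))" .
    then have "ennreal (L f') \<le> content X L U + content X L V"
      using content_upper[OF 1] content_upper[OF 2] dominated_state_nonneg[OF 1] dominated_state_nonneg[OF 2]
      by (simp add: ennreal_plus add_mono)
    moreover have "ennreal (L f) \<le> ennreal (L f') + ennreal e"
      using f'(2) \<open>0 < e\<close> dominated_state_nonneg[OF f'(1)] by (simp flip: ennreal_plus add: ennreal_leI)
    ultimately show "ennreal (L f) \<le> content X L U + content X L V + ennreal e"
      by (rule add_le_trans)
  qed
qed

lemma content_empty: "content X L {} = 0"
proof -
  have "L f = 0" if "f \<in> dominated X {}" for f
    using state_cong[OF L, of f "\<lambda>_. 0"] state_const[OF L, of 0] that by (simp add: dominated_def)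
  then show ?thesis
    unfolding content_def using zero_dominated by (intro antisym SUP_least) auto
qed

lemma content_finite_UN:
  assumes "finite I" "\<And>i. i \<in> I \<Longrightarrow> openin X (U i)"
  shows "content X L (\<Union>i\<in>I. U i) \<le> (\<Sum>i\<in>I. content X L (U i))"
  using assms
proof (induction I rule: finite_induct)
  case (insert i I)
  have "content X L (U i \<union> (\<Union>i\<in>I. U i)) \<le> content X L (U i) + content X L (\<Union>i\<in>I. U i)"
    using insert.prems by (intro content_Un) auto
  with insert show ?case
    by (simp add: add_mono order_trans)
qed (simp add: content_empty)

text \<open>The truncation \<open>f'\<close> vanishes off the compact set \<open>K\<close>, so it is
  already dominated on the union of finitely many \<open>U i\<close>, where finite subadditivity
  applies.\<close>

lemma content_countable_UN:
  fixes U :: "nat \<Rightarrow> 'x set"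
  assumes U: "\<And>i. openin X (U i)"
  shows "content X L (\<Union>i. U i) \<le> (\<Sum>i. content X L (U i))"
  unfolding content_def[of X L "\<Union>i. U i"]
proof (rule SUP_least)
  fix f assume f: "f \<in> dominated X (\<Union>i. U i)"
  show "ennreal (L f) \<le> (\<Sum>i. content X L (U i))"
  proof (rule ennreal_le_epsilon)
    fix e :: real assume "0 < e"
    obtain f' where f': "f' \<in> dominated X (\<Union>i. U i)" "L f \<le> L f' + e"
      "\<And>x. x \<in> topspace X \<Longrightarrow> f x \<le> e \<Longrightarrow> f' x = 0"
      using dominated_truncate[OF f \<open>0 < e\<close>] by blast
    define K where "K = {x \<in> topspace X. f x \<in> {e..}}"
    have cf: "continuous_map X euclideanreal f"
      using f by (auto simp: dominated_def)
    have "closedin X K"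
      unfolding K_def by (rule closedin_continuous_map_preimage[OF cf(1)]) simp
    then have "compactin X K"
      using X(1) closedin_compact_space by blast
    moreover have "K \<subseteq> \<Union>(range U)"
      using f \<open>0 < e\<close> by (force simp: K_def dominated_def)
    ultimately obtain \<F> where "finite \<F>" "\<F> \<subseteq> range U" "K \<subseteq> \<Union>\<F>"
      using U unfolding compactin_def by (metis (no_types, lifting) image_iff)
    then obtain I where I: "finite I" "K \<subseteq> (\<Union>i\<in>I. U i)"
      by (metis finite_subset_image)
    have "f' \<in> dominated X (\<Union>i\<in>I. U i)"
      using f'(1,3) I(2) by (force simp: dominated_def K_def)
    then have "ennreal (L f') \<le> content X L (\<Union>i\<in>I. U i)"
      by (rule content_upper)
    also have "\<dots> \<le> (\<Sum>i\<in>I. content X L (U i))"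
      by (rule content_finite_UN[OF I(1) U])
    also have "\<dots> \<le> (\<Sum>i. content X L (U i))"
      using I(1) by (intro sum_le_suminf) auto
    finally have "ennreal (L f') \<le> (\<Sum>i. content X L (U i))" .
    moreover have "ennreal (L f) \<le> ennreal (L f') + ennreal e"
      using f'(2) \<open>0 < e\<close> dominated_state_nonneg[OF f'(1)] by (simp flip: ennreal_plus add: ennreal_leI)
    ultimately show "ennreal (L f) \<le> (\<Sum>i. content X L (U i)) + ennreal e"
      by (rule add_le_trans)
  qed
qed

lemma outer_content_open: "openin X U \<Longrightarrow> outer_content X L U = content X L U"
  unfolding outer_content_def by (intro antisym INF_lower INF_greatest content_mono) auto

lemma outer_content_mono: "A \<subseteq> B \<Longrightarrow> outer_content X L A \<le> outer_content X L B"
  unfolding outer_content_def by (rule INF_superset_mono) auto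

lemma outer_content_approx:
  assumes "outer_content X L A < top" "e > (0 :: real)"
  obtains U where "openin X U" "A \<subseteq> U" "content X L U \<le> outer_content X L A + ennreal e"
  using INF_approx_ennreal[OF assms(2), of "outer_content X L A" "content X L" "{U. openin X U \<and> A \<subseteq> U}"]
    assms(1) by (auto simp: outer_content_def less_top[symmetric] intro: less_imp_le)

lemma outer_measure_space_outer_content:
  "outer_measure_space (Pow (topspace X)) (outer_content X L)"
  unfolding outer_measure_space_def
proof (intro conjI)
  show "positive (Pow (topspace X)) (outer_content X L)"
    by (simp add: positive_def outer_content_open content_empty)
  show "increasing (Pow (topspace X)) (outer_content X L)"
    by (simp add: increasing_def outer_content_mono)
  show "countably_subadditive (Pow (topspace X)) (outer_content X L)"
    unfolding countably_subadditive_def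
  proof (intro allI impI)
    fix A :: "nat \<Rightarrow> 'x set"
    let ?O = "outer_content X L"
    show "?O (\<Union>i. A i) \<le> (\<Sum>i. ?O (A i))"
    proof (rule ennreal_le_epsilon)
      fix e :: real assume e: "0 < e" and fin: "(\<Sum>i. ?O (A i)) < top"
      have "\<exists>U. openin X U \<and> A i \<subseteq> U \<and> content X L U \<le> ?O (A i) + ennreal (e * (1/2) ^ Suc i)" for i
        using outer_content_approx[of "A i" "e * (1/2) ^ Suc i"] ennreal_suminf_lessD[OF fin, of i] e
        by (metis (no_types, lifting) mult_pos_pos half_gt_zero_iff zero_less_one zero_less_power)
      then obtain U where U: "\<And>i. openin X (U i)" "\<And>i. A i \<subseteq> U i"
        "\<And>i. content X L (U i) \<le> ?O (A i) + ennreal (e * (1/2) ^ Suc i)"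
        by metis
      have "?O (\<Union>i. A i) \<le> ?O (\<Union>i. U i)"
        using U(2) by (intro outer_content_mono UN_mono) auto
      also have "\<dots> = content X L (\<Union>i. U i)"
        using U(1) by (intro outer_content_open openin_Union) auto
      also have "\<dots> \<le> (\<Sum>i. content X L (U i))"
        by (rule content_countable_UN[OF U(1)])
      also have "\<dots> \<le> (\<Sum>i. ?O (A i) + ennreal (e * (1/2) ^ Suc i))"
        by (intro suminf_le U) auto
      also have "\<dots> = (\<Sum>i. ?O (A i)) + (\<Sum>i. ennreal e * ennreal ((1/2) ^ Suc i))"
        using e by (subst suminf_add[symmetric])
          (auto simp del: ennreal_suminf_cmult simp add: ennreal_mult[symmetric])
      also have "\<dots> = (\<Sum>i. ?O (A i)) + e"
        unfolding ennreal_suminf_cmult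
        by (subst suminf_ennreal_eq[OF zero_le_power power_half_series]) auto
      finally show "?O (\<Union>i. A i) \<le> (\<Sum>i. ?O (A i)) + e" .
    qed
  qed
qed

text \<open>The Caratheodory condition for an open test set \<open>V\<close>. It is shown for one
  \<open>f\<close> dominated on \<open>V \<inter> U\<close> at a time, up to \<open>e\<close>,
  before the supremum over \<open>f\<close> is taken.\<close>

lemma outer_content_split_open:
  assumes U: "openin X U" and V: "openin X V"
  shows "outer_content X L (V \<inter> U) + outer_content X L (V - U) \<le> content X L V"
proof -
  let ?O = "outer_content X L"
  have UV: "openin X (V \<inter> U)" using U V by blast
  have "ennreal (L f) + ?O (V - U) \<le> content X L V" if f: "f \<in> dominated X (V \<inter> U)" for f
  proof (rule ennreal_le_epsilon)
    fix e :: real assume "0 < e"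
    obtain f' where f': "f' \<in> dominated X (V \<inter> U)" "L f \<le> L f' + e"
      "\<And>x. x \<in> topspace X \<Longrightarrow> f x \<le> e \<Longrightarrow> f' x = 0"
      using dominated_truncate[OF f \<open>0 < e\<close>] by blast
    have cf: "continuous_map X euclideanreal f" "continuous_map X euclideanreal f'"
      using f f' by (auto simp: dominated_def)
    \<comment> \<open>An open set between \<open>V - U\<close> and \<open>V\<close>. Where
      \<open>f < e\<close> the truncation \<open>f'\<close> is 0, and elsewhere every
      \<open>g\<close> dominated on \<open>W\<close> is 0; so \<open>f' + g\<close> stays at most 1
      and is dominated on \<open>V\<close>.\<close>
    define W where "W = V \<inter> {x \<in> topspace X. f x \<in> {..<e}}"
    have W: "openin X W"
      unfolding W_def by (intro openin_Int V openin_continuous_map_preimage[OF cf(1)]) simp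
    have "V - U \<subseteq> W"
      using f V openin_subset[OF V] \<open>0 < e\<close> by (force simp: W_def dominated_def)
    then have "ennreal (L f') + ?O (V - U) \<le> ennreal (L f') + content X L W"
      using outer_content_mono outer_content_open[OF W] by (metis add_left_mono)
    also have "\<dots> = (SUP g\<in>dominated X W. ennreal (L f') + ennreal (L g))"
      unfolding content_def using zero_dominated by (subst ennreal_SUP_add_right) auto
    also have "\<dots> \<le> content X L V"
    proof (rule SUP_least)
      fix g assume g: "g \<in> dominated X W"
      have cg: "continuous_map X euclideanreal g" using g by (simp add: dominated_def)
      have "(\<lambda>x. f' x + g x) \<in> dominated X V"
      proof -
        have "0 \<le> f' x + g x \<and> f' x + g x \<le> 1 \<and> (x \<notin> V \<longrightarrow> f' x + g x = 0)" if x: "x \<in> topspace X" for x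
          using f'(1) f'(3)[OF x] g x by (cases "f x < e") (auto simp: dominated_def W_def)
        then show ?thesis
          using cf(2) cg by (simp add: dominated_def continuous_map_add)
      qed
      moreover have "L (\<lambda>x. f' x + g x) = L f' + L g"
        by (rule state_add[OF L cf(2) cg])
      ultimately show "ennreal (L f') + ennreal (L g) \<le> content X L V"
        using content_upper[of "\<lambda>x. f' x + g x" V] dominated_state_nonneg[OF f'(1)]
          dominated_state_nonneg[OF g] by (simp flip: ennreal_plus)
    qed
    finally have "ennreal (L f') + ?O (V - U) + ennreal e \<le> content X L V + ennreal e"
      by (rule add_right_mono)
    moreover have "ennreal (L f) \<le> ennreal (L f') + ennreal e"
      using f'(2) \<open>0 < e\<close> dominated_state_nonneg[OF f'(1)] by (simp flip: ennreal_plus add: ennreal_leI)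
    then have "ennreal (L f) + ?O (V - U) \<le> ennreal (L f') + ennreal e + ?O (V - U)"
      by (rule add_right_mono)
    then have "ennreal (L f) + ?O (V - U) \<le> ennreal (L f') + ?O (V - U) + ennreal e"
      by (simp only: ac_simps)
    ultimately show "ennreal (L f) + ?O (V - U) \<le> content X L V + ennreal e"
      by (rule order_trans[rotated])
  qed
  then have "(SUP f\<in>dominated X (V \<inter> U). ennreal (L f) + ?O (V - U)) \<le> content X L V"
    by (rule SUP_least)
  then show ?thesis
    using zero_dominated by (subst (asm) ennreal_SUP_add_left) (auto simp: outer_content_open[OF UV] content_def)
qed

lemma outer_content_split:
  assumes U: "openin X U" and A: "A \<subseteq> topspace X"
  shows "outer_content X L (A \<inter> U) + outer_content X L (A - U) \<le> outer_content X L A"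
  unfolding outer_content_def[of X L A]
proof (rule INF_greatest)
  fix V assume V: "V \<in> {U. openin X U \<and> A \<subseteq> U}"
  have "outer_content X L (A \<inter> U) + outer_content X L (A - U)
      \<le> outer_content X L (V \<inter> U) + outer_content X L (V - U)"
    using V by (intro add_mono outer_content_mono) auto
  also have "\<dots> \<le> content X L V"
    using V by (intro outer_content_split_open U) auto
  finally show "outer_content X L (A \<inter> U) + outer_content X L (A - U) \<le> content X L V" .
qed

text \<open>\<open>outer_content_split\<close> and subadditivity place the open sets in the
  Caratheodory sigma-algebra, so the outer measure is countably additive on the Borel sets.\<close>

lemma measure_space_outer_content:
  "measure_space (topspace X) (sigma_sets (topspace X) {U. openin X U}) (outer_content X L)"
proof -
  interpret P: sigma_algebra "topspace X" "Pow (topspace X)" by (rule sigma_algebra_Pow)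
  let ?\<Lambda> = "lambda_system (topspace X) (Pow (topspace X)) (outer_content X L)"
  note oms = outer_measure_space_outer_content
  have ms: "measure_space (topspace X) ?\<Lambda> (outer_content X L)"
    by (rule P.caratheodory_lemma[OF oms])
  have sub: "subadditive (Pow (topspace X)) (outer_content X L)"
    using oms P.countably_subadditive_subadditive by (auto simp: outer_measure_space_def)
  have "U \<in> ?\<Lambda>" if U: "openin X U" for U
  proof -
    have "outer_content X L (A \<inter> U) + outer_content X L (A - U) = outer_content X L A"
      if "A \<subseteq> topspace X" for A
    proof (rule antisym)
      show "outer_content X L (A \<inter> U) + outer_content X L (A - U) \<le> outer_content X L A"
        by (rule outer_content_split[OF U that])
      have "outer_content X L ((A \<inter> U) \<union> (A - U)) \<le> outer_content X L (A \<inter> U) + outer_content X L (A - U)"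
        using that by (intro subadditiveD[OF sub]) auto
      then show "outer_content X L A \<le> outer_content X L (A \<inter> U) + outer_content X L (A - U)"
        by (simp add: Int_Diff_Un)
    qed
    then show ?thesis using openin_subset[OF U] by (simp add: P.lambda_system_eq)
  qed
  then have "sigma_sets (topspace X) {U. openin X U} \<subseteq> ?\<Lambda>"
    using ms by (intro sigma_algebra.sigma_sets_subset) (auto simp: measure_space_def)
  moreover have "sigma_algebra (topspace X) (sigma_sets (topspace X) {U. openin X U})"
    by (rule sigma_algebra_sigma_sets) (use openin_subset in blast)
  ultimately show ?thesis
    using measure_down[OF ms] by blast
qed

section \<open>The representing measure, its regularity and its integral\<close>

lemma sets_riesz_measure: "sets (riesz_measure X L) = sets (borel_algebra X)"
  unfolding riesz_measure_def borel_algebra_def by (subst (1 2) sets_measure_of) (use openin_subset in blast)+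

lemma space_riesz_measure: "space (riesz_measure X L) = topspace X"
  unfolding riesz_measure_def by (rule space_measure_of) (use openin_subset in blast)

lemma openin_riesz_measure: "openin X U \<Longrightarrow> U \<in> sets (riesz_measure X L)"
  unfolding riesz_measure_def by (subst sets_measure_of) (use openin_subset in blast)+

lemma emeasure_riesz_measure:
  assumes "A \<in> sets (riesz_measure X L)"
  shows "emeasure (riesz_measure X L) A = outer_content X L A"
proof (rule emeasure_measure_of[of _ "topspace X" "{U. openin X U}"])
  show "{U. openin X U} \<subseteq> Pow (topspace X)" using openin_subset by blast
  then have "sets (riesz_measure X L) = sigma_sets (topspace X) {U. openin X U}"
    by (simp add: riesz_measure_def)
  then show "positive (sets (riesz_measure X L)) (outer_content X L)"
    "countably_additive (sets (riesz_measure X L)) (outer_content X L)"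
    using measure_space_outer_content by (simp_all add: measure_space_def)
qed (use assms in \<open>auto simp: riesz_measure_def\<close>)

lemma prob_space_riesz_measure: "prob_space (riesz_measure X L)"
proof
  have "(\<lambda>_. 1) \<in> dominated X (topspace X)" by (simp add: dominated_def)
  then have "1 \<le> content X L (topspace X)"
    using content_upper state_one[OF L] by fastforce
  moreover have "content X L (topspace X) \<le> 1"
    unfolding content_def
  proof (rule SUP_least)
    fix f assume "f \<in> dominated X (topspace X)"
    then have "L f \<le> L (\<lambda>_. 1)"
      by (intro state_mono[OF L]) (auto simp: dominated_def)
    then show "ennreal (L f) \<le> 1" using state_one[OF L] by simp
  qed
  ultimately show "emeasure (riesz_measure X L) (space (riesz_measure X L)) = 1"
    unfolding space_riesz_measure
    by (subst emeasure_riesz_measure) (auto simp: openin_riesz_measure outer_content_open)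
qed

text \<open>Outer regularity of the complement: an open \<open>U\<close> that covers the complement
  of \<open>A\<close> with excess at most \<open>e\<close> has a compact complement inside
  \<open>A\<close>, which misses at most \<open>e\<close> of the measure of
  \<open>A\<close>.\<close>

lemma riesz_measure_inner_regular:
  assumes A: "A \<in> sets (riesz_measure X L)"
  shows "emeasure (riesz_measure X L) A =
    (SUP K\<in>{K. compactin X K \<and> K \<subseteq> A}. emeasure (riesz_measure X L) K)"
proof (rule antisym)
  interpret prob_space "riesz_measure X L" by (rule prob_space_riesz_measure)
  let ?M = "riesz_measure X L"
  show "(SUP K\<in>{K. compactin X K \<and> K \<subseteq> A}. emeasure ?M K) \<le> emeasure ?M A"
    using A by (intro SUP_least emeasure_mono) auto
  show "emeasure ?M A \<le> (SUP K\<in>{K. compactin X K \<and> K \<subseteq> A}. emeasure ?M K)"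
  proof (rule ennreal_le_epsilon)
    fix e :: real assume "0 < e"
    have cA: "space ?M - A \<in> sets ?M" using A by blast
    have "outer_content X L (space ?M - A) < top"
      using emeasure_riesz_measure[OF cA] emeasure_finite by (metis less_top)
    then obtain U where U: "openin X U" "space ?M - A \<subseteq> U"
      "content X L U \<le> outer_content X L (space ?M - A) + ennreal e"
      using outer_content_approx \<open>0 < e\<close> by blast
    note Us = openin_riesz_measure[OF U(1)]
    have "emeasure ?M U \<le> emeasure ?M (space ?M - A) + ennreal e"
      using U(3) emeasure_riesz_measure[OF cA] emeasure_riesz_measure[OF Us] outer_content_open[OF U(1)]
      by simp
    then have "prob U \<le> prob (space ?M - A) + e"
      using \<open>0 < e\<close> by (simp add: emeasure_eq_measure flip: ennreal_plus)
    then have "prob A \<le> prob (space ?M - U) + e"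
      using prob_compl[OF A] prob_compl[OF Us] by simp
    then have "emeasure ?M A \<le> emeasure ?M (space ?M - U) + ennreal e"
      using \<open>0 < e\<close> by (simp add: emeasure_eq_measure flip: ennreal_plus)
    moreover have "compactin X (space ?M - U)"
      unfolding space_riesz_measure using X(1) U(1)
      by (intro closedin_compact_space) auto
    then have "emeasure ?M (space ?M - U) \<le> (SUP K\<in>{K. compactin X K \<and> K \<subseteq> A}. emeasure ?M K)"
      using U(2) by (intro SUP_upper) auto
    ultimately show "emeasure ?M A \<le> (SUP K\<in>{K. compactin X K \<and> K \<subseteq> A}. emeasure ?M K) + ennreal e"
      by (rule add_le_trans[rotated])
  qed
qed

lemma riesz_measure_in_prob_measures: "riesz_measure X L \<in> prob_measures X"
  using prob_space_riesz_measure riesz_measure_inner_regular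
  by (simp add: prob_measures_def space_riesz_measure sets_riesz_measure)

text \<open>The region under \<open>f\<close> is cut into horizontal slices \<open>s k\<close> of
  height \<open>1 / n\<close>. A superlevel set bounds the \<open>L\<close>-value of one slice from
  above and the integral of the slice beneath it from below. After this index shift only the bottom
  slice is lost, at a cost of \<open>1 / n < e\<close>.\<close>

lemma state_le_integral_riesz:
  assumes f: "continuous_map X euclideanreal f" "\<And>x. x \<in> topspace X \<Longrightarrow> 0 \<le> f x \<and> f x \<le> 1"
  shows "L f \<le> (\<integral>x. f x \<partial>riesz_measure X L)"
proof (rule field_le_epsilon)
  fix e :: real assume "0 < e"
  interpret prob_space "riesz_measure X L" by (rule prob_space_riesz_measure)
  let ?M = "riesz_measure X L"
  note int = continuous_map_prob_measures_integrable[OF X(1) riesz_measure_in_prob_measures]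
  obtain m where m: "inverse (real (Suc m)) < e"
    using reals_Archimedean[OF \<open>0 < e\<close>] by blast
  define n where "n = real (Suc m)"
  have n: "n > 0" "1 / n < e" using m by (auto simp: n_def inverse_eq_divide)
  define s where "s k x = min (max (f x - real k / n) 0) (1 / n)" for k :: nat and x
  have s: "continuous_map X euclideanreal (s k)" for k
    unfolding s_def by (intro continuous_intros f)
  have s_bounds: "0 \<le> s k x" "s k x \<le> 1 / n" for k x
    using n by (auto simp: s_def)
  have sum_s: "(\<Sum>k<j. s k x) = min (f x) (real j / n)" if "x \<in> topspace X" for j x
  proof (induction j)
    case 0
    then show ?case using f(2)[OF that] by simp
  next
    case (Suc j)
    have "real (Suc j) / n = real j / n + 1 / n" by (simp add: add_divide_distrib)
    moreover have "min (f x) (real j / n) + s j x = min (f x) (real j / n + 1 / n)"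
      unfolding s_def using divide_pos_pos[OF zero_less_one n(1)] by linarith
    ultimately show ?case
      using Suc by simp
  qed
  have step: "L (s (Suc k)) \<le> (\<integral>x. s k x \<partial>?M)" for k
  proof -
    \<comment> \<open>\<open>n * s (Suc k)\<close> vanishes off \<open>U\<close>, so its
      \<open>L\<close>-value is at most the measure of \<open>U\<close>; and \<open>n * s k\<close>
      equals 1 on \<open>U\<close>, so that measure is at most the integral of
      \<open>n * s k\<close>.\<close>
    define U where "U = {x \<in> topspace X. f x \<in> {real (Suc k) / n<..}}"
    have U: "openin X U"
      unfolding U_def by (rule openin_continuous_map_preimage[OF f(1)]) simp
    note Us = openin_riesz_measure[OF U]
    have dom: "(\<lambda>x. n * s (Suc k) x) \<in> dominated X U"
    proof -
      have "n * s (Suc k) x \<le> 1" for x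
        using s_bounds(2)[of "Suc k" x] n by (simp add: field_simps)
      moreover have "s (Suc k) x = 0" if "x \<in> topspace X" "x \<notin> U" for x
        using that n by (simp add: s_def U_def)
      ultimately show ?thesis
        using s_bounds(1) n s by (auto simp: dominated_def intro: continuous_map_real_mult_left)
    qed
    have "ennreal (L (\<lambda>x. n * s (Suc k) x)) \<le> emeasure ?M U"
      using content_upper[OF dom] by (simp add: emeasure_riesz_measure[OF Us] outer_content_open[OF U])
    then have "L (\<lambda>x. n * s (Suc k) x) \<le> prob U"
      by (simp add: emeasure_eq_measure)
    also have "prob U = (\<integral>x. indicator U x \<partial>?M)"
      using Us by simp
    also have "\<dots> \<le> (\<integral>x. n * s k x \<partial>?M)"
    proof (rule integral_mono)
      show "integrable ?M (indicator U :: 'x \<Rightarrow> real)" using Us by (simp add: emeasure_eq_measure)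
      show "integrable ?M (\<lambda>x. n * s k x)" by (intro int continuous_map_real_mult_left s)
      fix x assume "x \<in> space ?M"
      have "s k x = 1 / n" if "x \<in> U"
      proof -
        have "f x > real k / n + 1 / n" using that by (simp add: U_def add_divide_distrib)
        then show ?thesis using n by (simp add: s_def)
      qed
      then show "indicator U x \<le> n * s k x"
        using s_bounds(1)[of k x] n by (cases "x \<in> U") auto
    qed
    finally show ?thesis
      using n state_cmult[OF L s] by simp
  qed
  have "L f = L (\<lambda>x. \<Sum>k<Suc m. s k x)"
  proof (rule state_cong[OF L])
    fix x assume x: "x \<in> topspace X"
    show "f x = (\<Sum>k<Suc m. s k x)"
      using sum_s[OF x, of "Suc m"] f(2)[OF x] by (simp add: n_def del: sum.lessThan_Suc)
  qed
  also have "\<dots> = (\<Sum>k<Suc m. L (s k))"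
    by (rule state_sum[OF L]) (auto simp: s)
  also have "\<dots> = L (s 0) + (\<Sum>k<m. L (s (Suc k)))"
    by (rule sum.lessThan_Suc_shift)
  also have "\<dots> \<le> 1 / n + (\<Sum>k<m. \<integral>x. s k x \<partial>?M)"
    using state_mono[OF L s, of "\<lambda>_. 1 / n" 0] s_bounds state_const[OF L]
    by (intro add_mono sum_mono step) auto
  also have "(\<Sum>k<m. \<integral>x. s k x \<partial>?M) = (\<integral>x. (\<Sum>k<m. s k x) \<partial>?M)"
    by (rule Bochner_Integration.integral_sum[symmetric]) (rule int[OF s])
  also have "\<dots> \<le> (\<integral>x. f x \<partial>?M)"
    using sum_s by (intro integral_mono int continuous_map_sum s f) (auto simp: space_riesz_measure)
  finally show "L f \<le> (\<integral>x. f x \<partial>?M) + e"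
    using n(2) by simp
qed

text \<open>One inequality is enough, since applied to \<open>- f\<close> it gives the reverse one.
  From functions with values in \<open>[0, 1]\<close> it extends to all continuous \<open>f\<close>
  through the affine rescaling \<open>h\<close>.\<close>

lemma integration_riesz_measure: "integration X (riesz_measure X L) = L"
proof
  let ?I = "integration X (riesz_measure X L)"
  have I: "?I \<in> states X"
    using prob_space_of_subset_states[OF X(1)] riesz_measure_in_prob_measures
    by (auto simp: prob_space_of_def)
  have le: "L f \<le> ?I f" if f: "continuous_map X euclideanreal f" for f
  proof -
    obtain B where B: "B > 0" "\<And>x. x \<in> topspace X \<Longrightarrow> \<bar>f x\<bar> \<le> B"
      using continuous_map_bounded[OF X(1) f] by blast
    define h where "h x = 1 / (2 * B) * f x + 1 / 2" for x
    have h: "continuous_map X euclideanreal h"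
      unfolding h_def by (intro continuous_intros f)
    have "0 \<le> h x \<and> h x \<le> 1" if "x \<in> topspace X" for x
      using B(2)[OF that] B(1) by (auto simp: h_def field_simps abs_le_iff)
    then have "L h \<le> ?I h"
      using state_le_integral_riesz[OF h] h by (simp add: integration_def)
    have J: "J h = 1 / (2 * B) * J f + 1 / 2" if J: "J \<in> states X" for J
      unfolding h_def
      by (subst state_add[OF J])
        (auto simp only: state_cmult[OF J f] state_const[OF J] continuous_map_canonical_const intro!: continuous_map_real_mult_left f)
    have "1 / (2 * B) * L f \<le> 1 / (2 * B) * ?I f"
      using \<open>L h \<le> ?I h\<close> unfolding J[OF L] J[OF I] by simp
    then show ?thesis using B(1) by (simp add: divide_le_cancel)
  qed
  fix f
  show "?I f = L f"
  proof (cases "continuous_map X euclideanreal f")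
    case True
    then have "L (\<lambda>x. - f x) \<le> ?I (\<lambda>x. - f x)" by (intro le) simp
    then show ?thesis
      using le[OF True] state_minus[OF L True] state_minus[OF I True] by simp
  next
    case False
    then show ?thesis by (simp add: state_outside[OF L] state_outside[OF I])
  qed
qed

end

theorem prob_space_of_eq_states:
  assumes "compact_space X" "Hausdorff_space X"
  shows "prob_space_of X = states X"
proof (rule antisym)
  show "prob_space_of X \<subseteq> states X" by (rule prob_space_of_subset_states[OF assms(1)])
  show "states X \<subseteq> prob_space_of X"
    using integration_riesz_measure[OF assms] riesz_measure_in_prob_measures[OF assms]
    unfolding prob_space_of_def by (metis image_iff subsetI)
qed

section \<open>Metrisability of the space of states\<close>

lemma metrizable_space_obtain_metric:
  assumes "metrizable_space X"
  obtains m where "X = mtopology_of m"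
proof -
  obtain M d where "Metric_space M d" "X = Metric_space.mtopology M d"
    using assms by (auto simp: metrizable_space_def)
  then show ?thesis
    using that[of "metric (M, d)"] by (simp add: Metric_space.mtopology_of)
qed

lemma compact_uniformly_continuous:
  assumes "compact_space (mtopology_of m)" "continuous_map (mtopology_of m) euclideanreal f" "e > 0"
  obtains \<delta> where "\<delta> > 0"
    "\<And>x y. x \<in> mspace m \<Longrightarrow> y \<in> mspace m \<Longrightarrow> mdist m y x < \<delta> \<Longrightarrow> \<bar>f y - f x\<bar> < e"
proof -
  have "uniformly_continuous_map m euclidean_metric f"
    using assms by (intro continuous_imp_uniformly_continuous_map) simp
  then show ?thesis
    using assms(3) that unfolding uniformly_continuous_map_def by (auto simp: dist_real_def)
qed

lemma mdist_continuous_map: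
  "y \<in> mspace m \<Longrightarrow> continuous_map (mtopology_of m) euclideanreal (mdist m y)"
  using continuous_map_mdist[of "mtopology_of m" m "\<lambda>_. y" "\<lambda>x. x"] by simp

text \<open>
  The dense family consists of the functions \<open>x \<mapsto> max\<^sub>i (q\<^sub>i - l\<^sub>i d(y\<^sub>i, x))\<close> with rational
  parameters and \<open>y\<^sub>i\<close> in a countable dense set.
\<close>

lemma countable_dense_continuous_functions:
  assumes X: "compact_space X" "metrizable_space X"
  obtains F where "countable F" "\<And>f. f \<in> F \<Longrightarrow> continuous_map X euclideanreal f"
    "\<And>f e. continuous_map X euclideanreal f \<Longrightarrow> e > 0 \<Longrightarrow> \<exists>g\<in>F. \<forall>x\<in>topspace X. \<bar>f x - g x\<bar> \<le> e"
proof (cases "topspace X = {}")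
  case True
  then show ?thesis by (intro that[of "{\<lambda>_. 0}"]) auto
next
  case ne: False
  obtain m where m: "X = mtopology_of m"
    using metrizable_space_obtain_metric[OF X(2)] by blast
  interpret M: Metric_space "mspace m" "mdist m" by (rule Metric_space_mspace_mdist)
  have top: "topspace X = mspace m" by (simp add: m)
  have "M.mtotally_bounded (mspace m)"
    using X(1) M.compactin_imp_mtotally_bounded[of "mspace m"] by (simp add: m compact_space_def mtopology_of_def)
  then have "\<exists>K. finite K \<and> K \<subseteq> mspace m \<and> mspace m \<subseteq> (\<Union>x\<in>K. M.mball x e)" if "e > 0" for e
    using that by (simp add: M.mtotally_bounded_def)
  then have "\<exists>K. finite K \<and> K \<subseteq> mspace m \<and> mspace m \<subseteq> (\<Union>x\<in>K. M.mball x (inverse (real (Suc n))))" for n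
    by simp
  then obtain K where K: "\<And>n. finite (K n)" "\<And>n. K n \<subseteq> mspace m"
    "\<And>n. mspace m \<subseteq> (\<Union>x\<in>K n. M.mball x (inverse (real (Suc n))))"
    by metis
  define D where "D = (\<Union>n. K n)"
  have D: "D \<subseteq> mspace m" using K(2) by (auto simp: D_def)
  have "countable D" unfolding D_def using K(1) by (simp add: countable_finite)
  define G where "G S x = Max ((\<lambda>(q, l, y). q - l * mdist m y x) ` S)"
    for S :: "(real \<times> real \<times> 'a) set" and x
  define F where "F = G ` {S. S \<noteq> {} \<and> finite S \<and> S \<subseteq> \<rat> \<times> \<rat> \<times> D}"
  have "countable {S. finite S \<and> S \<subseteq> (\<rat> :: real set) \<times> (\<rat> :: real set) \<times> D}"
    using \<open>countable D\<close> by (intro countable_Collect_finite_subset countable_SIGMA countable_rat)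
  then have "countable F"
    unfolding F_def by (rule countable_image[OF countable_subset, rotated]) auto
  moreover have "continuous_map X euclideanreal f" if "f \<in> F" for f
  proof -
    have "continuous_map X euclideanreal (G S)" if "finite S" "S \<noteq> {}" "S \<subseteq> \<rat> \<times> \<rat> \<times> D" for S
      using that
    proof (induction S rule: finite_ne_induct)
      case (singleton p)
      then obtain q l y where p: "p = (q, l, y)" "y \<in> mspace m"
        using D by (cases p) auto
      have "continuous_map X euclideanreal (\<lambda>x. q - l * mdist m y x)"
        unfolding m by (intro continuous_intros mdist_continuous_map p)
      then show ?case by (rule continuous_map_eq) (simp add: G_def p)
    next
      case (insert p S)
      then obtain q l y where p: "p = (q, l, y)" "y \<in> mspace m"
        using D by (cases p) auto
      have "continuous_map X euclideanreal (\<lambda>x. q - l * mdist m y x)"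
        unfolding m by (intro continuous_intros mdist_continuous_map p)
      then have "continuous_map X euclideanreal (\<lambda>x. max (q - l * mdist m y x) (G S x))"
        using insert by (intro continuous_map_real_max) auto
      then show ?case by (rule continuous_map_eq) (use insert in \<open>simp add: G_def p\<close>)
    qed
    then show ?thesis using that by (auto simp: F_def)
  qed
  moreover have "\<exists>g\<in>F. \<forall>x\<in>topspace X. \<bar>f x - g x\<bar> \<le> e"
    if f: "continuous_map X euclideanreal f" and "e > 0" for f and e :: real
  proof -
    \<comment> \<open>Three errors of size \<open>c\<close> add up in the lower estimate: the
      oscillation of \<open>f\<close> near \<open>y\<close>, the gap between \<open>q y\<close> and
      \<open>f y\<close>, and the term \<open>l * mdist m y x\<close>.\<close>
    define c where "c = e / 3"
    have "c > 0" using \<open>e > 0\<close> by (simp add: c_def)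
    obtain B where B: "B > 0" "\<And>x. x \<in> topspace X \<Longrightarrow> \<bar>f x\<bar> \<le> B"
      using continuous_map_bounded[OF X(1) f] by blast
    obtain \<delta> where \<delta>: "\<delta> > 0"
      "\<And>x y. x \<in> mspace m \<Longrightarrow> y \<in> mspace m \<Longrightarrow> mdist m y x < \<delta> \<Longrightarrow> \<bar>f y - f x\<bar> < c"
      using compact_uniformly_continuous[of m f c] X(1) f \<open>c > 0\<close> m by blast
    \<comment> \<open>The slope is so steep that a cone has dropped by more than
      \<open>2 * B\<close>, the largest possible variation of \<open>f\<close>, at distance
      \<open>\<delta>\<close> from its apex. Cones with a distant apex therefore stay below
      \<open>f x\<close>.\<close>
    obtain l where l: "l \<in> \<rat>" "l > 2 * B / \<delta>"
      using Rats_dense_in_real[of "2 * B / \<delta>" "2 * B / \<delta> + 1"] by auto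
    have "l > 0" using l(2) B(1) \<delta>(1) by (smt (verit) divide_nonneg_pos)
    have l\<delta>: "l * \<delta> > 2 * B" using l(2) \<delta>(1) by (simp add: field_simps)
    obtain n where n: "inverse (real (Suc n)) < min \<delta> (c / l)"
      using reals_Archimedean[of "min \<delta> (c / l)"] \<delta>(1) \<open>c > 0\<close> \<open>l > 0\<close> by auto
    have "\<exists>q\<in>\<rat>. f y - c < q \<and> q < f y" for y
      using Rats_dense_in_real[of "f y - c" "f y"] \<open>c > 0\<close> by auto
    then obtain q where q: "\<And>y. q y \<in> \<rat>" "\<And>y. f y - c < q y" "\<And>y. q y < f y" by metis
    define S where "S = (\<lambda>y. (q y, l, y)) ` K n"
    have "K n \<noteq> {}" using K(3)[of n] ne top by auto
    then have S: "finite S" "S \<noteq> {}" "S \<subseteq> \<rat> \<times> \<rat> \<times> D"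
      using K(1) q(1) l(1) by (auto simp: S_def D_def)
    have "\<bar>f x - G S x\<bar> \<le> e" if x: "x \<in> mspace m" for x
    proof -
      have "q y - l * mdist m y x \<le> f x + c" if "y \<in> K n" for y
      proof (cases "mdist m y x < \<delta>")
        case True
        have "y \<in> mspace m" using that K(2) by blast
        then have "f y < f x + c" using \<delta>(2)[OF x _ True] by linarith
        moreover have "0 \<le> l * mdist m y x" using \<open>l > 0\<close> by simp
        ultimately show ?thesis using q(3)[of y] by linarith
      next
        case False
        then have "l * \<delta> \<le> l * mdist m y x" using \<open>l > 0\<close> by simp
        moreover have "\<bar>f y\<bar> \<le> B" "\<bar>f x\<bar> \<le> B" using that K(2) x B(2) top by auto
        ultimately show ?thesis using l\<delta> q(3)[of y] \<open>c > 0\<close> by linarith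
      qed
      then have upper: "G S x \<le> f x + c"
        using S by (auto simp: G_def S_def)
      obtain y where y: "y \<in> K n" "x \<in> M.mball y (inverse (real (Suc n)))"
        using K(3)[of n] x by blast
      then have d: "mdist m y x < \<delta>" "mdist m y x < c / l" "y \<in> mspace m"
        using n by auto
      have "f x - c < f y" using \<delta>(2)[OF x d(3) d(1)] by linarith
      moreover have "l * mdist m y x < c" using d(2) \<open>l > 0\<close> by (simp add: field_simps)
      moreover have "q y - l * mdist m y x \<le> G S x"
        unfolding G_def S_def image_image using K(1) y(1) by (intro Max_ge) auto
      ultimately have "f x - 3 * c < G S x" using q(2)[of y] by linarith
      with upper show ?thesis using \<open>c > 0\<close> by (simp add: c_def)
    qed
    moreover have "G S \<in> F" using S by (auto simp: F_def)
    ultimately show ?thesis using top by auto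
  qed
  ultimately show ?thesis using that by metis
qed

text \<open>Restriction to the countable dense family \<open>F\<close> is injective on states, since
  states are 1-Lipschitz for the uniform norm. By compactness it is an embedding into a countable
  power of the real line.\<close>

lemma metrizable_space_states:
  assumes X: "compact_space X" "metrizable_space X"
  shows "metrizable_space (subtopology weak_star (states X))"
proof -
  obtain F where F: "countable F" "\<And>f. f \<in> F \<Longrightarrow> continuous_map X euclideanreal f"
    "\<And>f e. continuous_map X euclideanreal f \<Longrightarrow> e > 0 \<Longrightarrow> \<exists>g\<in>F. \<forall>x\<in>topspace X. \<bar>f x - g x\<bar> \<le> e"
    using countable_dense_continuous_functions[OF X] by metis
  let ?S = "subtopology weak_star (states X)"
  let ?P = "product_topology (\<lambda>_. euclideanreal) F"
  have "continuous_map ?S ?P (\<lambda>L. restrict L F)"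
    unfolding weak_star_def
    by (rule continuous_map_from_subtopology[OF continuous_on_restrict]) simp
  moreover have "compact_space ?S"
    using compactin_states[OF X(1)] by (simp add: compact_space_subtopology)
  moreover have "Hausdorff_space ?P"
    by (simp add: Hausdorff_space_product_topology)
  moreover have "inj_on (\<lambda>L. restrict L F) (topspace ?S)"
  proof (rule inj_onI)
    fix L M assume LM: "L \<in> topspace ?S" "M \<in> topspace ?S" and eq: "restrict L F = restrict M F"
    then have L: "L \<in> states X" and M: "M \<in> states X" by auto
    show "L = M"
    proof
      fix f
      show "L f = M f"
      proof (cases "continuous_map X euclideanreal f")
        case True
        have "\<bar>L f - M f\<bar> \<le> e" if e: "0 < e" for e
        proof -
          obtain g where g: "g \<in> F" "\<And>x. x \<in> topspace X \<Longrightarrow> \<bar>f x - g x\<bar> \<le> e / 2"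
            using F(3)[OF True half_gt_zero[OF e]] by blast
          have "\<bar>L f - L g\<bar> \<le> e / 2"
            by (rule state_abs_diff_le[OF L True F(2)[OF g(1)] g(2)])
          moreover have "\<bar>M f - M g\<bar> \<le> e / 2"
            by (rule state_abs_diff_le[OF M True F(2)[OF g(1)] g(2)])
          moreover have "L g = M g" using eq g(1) by (metis restrict_apply')
          ultimately show ?thesis by linarith
        qed
        then have "\<bar>L f - M f\<bar> \<le> 0" by (rule dense_ge)
        then show ?thesis by simp
      next
        case False
        then show ?thesis using state_outside[OF L] state_outside[OF M] by simp
      qed
    qed
  qed
  ultimately have "embedding_map ?S ?P (\<lambda>L. restrict L F)"
    by (intro continuous_imp_embedding_map)
  then have hom: "?S homeomorphic_space subtopology ?P ((\<lambda>L. restrict L F) ` topspace ?S)"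
    by (rule embedding_map_imp_homeomorphic_space)
  have "metrizable_space ?P"
    using F(1) by (auto simp: metrizable_space_product_topology metrizable_space_euclidean
      intro: countable_subset[rotated])
  then show ?thesis
    using homeomorphic_metrizable_space[OF hom] metrizable_space_subtopology by blast
qed


section \<open>The affine system of states\<close>

text \<open>
  For a state \<open>L\<close>, minimise \<open>\<Sum>\<^bsub>f\<in>F\<^esub> (M f - L f)\<^sup>2\<close> over \<open>M\<close> in a compact convex set that contains
  the point masses. Moving from the minimiser \<open>M\<close> towards a point mass does not decrease the sum, so
  \<open>\<Sum>\<^bsub>f\<in>F\<^esub> (M f - L f) (f x - M f) \<ge> 0\<close> for all \<open>x\<close>. Applying \<open>L\<close> shows that the minimum is \<open>0\<close>.
\<close>

lemma states_finite_approximation: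
  assumes X: "compact_space X" "topspace X \<noteq> {}"
    and N: "closedin weak_star N" "N \<subseteq> states X" "convex N" "\<And>x. x \<in> topspace X \<Longrightarrow> point_mass X x \<in> N"
    and L: "L \<in> states X" and F: "finite F" "\<And>f. f \<in> F \<Longrightarrow> continuous_map X euclideanreal f"
  obtains M where "M \<in> N" "\<And>f. f \<in> F \<Longrightarrow> M f = L f"
proof -
  have "compact N"
    using closed_compactin[OF compactin_states[OF X(1)] N(2,1)] by (simp add: weak_star_eq_euclidean)
  moreover have "N \<noteq> {}" using N(4) X(2) by blast
  moreover have "continuous_on N (\<lambda>M. \<Sum>f\<in>F. (M f - L f)\<^sup>2)"
    by (intro continuous_intros continuous_on_subset[OF continuous_on_product_coordinates]) auto
  ultimately obtain M where M: "M \<in> N"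
    "\<And>M'. M' \<in> N \<Longrightarrow> (\<Sum>f\<in>F. (M f - L f)\<^sup>2) \<le> (\<Sum>f\<in>F. (M' f - L f)\<^sup>2)"
    using continuous_attains_inf[of N "\<lambda>M. \<Sum>f\<in>F. (M f - L f)\<^sup>2"] by blast
  have var: "0 \<le> (\<Sum>f\<in>F. (M f - L f) * (f x - M f))" if x: "x \<in> topspace X" for x
  proof (rule ccontr)
    define A where "A = (\<Sum>f\<in>F. (M f - L f) * (f x - M f))"
    define W where "W = (\<Sum>f\<in>F. (f x - M f)\<^sup>2)"
    assume "\<not> 0 \<le> (\<Sum>f\<in>F. (M f - L f) * (f x - M f))"
    then have "A < 0" by (simp add: A_def)
    have "W \<ge> 0" by (simp add: W_def sum_nonneg)
    \<comment> \<open>On the segment to the point mass the objective changes by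
      \<open>2 * t * A + t\<^sup>2 * W\<close>, which is negative once \<open>t * W < - A\<close>.
      The denominator \<open>W + 1\<close> is positive even for \<open>W = 0\<close>.\<close>
    define t where "t = min 1 (- A / (W + 1))"
    have t: "0 < t" "t \<le> 1" "t * W < - A"
    proof -
      have "0 < - A / (W + 1)" using \<open>A < 0\<close> \<open>W \<ge> 0\<close> by (intro divide_pos_pos) auto
      then show "0 < t" "t \<le> 1" by (auto simp: t_def)
      have "t * (W + 1) \<le> - A / (W + 1) * (W + 1)"
        using \<open>W \<ge> 0\<close> by (intro mult_right_mono) (auto simp: t_def)
      moreover have "- A / (W + 1) * (W + 1) = - A" using \<open>W \<ge> 0\<close> by simp
      ultimately have "t * W + t \<le> - A" by (simp only: distrib_left mult_1_right)
      then show "t * W < - A" using \<open>0 < t\<close> by simp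
    qed
    define M' where "M' = (1 - t) *\<^sub>R M + t *\<^sub>R point_mass X x"
    have "M' \<in> N"
      unfolding M'_def using t M(1) N(4)[OF x] by (intro convexD[OF N(3)]) auto
    then have "(\<Sum>f\<in>F. (M f - L f)\<^sup>2) \<le> (\<Sum>f\<in>F. (M' f - L f)\<^sup>2)" by (rule M(2))
    also have "\<dots> = (\<Sum>f\<in>F. (M f - L f)\<^sup>2 + 2 * t * ((M f - L f) * (f x - M f)) + t\<^sup>2 * (f x - M f)\<^sup>2)"
    proof (rule sum.cong[OF refl])
      fix f assume "f \<in> F"
      then have "M' f - L f = (M f - L f) + t * (f x - M f)"
        using point_mass_apply[OF x F(2)] by (simp add: M'_def algebra_simps)
      then show "(M' f - L f)\<^sup>2 = (M f - L f)\<^sup>2 + 2 * t * ((M f - L f) * (f x - M f)) + t\<^sup>2 * (f x - M f)\<^sup>2"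
        by (simp only: power2_eq_square) (simp add: algebra_simps)
    qed
    also have "\<dots> = (\<Sum>f\<in>F. (M f - L f)\<^sup>2) + 2 * t * A + t\<^sup>2 * W"
      by (simp only: sum.distrib sum_distrib_left A_def W_def)
    finally have "0 \<le> t * (2 * A + t * W)" by (simp add: power2_eq_square distrib_left mult_ac)
    then have "0 \<le> 2 * A + t * W" using t(1) by (simp add: zero_le_mult_iff)
    then show False using t(3) \<open>A < 0\<close> by linarith
  qed
  have "0 \<le> L (\<lambda>x. \<Sum>f\<in>F. (M f - L f) * (f x - M f))"
    using F var by (intro state_nonneg[OF L]) (auto intro!: continuous_intros)
  also have "\<dots> = (\<Sum>f\<in>F. L (\<lambda>x. (M f - L f) * (f x - M f)))"
    using F by (intro state_sum[OF L]) (auto intro!: continuous_intros)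
  also have "\<dots> = (\<Sum>f\<in>F. - (M f - L f)\<^sup>2)"
  proof (rule sum.cong[OF refl])
    fix f assume f: "f \<in> F"
    have "L (\<lambda>x. (M f - L f) * (f x - M f)) = (M f - L f) * (L f - M f)"
      using F(2)[OF f] state_diff[OF L, of f "\<lambda>_. M f"] state_const[OF L]
      by (subst state_cmult[OF L]) (auto intro!: continuous_intros)
    then show "L (\<lambda>x. (M f - L f) * (f x - M f)) = - (M f - L f)\<^sup>2"
      by (simp add: power2_eq_square algebra_simps)
  qed
  finally have "(\<Sum>f\<in>F. (M f - L f)\<^sup>2) = 0"
    by (simp add: sum_negf sum_nonneg antisym)
  then have "\<And>f. f \<in> F \<Longrightarrow> M f = L f"
    using F(1) by (simp add: sum_nonneg_eq_0_iff)
  then show ?thesis using that M(1) by blast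
qed

text \<open>A basic neighbourhood of a state tests finitely many functions, and all states vanish at
  the discontinuous ones. So \<open>states_finite_approximation\<close> finds a member of the closed
  set \<open>N\<close> in every neighbourhood.\<close>

lemma states_subset_closed_convex:
  assumes X: "compact_space X" "topspace X \<noteq> {}"
    and N: "closedin weak_star N" "N \<subseteq> states X" "convex N" "\<And>x. x \<in> topspace X \<Longrightarrow> point_mass X x \<in> N"
  shows "N = states X"
proof (rule antisym[OF N(2)], rule subsetI, rule ccontr)
  fix L assume L: "L \<in> states X" "L \<notin> N"
  have o: "openin weak_star (UNIV - N)"
    using N(1) by (simp add: closedin_def)
  have LN: "L \<in> UNIV - N" using L(2) by simp
  obtain F e where F: "finite F" "e > 0"
    "\<forall>M. (\<forall>f\<in>F. \<bar>M f - L f\<bar> < e) \<longrightarrow> M \<in> UNIV - N"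
    by (rule weak_star_neighbourhood[OF o LN])
  obtain M where M: "M \<in> N" "\<And>f. f \<in> {f \<in> F. continuous_map X euclideanreal f} \<Longrightarrow> M f = L f"
    by (rule states_finite_approximation[OF X N L(1), of "{f \<in> F. continuous_map X euclideanreal f}"])
      (use F(1) in auto)
  have "M f = L f" if "f \<in> F" for f
    using M N(2) that state_outside[of _ X f] L(1) by (cases "continuous_map X euclideanreal f") (simp, metis subsetD)
  then have "M \<in> UNIV - N" using F(2,3) by simp
  then show False using M(1) by simp
qed

text \<open>The tube argument around \<open>{g} \<times> topspace X\<close> makes the estimate
  uniform in \<open>x\<close>. Then \<open>f \<circ> a h\<close> is uniformly close to
  \<open>f \<circ> a g\<close>, which is felt equally little by all states; this is what gives joint
  continuity of the induced action.\<close>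

lemma dynamical_system_uniform:
  assumes X: "dynamical_system metr X a" and f: "continuous_map X euclideanreal f" and "e > 0"
  obtains N where "openin euclidean N" "g \<in> N"
    "\<forall>h\<in>N. \<forall>x\<in>topspace X. \<bar>f (a h x) - f (a g x)\<bar> < e"
proof -
  let ?P = "prod_topology euclidean X"
  define W where "W = {p \<in> topspace ?P. f (a (fst p) (snd p)) - f (a g (snd p)) \<in> {-e<..<e}}"
  have "continuous_map ?P euclideanreal (\<lambda>p. f (a (fst p) (snd p)))"
    using continuous_map_compose[OF dynamical_system_jointly_continuous[OF X] f]
    by (simp add: comp_def case_prod_unfold)
  moreover have "continuous_map ?P euclideanreal (\<lambda>p. f (a g (snd p)))"
    using continuous_map_compose[OF continuous_map_compose[OF continuous_map_snd
        dynamical_system_continuous[OF X]] f] by (simp add: comp_def)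
  ultimately have W: "openin ?P W"
    unfolding W_def by (intro openin_continuous_map_preimage[OF continuous_map_diff]) auto
  have g: "compactin euclidean {g}" "{g} \<times> topspace X \<subseteq> W"
    using \<open>e > 0\<close> by (auto simp: W_def)
  have "compactin X (topspace X)"
    using X by (simp add: dynamical_system_def compact_space_def)
  then obtain N V where N: "openin euclidean N" "openin X V" "{g} \<subseteq> N" "topspace X \<subseteq> V" "N \<times> V \<subseteq> W"
    by (rule Wallace_theorem_prod_topology[OF g(1) _ W g(2)])
  have "\<bar>f (a h x) - f (a g x)\<bar> < e" if "h \<in> N" "x \<in> topspace X" for h x
    using subsetD[OF N(5), of "(h, x)"] subsetD[OF N(4)] that by (auto simp: W_def)
  then show ?thesis using that N(1,3) by blast
qed

lemma dynamical_system_states: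
  assumes X: "dynamical_system metr X a"
  shows "dynamical_system metr (subtopology weak_star (states X)) (induced_action a)"
proof (rule dynamical_systemI)
  let ?S = "subtopology weak_star (states X)"
  have cX: "compact_space X" and ne: "topspace X \<noteq> {}" using X by (auto simp: dynamical_system_def)
  show "topspace ?S \<noteq> {}"
    using ne point_mass_in_states[of _ X] by fastforce
  show "compact_space ?S"
    using compactin_states[OF cX] by (simp add: compact_space_subtopology)
  show "Hausdorff_space ?S"
    by (simp add: Hausdorff_weak_star Hausdorff_space_subtopology)
  show "metr \<Longrightarrow> metrizable_space ?S"
    using X metrizable_space_states by (auto simp: dynamical_system_def)
  have "continuous_map (prod_topology euclidean ?S) euclideanreal (\<lambda>(g, L). induced_action a g L f)" for f
  proof (cases "continuous_map X euclideanreal f")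
    case True
    show ?thesis
      unfolding Met_TC.continuous_map_to_metric[unfolded mtopology_is_euclidean]
    proof (intro ballI allI impI)
      fix p and e :: real assume p: "p \<in> topspace (prod_topology (euclidean :: 'b topology) ?S)" and "0 < e"
      then obtain g L where gL: "p = (g, L)" "L \<in> states X" by auto
      obtain N where N: "openin euclidean N" "g \<in> N"
        "\<forall>h\<in>N. \<forall>x\<in>topspace X. \<bar>f (a h x) - f (a g x)\<bar> < e / 2"
        by (rule dynamical_system_uniform[OF X True half_gt_zero[OF \<open>0 < e\<close>], of g])
      \<comment> \<open>Half of \<open>e\<close> is spent on moving the state with \<open>g\<close>
        fixed, the other half on moving the group element, which \<open>N\<close> controls for all
        states at once.\<close>
      define V where "V = {M \<in> topspace ?S. M (f \<circ> a g) \<in> ball (L (f \<circ> a g)) (e / 2)}"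
      have V: "openin ?S V"
        unfolding V_def
        by (intro openin_continuous_map_preimage[OF continuous_map_from_subtopology[OF continuous_map_weak_star_apply]]) simp
      have cont: "continuous_map X euclideanreal (f \<circ> a h)" for h
        using continuous_map_compose[OF dynamical_system_continuous[OF X] True] .
      have "(case q of (g, L) \<Rightarrow> induced_action a g L f) \<in> ball (induced_action a g L f) e"
        if "q \<in> N \<times> V" for q
      proof -
        from that obtain h M where q: "q = (h, M)" "h \<in> N" "M \<in> V" by auto
        then have "M \<in> states X" by (simp add: V_def)
        then have "\<bar>M (f \<circ> a h) - M (f \<circ> a g)\<bar> \<le> e / 2"
        proof (rule state_abs_diff_le[OF _ cont cont])
          fix x assume "x \<in> topspace X"
          then show "\<bar>(f \<circ> a h) x - (f \<circ> a g) x\<bar> \<le> e / 2"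
            using N(3) q(2) by (simp add: less_imp_le)
        qed
        moreover have "\<bar>L (f \<circ> a g) - M (f \<circ> a g)\<bar> < e / 2"
          using q(3) by (simp add: V_def dist_real_def)
        ultimately have "\<bar>L (f \<circ> a g) - M (f \<circ> a h)\<bar> < e" by linarith
        then show ?thesis by (simp add: q(1) induced_action_def dist_real_def)
      qed
      moreover have "openin (prod_topology euclidean ?S) (N \<times> V)"
        using N(1) V by (simp add: openin_prod_Times_iff)
      moreover have "p \<in> N \<times> V"
        using N(2) gL \<open>0 < e\<close> by (simp add: V_def)
      ultimately show "\<exists>U. openin (prod_topology euclidean ?S) U \<and> p \<in> U \<and>
          (\<forall>q\<in>U. (case q of (g, L) \<Rightarrow> induced_action a g L f)
            \<in> Met_TC.mball (case p of (g, L) \<Rightarrow> induced_action a g L f) e)"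
        unfolding gL(1) by (intro exI[of _ "N \<times> V"]) auto
    qed
  next
    case False
    have "continuous_map (prod_topology euclidean ?S) euclideanreal (\<lambda>_. 0)" by simp
    then show ?thesis
      by (rule continuous_map_eq)
        (auto simp: state_outside[OF induced_action_in_states[OF X] False])
  qed
  then have "continuous_map (prod_topology euclidean ?S) weak_star (\<lambda>(g, L). induced_action a g L)"
    unfolding continuous_map_weak_star_iff by (simp add: case_prod_unfold)
  then show "continuous_map (prod_topology euclidean ?S) ?S (\<lambda>(g, L). induced_action a g L)"
    using induced_action_in_states[OF X] by (auto simp: continuous_map_in_subtopology)
next
  fix L assume "L \<in> topspace (subtopology weak_star (states X))"
  then have L: "L \<in> states X" by simp
  show "induced_action a (g + h) L = induced_action a g (induced_action a h L)" for g h
    unfolding induced_action_def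
    by (intro ext state_cong[OF L]) (simp add: dynamical_system_add[OF X])
  show "induced_action a 0 L = L"
    unfolding induced_action_def
    by (intro ext state_cong[OF L]) (simp add: dynamical_system_zero[OF X])
qed

lemma affine_map_on_induced_action: "affine_map_on S (induced_action a g)"
  by (simp add: affine_map_on_def induced_action_def fun_eq_iff)

lemma affine_system_states:
  assumes X: "dynamical_system metr X a"
  shows "affine_system metr weak_star (states X) (induced_action a)"
  using locally_convex_tvs_weak_star convex_states dynamical_system_states[OF X]
    affine_map_on_induced_action by (auto simp: affine_system_def)

lemma irreducible_affine_system_states:
  assumes "minimal_strongly_proximal metr X a"
  shows "irreducible_affine_system metr weak_star (states X) (induced_action a)"
  unfolding irreducible_affine_system_def
proof (intro conjI allI impI)
  have X: "dynamical_system metr X a"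
    and min: "\<And>C. closedin X C \<Longrightarrow> C \<noteq> {} \<Longrightarrow> invariant a C \<Longrightarrow> C = topspace X"
    using assms by (auto simp: minimal_strongly_proximal_def minimal_system_def)
  have cX: "compact_space X" "Hausdorff_space X" and ne: "topspace X \<noteq> {}"
    using X by (auto simp: dynamical_system_def)
  show "affine_system metr weak_star (states X) (induced_action a)" by (rule affine_system_states[OF X])
  fix N assume N: "N \<subseteq> states X \<and> N \<noteq> {} \<and> closedin (subtopology weak_star (states X)) N \<and> convex N \<and>
    invariant (induced_action a) N"
  then have cN: "closedin weak_star N"
    using closedin_states closedin_closed_subtopology by blast
  obtain \<mu> where mu: "\<mu> \<in> N" using N by blast
  have orb: "induced_action a g \<mu> \<in> N" for g using N mu by (auto simp: invariant_def)
  have "\<mu> \<in> prob_space_of X" using mu N by (auto simp: prob_space_of_eq_states[OF cX])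
  then obtain x where x: "x \<in> topspace X" and lim: "if metr
      then \<exists>s::nat \<Rightarrow> _. limitin weak_star (\<lambda>n. induced_action a (s n) \<mu>) (point_mass X x) sequentially
      else \<exists>F. F \<noteq> bot \<and> limitin weak_star (\<lambda>g. induced_action a g \<mu>) (point_mass X x) F"
    using assms unfolding minimal_strongly_proximal_def strongly_proximal_def by blast
  have "point_mass X x \<in> N"
  proof (cases metr)
    case True
    then obtain s :: "nat \<Rightarrow> _"
      where s: "limitin weak_star (\<lambda>n. induced_action a (s n) \<mu>) (point_mass X x) sequentially"
      using lim by auto
    show ?thesis by (rule limitin_closedin[OF s cN]) (auto simp: orb)
  next
    case False
    then obtain F where "F \<noteq> bot" and F: "limitin weak_star (\<lambda>g. induced_action a g \<mu>) (point_mass X x) F"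
      using lim by auto
    then show ?thesis by (intro limitin_closedin[OF F cN]) (auto simp: orb)
  qed
  \<comment> \<open>Minimality of \<open>X\<close> speaks of points, so \<open>N\<close> is pulled
    back along the point masses to a closed invariant subset of \<open>X\<close>.\<close>
  define C where "C = {y \<in> topspace X. point_mass X y \<in> N}"
  have "closedin X C"
    unfolding C_def by (rule closedin_continuous_map_preimage[OF continuous_map_point_mass cN])
  moreover have "C \<noteq> {}" using x \<open>point_mass X x \<in> N\<close> by (auto simp: C_def)
  moreover have "invariant a C"
    unfolding invariant_def C_def
  proof (intro allI image_subsetI CollectI conjI)
    fix g y assume y: "y \<in> {y \<in> topspace X. point_mass X y \<in> N}"
    then show "a g y \<in> topspace X" using dynamical_system_in_topspace[OF X] by simp
    have "induced_action a g (point_mass X y) \<in> N" using N y by (auto simp: invariant_def)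
    then show "point_mass X (a g y) \<in> N" using y by (simp add: induced_action_point_mass[OF X])
  qed
  ultimately have "C = topspace X" by (rule min)
  then show "N = states X"
    using N cN by (intro states_subset_closed_convex[OF cX(1) ne]) (auto simp: C_def)
qed

section \<open>Continuous linear functionals\<close>

definition sublinear :: "('v::real_vector \<Rightarrow> real) \<Rightarrow> bool"
  where "sublinear p \<longleftrightarrow> (\<forall>x y. p (x + y) \<le> p x + p y) \<and> (\<forall>c x. 0 < c \<longrightarrow> p (c *\<^sub>R x) = c * p x) \<and> p 0 = 0"

lemma sublinear_add: "sublinear p \<Longrightarrow> p (x + y) \<le> p x + p y"
  by (simp add: sublinear_def)

lemma sublinear_scale: "sublinear p \<Longrightarrow> 0 \<le> c \<Longrightarrow> p (c *\<^sub>R x) = c * p x"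
  by (cases "c = 0") (simp_all add: sublinear_def)

lemma sublinear_zero: "sublinear p \<Longrightarrow> p 0 = 0"
  by (simp add: sublinear_def)

lemma sublinear_minus: "sublinear p \<Longrightarrow> - p (- x) \<le> p x"
  using sublinear_add[of p x "- x"] by (simp add: sublinear_zero)

text \<open>Serves three infima: over shifts along a vector, over a chain of sublinear functionals,
  and in the Minkowski gauge. The set \<open>\<Phi> x\<close> lists the values competing at
  \<open>x\<close>.\<close>

lemma sublinear_Inf:
  fixes \<Phi> :: "'v::real_vector \<Rightarrow> real set"
  assumes ne: "\<And>x. \<Phi> x \<noteq> {}" and bdd: "\<And>x. bdd_below (\<Phi> x)" and zero: "Inf (\<Phi> 0) = 0"
    and add: "\<And>x y a b. a \<in> \<Phi> x \<Longrightarrow> b \<in> \<Phi> y \<Longrightarrow> \<exists>c\<in>\<Phi> (x + y). c \<le> a + b"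
    and scale: "\<And>x a c. a \<in> \<Phi> x \<Longrightarrow> 0 < c \<Longrightarrow> \<exists>b\<in>\<Phi> (c *\<^sub>R x). b \<le> c * a"
  shows "sublinear (\<lambda>x. Inf (\<Phi> x))"
  unfolding sublinear_def
proof (intro conjI allI impI)
  fix x y
  have "Inf (\<Phi> (x + y)) \<le> a + b" if ab: "a \<in> \<Phi> x" "b \<in> \<Phi> y" for a b
    using add[OF ab] cInf_lower[OF _ bdd] by force
  then have "Inf (\<Phi> (x + y)) - b \<le> Inf (\<Phi> x)" if "b \<in> \<Phi> y" for b
    using that by (intro cInf_greatest ne) (simp add: diff_le_eq)
  then have "Inf (\<Phi> (x + y)) - Inf (\<Phi> x) \<le> Inf (\<Phi> y)"
    by (intro cInf_greatest ne) (simp add: diff_le_eq add.commute)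
  then show "Inf (\<Phi> (x + y)) \<le> Inf (\<Phi> x) + Inf (\<Phi> y)" by simp
next
  have le: "Inf (\<Phi> (c *\<^sub>R x)) \<le> c * Inf (\<Phi> x)" if "0 < c" for c and x :: 'v
  proof -
    have "Inf (\<Phi> (c *\<^sub>R x)) / c \<le> a" if "a \<in> \<Phi> x" for a
    proof -
      have "Inf (\<Phi> (c *\<^sub>R x)) \<le> c * a"
        using scale[OF that \<open>0 < c\<close>] cInf_lower[OF _ bdd] by force
      then show ?thesis using \<open>0 < c\<close> by (simp add: divide_le_eq mult.commute)
    qed
    then have "Inf (\<Phi> (c *\<^sub>R x)) / c \<le> Inf (\<Phi> x)" by (intro cInf_greatest ne)
    then show ?thesis using \<open>0 < c\<close> by (simp add: divide_le_eq mult.commute)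
  qed
  fix c :: real and x assume "0 < c"
  have "Inf (\<Phi> x) \<le> (1 / c) * Inf (\<Phi> (c *\<^sub>R x))"
    using le[of "1 / c" "c *\<^sub>R x"] \<open>0 < c\<close> by simp
  then have "c * Inf (\<Phi> x) \<le> Inf (\<Phi> (c *\<^sub>R x))"
    using \<open>0 < c\<close> by (simp add: le_divide_eq mult.commute)
  then show "Inf (\<Phi> (c *\<^sub>R x)) = c * Inf (\<Phi> x)"
    using le[OF \<open>0 < c\<close>] by (simp add: antisym)
qed (fact zero)

text \<open>
  The functional \<open>x \<mapsto> inf\<^bsub>t \<ge> 0\<^esub> (p (x + t y) - t p y)\<close> is sublinear and at most \<open>p\<close>. A minimal
  sublinear functional \<open>p\<close> is therefore equal to it, which gives \<open>p x + p y \<le> p (x + y)\<close>.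
\<close>

lemma sublinear_shift:
  assumes p: "sublinear p"
  obtains q where "sublinear q" "\<And>x. q x \<le> p x" "\<And>x. q x \<le> p (x + y) - p y"
proof -
  define \<Phi> where "\<Phi> x = (\<lambda>t. p (x + t *\<^sub>R y) - t * p y) ` {0..}" for x
  have bdd: "bdd_below (\<Phi> x)" for x
  proof (rule bdd_belowI)
    fix a assume "a \<in> \<Phi> x"
    then obtain t where t: "0 \<le> t" "a = p (x + t *\<^sub>R y) - t * p y" by (auto simp: \<Phi>_def)
    \<comment> \<open>From \<open>p (t *\<^sub>R y) \<le> p (x + t *\<^sub>R y) + p (- x)\<close>:
      the term \<open>t * p y\<close> cancels, so the bound does not depend on
      \<open>t\<close>.\<close>
    show "- p (- x) \<le> a"
      using sublinear_add[OF p, of "x + t *\<^sub>R y" "- x"] t by (simp add: sublinear_scale[OF p])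
  qed
  have "sublinear (\<lambda>x. Inf (\<Phi> x))"
  proof (rule sublinear_Inf)
    show "\<Phi> x \<noteq> {}" for x by (auto simp: \<Phi>_def)
    have "\<Phi> 0 = {0}"
      using sublinear_scale[OF p] by (auto simp: \<Phi>_def image_def)
    then show "Inf (\<Phi> 0) = 0" by simp
  next
    fix x z a b assume "a \<in> \<Phi> x" "b \<in> \<Phi> z"
    then obtain s t where st: "0 \<le> s" "a = p (x + s *\<^sub>R y) - s * p y" "0 \<le> t" "b = p (z + t *\<^sub>R y) - t * p y"
      by (auto simp: \<Phi>_def)
    have "p (x + z + (s + t) *\<^sub>R y) \<le> p (x + s *\<^sub>R y) + p (z + t *\<^sub>R y)"
      using sublinear_add[OF p, of "x + s *\<^sub>R y" "z + t *\<^sub>R y"] by (simp add: algebra_simps)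
    then have "p (x + z + (s + t) *\<^sub>R y) - (s + t) * p y \<le> a + b"
      using st by (simp add: algebra_simps)
    moreover have "p (x + z + (s + t) *\<^sub>R y) - (s + t) * p y \<in> \<Phi> (x + z)"
      unfolding \<Phi>_def using st by (intro imageI) simp
    ultimately show "\<exists>c\<in>\<Phi> (x + z). c \<le> a + b" by blast
  next
    fix x a and c :: real assume "a \<in> \<Phi> x" "0 < c"
    then obtain t where t: "0 \<le> t" "a = p (x + t *\<^sub>R y) - t * p y" by (auto simp: \<Phi>_def)
    have "p (c *\<^sub>R x + (c * t) *\<^sub>R y) = c * p (x + t *\<^sub>R y)"
      using sublinear_scale[OF p, of c "x + t *\<^sub>R y"] \<open>0 < c\<close> by (simp add: scaleR_add_right)
    then have "p (c *\<^sub>R x + (c * t) *\<^sub>R y) - (c * t) * p y \<le> c * a"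
      using t by (simp add: right_diff_distrib)
    moreover have "p (c *\<^sub>R x + (c * t) *\<^sub>R y) - (c * t) * p y \<in> \<Phi> (c *\<^sub>R x)"
      unfolding \<Phi>_def using t \<open>0 < c\<close> by (intro imageI) simp
    ultimately show "\<exists>b\<in>\<Phi> (c *\<^sub>R x). b \<le> c * a" by blast
  qed (rule bdd)
  \<comment> \<open>This bound is the parameter \<open>t = 0\<close>, the next one is
    \<open>t = 1\<close>.\<close>
  moreover have "Inf (\<Phi> x) \<le> p x" for x
    by (rule cInf_lower[OF _ bdd]) (auto simp: \<Phi>_def image_def intro!: bexI[of _ 0])
  moreover have "Inf (\<Phi> x) \<le> p (x + y) - p y" for x
    by (rule cInf_lower[OF _ bdd]) (auto simp: \<Phi>_def image_def intro!: bexI[of _ 1])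
  ultimately show ?thesis using that by blast
qed

text \<open>Zorn's lemma for the reversed order. The pointwise infimum of a chain is finite because
  every sublinear \<open>q\<close> below \<open>p\<close> satisfies
  \<open>- p (- x) \<le> q x\<close>.\<close>

lemma minimal_sublinear:
  fixes p :: "'v::real_vector \<Rightarrow> real"
  assumes p: "sublinear p"
  obtains l where "sublinear l" "l \<le> p" "\<And>q. sublinear q \<Longrightarrow> q \<le> l \<Longrightarrow> q = l"
proof -
  define A where "A = {q. sublinear q \<and> q \<le> p}"
  have "\<exists>l\<in>A. \<forall>q\<in>A. q \<le> l \<longrightarrow> q = l"
  proof (rule predicate_Zorn)
    show "partial_order_on A (relation_of (\<lambda>x y. y \<le> x) A)"
      by (rule partial_order_on_relation_ofI) auto
    fix C assume C: "C \<in> Chains (relation_of (\<lambda>x y. y \<le> x) A)"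
    then have CA: "C \<subseteq> A" and chain: "\<And>q r. q \<in> C \<Longrightarrow> r \<in> C \<Longrightarrow> q \<le> r \<or> r \<le> q"
      by (auto simp: Chains_def relation_of_def)
    show "\<exists>u\<in>A. \<forall>q\<in>C. u \<le> q"
    proof (cases "C = {}")
      case True
      then show ?thesis using p by (auto simp: A_def)
    next
      case False
      have sub: "sublinear q" "\<And>x. q x \<le> p x" if "q \<in> C" for q
        using that CA by (auto simp: A_def le_fun_def)
      define \<Phi> where "\<Phi> x = (\<lambda>q. q x) ` C" for x
      have bdd: "bdd_below (\<Phi> x)" for x
      proof (rule bdd_belowI)
        fix a assume "a \<in> \<Phi> x"
        then obtain q where q: "q \<in> C" "a = q x" by (auto simp: \<Phi>_def)
        show "- p (- x) \<le> a"
          using sublinear_minus[OF sub(1)[OF q(1)], of x] sub(2)[OF q(1), of "- x"] q(2) by linarith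
      qed
      have "sublinear (\<lambda>x. Inf (\<Phi> x))"
      proof (rule sublinear_Inf)
        show "\<Phi> x \<noteq> {}" for x using False by (simp add: \<Phi>_def)
        have "\<Phi> 0 = {0}" using False sub(1) by (auto simp: \<Phi>_def image_def sublinear_zero)
        then show "Inf (\<Phi> 0) = 0" by simp
      next
        fix x y a b assume "a \<in> \<Phi> x" "b \<in> \<Phi> y"
        then obtain q r where qr: "q \<in> C" "r \<in> C" "a = q x" "b = r y" by (auto simp: \<Phi>_def)
        show "\<exists>c\<in>\<Phi> (x + y). c \<le> a + b"
        proof (cases "q \<le> r")
          case True
          then have "q (x + y) \<le> a + b"
            using sublinear_add[OF sub(1)[OF qr(1)], of x y] le_funD[OF True, of y] qr by linarith
          then show ?thesis using qr by (auto simp: \<Phi>_def)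
        next
          case False
          then have "r \<le> q" using chain qr by blast
          then have "r (x + y) \<le> a + b"
            using sublinear_add[OF sub(1)[OF qr(2)], of x y] le_funD[OF \<open>r \<le> q\<close>, of x] qr by linarith
          then show ?thesis using qr by (auto simp: \<Phi>_def)
        qed
      next
        fix x a and c :: real assume "a \<in> \<Phi> x" "0 < c"
        then show "\<exists>b\<in>\<Phi> (c *\<^sub>R x). b \<le> c * a"
          using sub(1) by (force simp: \<Phi>_def sublinear_scale)
      qed (rule bdd)
      moreover have lower: "Inf (\<Phi> x) \<le> q x" if "q \<in> C" for q x
        using that by (intro cInf_lower bdd) (auto simp: \<Phi>_def)
      moreover obtain q where "q \<in> C" using False by blast
      then have "Inf (\<Phi> x) \<le> p x" for x
        using lower[OF \<open>q \<in> C\<close>, of x] sub(2)[OF \<open>q \<in> C\<close>, of x] by linarith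
      ultimately show ?thesis
        by (intro bexI[of _ "\<lambda>x. Inf (\<Phi> x)"]) (auto simp: A_def le_fun_def)
    qed
  qed
  then show ?thesis
    using that order_trans unfolding A_def by (metis (no_types, lifting) mem_Collect_eq)
qed

text \<open>Shifting along \<open>v\<close> before minimising forces
  \<open>q (- v) \<le> - p v\<close>, so a linear functional below \<open>q\<close> must take the
  value \<open>p v\<close> at \<open>v\<close>. A minimal functional is unchanged by every further
  shift, which makes it superadditive and hence linear.\<close>

lemma Hahn_Banach_sublinear:
  fixes p :: "'v::real_vector \<Rightarrow> real"
  assumes p: "sublinear p"
  obtains l where "linear l" "\<And>x. l x \<le> p x" "l v = p v"
proof -
  obtain q where q: "sublinear q" "\<And>x. q x \<le> p x" "\<And>x. q x \<le> p (x + v) - p v"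
    using sublinear_shift[OF p, of v] by blast
  obtain l where l: "sublinear l" "l \<le> q" "\<And>r. sublinear r \<Longrightarrow> r \<le> l \<Longrightarrow> r = l"
    using minimal_sublinear[OF q(1)] by blast
  have ge: "l x + l y \<le> l (x + y)" for x y
  proof -
    obtain r where r: "sublinear r" "\<And>x. r x \<le> l x" "\<And>x. r x \<le> l (x + y) - l y"
      using sublinear_shift[OF l(1), of y] by blast
    then have "r = l" by (intro l(3)) (auto simp: le_fun_def)
    then show ?thesis using r(3)[of x] by simp
  qed
  then have add: "l (x + y) = l x + l y" for x y
    using sublinear_add[OF l(1)] by (simp add: antisym)
  have neg: "l (- x) = - l x" for x
    using add[of x "- x"] sublinear_zero[OF l(1)] by simp
  have "linear l"
  proof (rule linearI)
    fix c x
    show "l (c *\<^sub>R x) = c *\<^sub>R l x"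
      using sublinear_scale[OF l(1), of c x] sublinear_scale[OF l(1), of "- c" x] neg[of "c *\<^sub>R x"]
      by (cases "0 \<le> c") auto
  qed (fact add)
  moreover have "l x \<le> p x" for x
    using le_funD[OF l(2), of x] q(2)[of x] by linarith
  moreover have "l v = p v"
  proof (rule antisym)
    have "l (- v) \<le> p (- v + v) - p v"
      using le_funD[OF l(2), of "- v"] q(3)[of "- v"] by linarith
    then show "p v \<le> l v" using neg[of v] sublinear_zero[OF p] by simp
  qed fact
  ultimately show ?thesis using that by blast
qed

section \<open>Gauges and separation of points in locally convex spaces\<close>

lemma lctvs_continuous_add:
  assumes "locally_convex_tvs T" "continuous_map X T f" "continuous_map X T g"
  shows "continuous_map X T (\<lambda>x. f x + g x)"
proof -
  have "continuous_map X (prod_topology T T) (\<lambda>x. (f x, g x))"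
    using assms by (simp add: continuous_map_pairedI)
  moreover have "continuous_map (prod_topology T T) T (\<lambda>(x, y). x + y)"
    using assms(1) by (simp add: locally_convex_tvs_def)
  ultimately show ?thesis
    using continuous_map_compose by (fastforce simp: comp_def)
qed

lemma lctvs_continuous_scaleR:
  assumes "locally_convex_tvs T" "continuous_map X euclideanreal c" "continuous_map X T f"
  shows "continuous_map X T (\<lambda>x. c x *\<^sub>R f x)"
proof -
  have "continuous_map X (prod_topology euclideanreal T) (\<lambda>x. (c x, f x))"
    using assms by (simp add: continuous_map_pairedI)
  moreover have "continuous_map (prod_topology euclideanreal T) T (\<lambda>(c, x). c *\<^sub>R x)"
    using assms(1) by (simp add: locally_convex_tvs_def)
  ultimately show ?thesis
    using continuous_map_compose by (fastforce simp: comp_def)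
qed

lemma lctvs_affine_preimage_open:
  assumes T: "locally_convex_tvs T" and U: "openin T U"
  shows "openin T {x. c *\<^sub>R (x + z) \<in> U}"
proof -
  have top: "topspace T = UNIV" using T by (simp add: locally_convex_tvs_def)
  have "continuous_map T T (\<lambda>x. c *\<^sub>R (x + z))"
    by (intro lctvs_continuous_scaleR[OF T] lctvs_continuous_add[OF T]) (auto simp: top)
  from openin_continuous_map_preimage[OF this U] show ?thesis by (simp add: top)
qed

text \<open>The Minkowski gauge of \<open>V\<close>. As \<open>V\<close> may fail to be symmetric,
  it is a sublinear functional rather than a seminorm; it is finite because
  \<open>s *\<^sub>R x\<close> enters \<open>V\<close> for small \<open>s\<close>.\<close>

lemma sublinear_gauge:
  fixes V :: "'v::real_vector set"
  assumes T: "locally_convex_tvs T" and V: "openin T V" "0 \<in> V" "convex V"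
  obtains p where "sublinear p" "\<And>x. x \<in> V \<Longrightarrow> p x \<le> 1" "\<And>x. x \<notin> V \<Longrightarrow> 1 \<le> p x"
proof -
  have top: "topspace T = UNIV" using T by (simp add: locally_convex_tvs_def)
  define \<Phi> where "\<Phi> x = {t. 0 < t \<and> (1 / t) *\<^sub>R x \<in> V}" for x
  have ne: "\<Phi> x \<noteq> {}" for x
  proof -
    have "continuous_map euclideanreal T (\<lambda>s. s *\<^sub>R x)"
      by (intro lctvs_continuous_scaleR[OF T]) (auto simp: top)
    from openin_continuous_map_preimage[OF this V(1)]
    have "open {s. s *\<^sub>R x \<in> V}" by simp
    moreover have "0 \<in> {s. s *\<^sub>R x \<in> V}" using V(2) by simp
    ultimately obtain e where e: "e > 0" "ball 0 e \<subseteq> {s. s *\<^sub>R x \<in> V}"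
      by (meson open_contains_ball)
    then have "2 / e \<in> \<Phi> x" using subsetD[OF e(2), of "e / 2"] by (simp add: \<Phi>_def)
    then show ?thesis by blast
  qed
  have bdd: "bdd_below (\<Phi> x)" for x
    by (rule bdd_belowI[of _ 0]) (simp add: \<Phi>_def less_imp_le)
  have "sublinear (\<lambda>x. Inf (\<Phi> x))"
  proof (rule sublinear_Inf[OF ne bdd])
    have "\<Phi> 0 = {0<..}" using V(2) by (auto simp: \<Phi>_def)
    then show "Inf (\<Phi> 0) = 0" by simp
  next
    fix x y a b assume a: "a \<in> \<Phi> x" and b: "b \<in> \<Phi> y"
    have "(a / (a + b)) *\<^sub>R ((1 / a) *\<^sub>R x) + (b / (a + b)) *\<^sub>R ((1 / b) *\<^sub>R y) \<in> V"
      using a b by (intro convexD[OF V(3)]) (auto simp: \<Phi>_def simp flip: add_divide_distrib)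
    then have "(1 / (a + b)) *\<^sub>R (x + y) \<in> V"
      using a b by (simp add: \<Phi>_def scaleR_add_right)
    then have "a + b \<in> \<Phi> (x + y)" using a b by (simp add: \<Phi>_def)
    then show "\<exists>c\<in>\<Phi> (x + y). c \<le> a + b" by blast
  next
    fix x a and c :: real assume "a \<in> \<Phi> x" "0 < c"
    then have "c * a \<in> \<Phi> (c *\<^sub>R x)" by (simp add: \<Phi>_def)
    then show "\<exists>b\<in>\<Phi> (c *\<^sub>R x). b \<le> c * a" by blast
  qed
  moreover have "Inf (\<Phi> x) \<le> 1" if "x \<in> V" for x
    using that by (intro cInf_lower bdd) (simp add: \<Phi>_def)
  moreover have "1 \<le> Inf (\<Phi> x)" if x: "x \<notin> V" for x
  proof (rule cInf_greatest[OF ne])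
    fix t assume t: "t \<in> \<Phi> x"
    show "1 \<le> t"
    proof (rule ccontr)
      assume "\<not> 1 \<le> t"
      then have "(1 - t) *\<^sub>R 0 + t *\<^sub>R ((1 / t) *\<^sub>R x) \<in> V"
        using t V(2) by (intro convexD[OF V(3)]) (auto simp: \<Phi>_def)
      then show False using t x by (simp add: \<Phi>_def)
    qed
  qed
  ultimately show ?thesis using that by blast
qed

text \<open>A convex neighbourhood \<open>V\<close> of 0 that omits \<open>x - y\<close> has gauge
  at least 1 at \<open>x - y\<close>. Hahn-Banach gives a functional that attains the gauge there
  and lies below it everywhere, hence is at most 1 on \<open>V\<close>; the latter also makes it
  continuous.\<close>

theorem lctvs_separation:
  fixes x y :: "'v::real_vector"
  assumes T: "locally_convex_tvs T" and "x \<noteq> y"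
  obtains l where "linear l" "continuous_map T euclideanreal l" "l x \<noteq> l y"
proof -
  have top: "topspace T = UNIV" using T by (simp add: locally_convex_tvs_def)
  obtain U where U: "openin T U" "0 \<in> U" "x - y \<notin> U"
    using T \<open>x \<noteq> y\<close> unfolding locally_convex_tvs_def Hausdorff_space_def disjnt_iff
    by (metis UNIV_I right_minus_eq)
  then obtain V where V: "openin T V" "0 \<in> V" "convex V" "V \<subseteq> U"
    using T unfolding locally_convex_tvs_def by blast
  obtain p where p: "sublinear p" "\<And>x. x \<in> V \<Longrightarrow> p x \<le> 1" "\<And>x. x \<notin> V \<Longrightarrow> 1 \<le> p x"
    using sublinear_gauge[OF T V(1-3)] by blast
  obtain l where l: "linear l" "\<And>x. l x \<le> p x" "l (x - y) = p (x - y)"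
    using Hahn_Banach_sublinear[OF p(1), of "x - y"] by blast
  have "l (x - y) \<ge> 1" using p(3)[of "x - y"] l(3) U(3) V(4) by auto
  then have "l x \<noteq> l y" using linear_diff[OF l(1)] by auto
  moreover have "continuous_map T euclideanreal l"
    unfolding Met_TC.continuous_map_to_metric[unfolded mtopology_is_euclidean]
  proof (intro ballI allI impI)
    fix z and e :: real assume "0 < e"
    \<comment> \<open>The bound on \<open>V\<close> is one-sided, so both signs are imposed on
      \<open>w - z\<close>. The factor 2 yields \<open>\<le> e / 2\<close>, hence the strict
      inequality required by a ball.\<close>
    define W where "W = {w. (2 / e) *\<^sub>R (w + - z) \<in> V} \<inter> {w. (- 2 / e) *\<^sub>R (w + - z) \<in> V}"
    have "openin T W"
      unfolding W_def by (intro openin_Int lctvs_affine_preimage_open[OF T V(1)])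
    moreover have "z \<in> W" using V(2) by (simp add: W_def)
    moreover have "l w \<in> ball (l z) e" if "w \<in> W" for w
    proof -
      have le: "l u \<le> 1" if "u \<in> V" for u using p(2)[OF that] l(2)[of u] by linarith
      have "(2 / e) * (l w - l z) \<le> 1" "(- 2 / e) * (l w - l z) \<le> 1"
        using le[of "(2 / e) *\<^sub>R (w + - z)"] le[of "(- 2 / e) *\<^sub>R (w + - z)"] \<open>w \<in> W\<close>
        by (simp_all add: W_def linear_cmul[OF l(1)] linear_diff[OF l(1)] linear_neg[OF l(1)])
      then have "l w - l z \<le> e / 2" "l z - l w \<le> e / 2"
        using \<open>0 < e\<close> by (auto simp: field_simps)
      then have "\<bar>l w - l z\<bar> \<le> e / 2" by linarith
      then show ?thesis using \<open>0 < e\<close> by (simp add: dist_real_def abs_minus_commute)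
    qed
    ultimately show "\<exists>U. openin T U \<and> z \<in> U \<and> (\<forall>y\<in>U. l y \<in> Met_TC.mball (l z) e)" by auto
  qed
  ultimately show ?thesis using that l(1) by blast
qed


section \<open>Extreme points\<close>

text \<open>Midpoints are the form needed later: a state is split into two of equal weight, and the
  mean of two homomorphisms is taken.\<close>

definition extreme_in :: "'v::real_vector \<Rightarrow> 'v set \<Rightarrow> bool"
  where "extreme_in q Q \<longleftrightarrow> q \<in> Q \<and>
    (\<forall>x\<in>Q. \<forall>y\<in>Q. (1/2) *\<^sub>R x + (1/2) *\<^sub>R y = q \<longrightarrow> x = q \<and> y = q)"

lemma Inter_finite_chain:
  assumes "finite \<F>" "\<F> \<noteq> {}" "\<F> \<subseteq> C" "\<And>A B. A \<in> C \<Longrightarrow> B \<in> C \<Longrightarrow> A \<subseteq> B \<or> B \<subseteq> A"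
  shows "\<Inter>\<F> \<in> C"
  using assms(1-3)
proof (induction \<F> rule: finite_ne_induct)
  case (insert A \<F>)
  then have "A \<subseteq> \<Inter>\<F> \<or> \<Inter>\<F> \<subseteq> A" using assms(4) by blast
  then have "\<Inter>(insert A \<F>) = A \<or> \<Inter>(insert A \<F>) = \<Inter>\<F>" by blast
  then show ?case using insert by auto
qed auto

text \<open>A minimal closed extreme subset is a point.\<close>

lemma extreme_point_exists:
  fixes Q :: "'v::real_vector set"
  assumes T: "locally_convex_tvs T" and Q: "compactin T Q" "Q \<noteq> {}"
  obtains q where "extreme_in q Q"
proof -
  have haus: "Hausdorff_space T" using T by (simp add: locally_convex_tvs_def)
  define A where "A = {F. F \<subseteq> Q \<and> F \<noteq> {} \<and> closedin T F \<and>
    (\<forall>x\<in>Q. \<forall>y\<in>Q. (1/2) *\<^sub>R x + (1/2) *\<^sub>R y \<in> F \<longrightarrow> x \<in> F \<and> y \<in> F)}"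
  have "\<exists>F\<in>A. \<forall>F'\<in>A. F' \<subseteq> F \<longrightarrow> F' = F"
  proof (rule predicate_Zorn)
    show "partial_order_on A (relation_of (\<lambda>x y. y \<subseteq> x) A)"
      by (rule partial_order_on_relation_ofI) auto
    fix C assume C: "C \<in> Chains (relation_of (\<lambda>x y. y \<subseteq> x) A)"
    then have CA: "C \<subseteq> A" and chain: "\<And>q r. q \<in> C \<Longrightarrow> r \<in> C \<Longrightarrow> q \<subseteq> r \<or> r \<subseteq> q"
      by (auto simp: Chains_def relation_of_def)
    show "\<exists>u\<in>A. \<forall>q\<in>C. u \<subseteq> q"
    proof (cases "C = {}")
      case True
      have "Q \<in> A" using Q compactin_imp_closedin[OF haus] by (auto simp: A_def)
      then show ?thesis using True by auto
    next
      case False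
      have "Q \<inter> \<Inter>C \<noteq> {}"
      proof -
        have "\<forall>F\<in>C. closedin T F" using CA by (auto simp: A_def)
        moreover have "Q \<inter> \<Inter>\<F> \<noteq> {}" if "finite \<F>" "\<F> \<subseteq> C" for \<F>
        proof (cases "\<F> = {}")
          case False
          have "\<Inter>\<F> \<in> C" by (rule Inter_finite_chain[OF that(1) False that(2) chain])
          then have "\<Inter>\<F> \<in> A" by (rule subsetD[OF CA])
          then have "\<Inter>\<F> \<subseteq> Q" "\<Inter>\<F> \<noteq> {}" by (simp_all add: A_def)
          then show ?thesis by (simp add: inf.absorb2)
        qed (use Q in simp)
        ultimately show ?thesis
          using Q(1)[unfolded compactin_fip, THEN conjunct2, rule_format, of C] by simp
      qed
      then have "\<Inter>C \<noteq> {}" by (metis inf_bot_right)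
      have cl: "closedin T (\<Inter>C)"
        using CA False by (intro closedin_Inter) (auto simp: A_def)
      have sub: "\<Inter>C \<subseteq> Q"
      proof -
        obtain F where "F \<in> C" using False by blast
        then have "F \<subseteq> Q" using CA by (auto simp: A_def)
        then show ?thesis using \<open>F \<in> C\<close> by blast
      qed
      have ext: "x \<in> \<Inter>C \<and> y \<in> \<Inter>C" if xy: "x \<in> Q" "y \<in> Q" "(1/2) *\<^sub>R x + (1/2) *\<^sub>R y \<in> \<Inter>C" for x y
      proof -
        have "x \<in> F \<and> y \<in> F" if "F \<in> C" for F
          using subsetD[OF CA that] InterD[OF xy(3) that] xy(1,2) by (simp add: A_def)
        then show ?thesis by blast
      qed
      define K where "K = \<Inter>C"
      have "K \<subseteq> Q" "K \<noteq> {}" "closedin T K"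
        "\<forall>x\<in>Q. \<forall>y\<in>Q. (1/2) *\<^sub>R x + (1/2) *\<^sub>R y \<in> K \<longrightarrow> x \<in> K \<and> y \<in> K"
        using sub \<open>\<Inter>C \<noteq> {}\<close> cl ext unfolding K_def by blast+
      then have "K \<in> A" by (simp add: A_def)
      then show ?thesis unfolding K_def by (rule bexI[rotated]) blast
    qed
  qed
  then obtain F where F: "F \<in> A" "\<And>F'. F' \<in> A \<Longrightarrow> F' \<subseteq> F \<Longrightarrow> F' = F" by blast
  have FQ: "F \<subseteq> Q" "F \<noteq> {}" "closedin T F" and
    ext: "\<And>x y. x \<in> Q \<Longrightarrow> y \<in> Q \<Longrightarrow> (1/2) *\<^sub>R x + (1/2) *\<^sub>R y \<in> F \<Longrightarrow> x \<in> F \<and> y \<in> F"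
    using F(1) by (simp_all add: A_def)
  have single: "x = y" if xy: "x \<in> F" "y \<in> F" for x y
  proof (rule ccontr)
    assume "x \<noteq> y"
    obtain l where l: "linear l" "continuous_map T euclideanreal l" "l x \<noteq> l y"
      by (rule lctvs_separation[OF T \<open>x \<noteq> y\<close>])
    have "compact (l ` F)"
      using image_compactin[OF closed_compactin[OF Q(1) FQ(1,3)] l(2)] by simp
    then obtain m where m: "m \<in> l ` F" "\<forall>z\<in>l ` F. z \<le> m"
      using compact_attains_sup[of "l ` F"] FQ(2) by auto
    \<comment> \<open>The part of \<open>F\<close> where \<open>l\<close> is maximal is again
      extreme in \<open>Q\<close>. By minimality it is all of \<open>F\<close>, so \<open>l\<close>
      is constant on \<open>F\<close>.\<close>
    define F' where "F' = F \<inter> {z \<in> topspace T. l z \<in> {m..}}"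
    have "closedin T F'"
      unfolding F'_def by (intro closedin_Int FQ(3) closedin_continuous_map_preimage[OF l(2)]) simp
    moreover have "F' \<noteq> {}"
      using m(1) closedin_subset[OF FQ(3)] by (auto simp: F'_def)
    moreover have "u \<in> F' \<and> w \<in> F'" if uw: "u \<in> Q" "w \<in> Q" "(1/2) *\<^sub>R u + (1/2) *\<^sub>R w \<in> F'" for u w
    proof -
      have "u \<in> F \<and> w \<in> F" using ext uw by (auto simp: F'_def)
      moreover from this have "l u \<le> m" "l w \<le> m" using m(2) by auto
      moreover have "m \<le> (1/2) * l u + (1/2) * l w"
        using uw(3) by (simp add: F'_def linear_add[OF l(1)] linear_cmul[OF l(1)])
      ultimately show ?thesis using closedin_subset[OF FQ(3)] by (auto simp: F'_def)
    qed
    ultimately have "F' \<in> A" using FQ(1) unfolding A_def F'_def by blast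
    then have "F' = F" by (rule F(2)) (simp add: F'_def)
    then have "m \<le> l x" "m \<le> l y" using xy by (auto simp: F'_def)
    moreover have "l x \<le> m" "l y \<le> m" using m(2) xy by auto
    ultimately show False using l(3) by simp
  qed
  obtain q where "q \<in> F" using FQ(2) by blast
  then have "F = {q}" using single by blast
  then have "extreme_in q Q" unfolding extreme_in_def using ext FQ(1) by blast
  then show ?thesis by (rule that)
qed

section \<open>Barycentres\<close>

text \<open>Affine functions on \<open>Q\<close> rather than restrictions of linear functionals: the
  class is stable under composition with the maps \<open>b g\<close>, which are affine on
  \<open>Q\<close> only.\<close>

definition affine_functions :: "'v::real_vector topology \<Rightarrow> 'v set \<Rightarrow> ('v \<Rightarrow> real) set"
  where "affine_functions T Q = {h. continuous_map (subtopology T Q) euclideanreal h \<and> affine_map_on Q h}"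

lemma affine_map_onD:
  "affine_map_on Q f \<Longrightarrow> x \<in> Q \<Longrightarrow> y \<in> Q \<Longrightarrow> 0 \<le> t \<Longrightarrow> t \<le> 1 \<Longrightarrow>
    f ((1 - t) *\<^sub>R x + t *\<^sub>R y) = (1 - t) *\<^sub>R f x + t *\<^sub>R f y"
  by (simp add: affine_map_on_def)

lemma convex_affine_map_image:
  assumes "affine_map_on Q f" "convex Q"
  shows "convex (f ` Q)"
  unfolding convex_alt
proof (intro ballI allI impI)
  fix p q and t :: real assume "p \<in> f ` Q" "q \<in> f ` Q" and t: "0 \<le> t \<and> t \<le> 1"
  then obtain x y where xy: "x \<in> Q" "y \<in> Q" "p = f x" "q = f y" by blast
  then have "f ((1 - t) *\<^sub>R x + t *\<^sub>R y) = (1 - t) *\<^sub>R p + t *\<^sub>R q"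
    using affine_map_onD[OF assms(1), of x y t] t by simp
  moreover have "(1 - t) *\<^sub>R x + t *\<^sub>R y \<in> Q"
    using assms(2) xy t unfolding convex_alt by blast
  ultimately show "(1 - t) *\<^sub>R p + t *\<^sub>R q \<in> f ` Q" by (metis imageI)
qed

lemma affine_functions_linear:
  "linear l \<Longrightarrow> continuous_map T euclideanreal l \<Longrightarrow> l \<in> affine_functions T Q"
  by (simp add: affine_functions_def affine_map_on_def continuous_map_from_subtopology linear_add linear_cmul)

lemma affine_functions_separate:
  assumes "locally_convex_tvs T" "x \<noteq> y"
  obtains h where "h \<in> affine_functions T Q" "h x \<noteq> h y"
proof -
  obtain l where "linear l" "continuous_map T euclideanreal l" "l x \<noteq> l y"
    by (rule lctvs_separation[OF assms])
  then show ?thesis using that affine_functions_linear by blast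
qed

lemma affine_functions_affine:
  assumes "h \<in> affine_functions T Q"
  shows "(\<lambda>x. c * (h x - d)) \<in> affine_functions T Q"
  unfolding affine_functions_def affine_map_on_def
proof (intro CollectI conjI ballI)
  show "continuous_map (subtopology T Q) euclideanreal (\<lambda>x. c * (h x - d))"
    using assms by (auto simp: affine_functions_def intro!: continuous_intros)
  fix x y and t :: real assume "x \<in> Q" "y \<in> Q" "t \<in> {0..1}"
  then have "h ((1 - t) *\<^sub>R x + t *\<^sub>R y) = (1 - t) *\<^sub>R h x + t *\<^sub>R h y"
    using assms by (intro affine_map_onD) (auto simp: affine_functions_def)
  then show "c * (h ((1 - t) *\<^sub>R x + t *\<^sub>R y) - d) = (1 - t) *\<^sub>R (c * (h x - d)) + t *\<^sub>R (c * (h y - d))"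
    by (simp only: real_scaleR_def) (simp add: algebra_simps)
qed

lemma affine_functions_compose:
  assumes "continuous_map (subtopology T Q) (subtopology T' Q') f" "affine_map_on Q f" "f ` Q \<subseteq> Q'"
    and "h \<in> affine_functions T' Q'"
  shows "h \<circ> f \<in> affine_functions T Q"
  using assms continuous_map_compose[OF assms(1), of euclideanreal h]
  by (auto simp: affine_functions_def affine_map_on_def image_subset_iff)

lemma affine_functions_eqI:
  assumes "locally_convex_tvs T" "\<And>h. h \<in> affine_functions T Q \<Longrightarrow> h x = h y"
  shows "x = y"
  using affine_functions_separate[OF assms(1), of x y Q] assms(2) by metis

definition evaluation :: "'v::real_vector topology \<Rightarrow> 'v set \<Rightarrow> 'v \<Rightarrow> ('v \<Rightarrow> real) \<Rightarrow> real"
  where "evaluation T Q q = (\<lambda>h. if h \<in> affine_functions T Q then h q else 0)"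

text \<open>Yields a copy of \<open>Q\<close> in a product of lines, where barycentres can be sought
  coordinatewise. The affine functions separate points, and compactness turns the continuous
  injection into a homeomorphism.\<close>

lemma homeomorphic_map_evaluation:
  assumes T: "locally_convex_tvs T" and Q: "compactin T Q"
  shows "homeomorphic_map (subtopology T Q) (subtopology weak_star (evaluation T Q ` Q)) (evaluation T Q)"
proof (rule continuous_imp_homeomorphic_map)
  have top: "topspace (subtopology T Q) = Q"
    using T by (simp add: locally_convex_tvs_def)
  have "continuous_map (subtopology T Q) euclideanreal (\<lambda>q. evaluation T Q q h)" for h
    by (cases "h \<in> affine_functions T Q") (simp_all add: evaluation_def affine_functions_def)
  then show "continuous_map (subtopology T Q) (subtopology weak_star (evaluation T Q ` Q)) (evaluation T Q)"
    by (auto simp: continuous_map_in_subtopology continuous_map_weak_star_iff)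
  show "compact_space (subtopology T Q)" using Q by (simp add: compact_space_subtopology)
  show "Hausdorff_space (subtopology weak_star (evaluation T Q ` Q))"
    by (simp add: Hausdorff_space_subtopology Hausdorff_weak_star)
  show "evaluation T Q ` topspace (subtopology T Q) = topspace (subtopology weak_star (evaluation T Q ` Q))"
    unfolding top by simp
  show "inj_on (evaluation T Q) (topspace (subtopology T Q))"
  proof (rule inj_onI)
    fix x y assume eq: "evaluation T Q x = evaluation T Q y"
    show "x = y"
    proof (rule affine_functions_eqI[OF T, of Q])
      fix h assume "h \<in> affine_functions T Q"
      then show "h x = h y" using fun_cong[OF eq, of h] by (simp add: evaluation_def)
    qed
  qed
qed

text \<open>\<open>L\<close> is a functional on functions on \<open>X\<close>; for a state, the
  chosen point is the barycentre in \<open>Q\<close> of its push-forward under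
  \<open>\<phi>\<close>. Existence is the lemma \<open>barycentre\<close>, uniqueness is
  \<open>barycentre_eqI\<close>.\<close>

definition barycentre :: "'v::real_vector topology \<Rightarrow> 'v set \<Rightarrow> ('x \<Rightarrow> 'v) \<Rightarrow> (('x \<Rightarrow> real) \<Rightarrow> real) \<Rightarrow> 'v"
  where "barycentre T Q \<phi> L = (SOME q. q \<in> Q \<and> (\<forall>h\<in>affine_functions T Q. h q = L (h \<circ> \<phi>)))"

context
  fixes T :: "'v::real_vector topology" and Q and X :: "'x topology" and \<phi>
  assumes T: "locally_convex_tvs T" and Q: "compactin T Q" "convex Q"
    and X: "compact_space X" "topspace X \<noteq> {}" and \<phi>: "continuous_map X (subtopology T Q) \<phi>"
begin

private lemma range: "x \<in> topspace X \<Longrightarrow> \<phi> x \<in> Q"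
  using continuous_map_funspace[OF \<phi>] by auto

lemma continuous_map_affine_compose:
  "h \<in> affine_functions T Q \<Longrightarrow> continuous_map X euclideanreal (h \<circ> \<phi>)"
  by (rule continuous_map_compose[OF \<phi>]) (simp add: affine_functions_def)

text \<open>The image under \<open>evaluation T Q\<close> that a barycentre of \<open>L\<close> must
  have. It is available before any barycentre is known to exist.\<close>

private definition integral_evaluation
  where "integral_evaluation L = (\<lambda>h. if h \<in> affine_functions T Q then L (h \<circ> \<phi>) else (0 :: real))"

private lemma integral_evaluation_continuous: "continuous_map weak_star weak_star integral_evaluation"
proof -
  have "continuous_map weak_star euclideanreal (\<lambda>L. integral_evaluation L h)" for h
    by (cases "h \<in> affine_functions T Q")
      (simp_all add: integral_evaluation_def continuous_map_weak_star_apply)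
  then show ?thesis by (simp add: continuous_map_weak_star_iff)
qed

text \<open>The states whose integral evaluation comes from a point of \<open>Q\<close> form a
  closed set, as the image of \<open>Q\<close> is compact, and a convex one, as affine functions
  respect convex combinations. The point masses belong to it, hence all states do.\<close>

private lemma integral_evaluation_states: "integral_evaluation ` states X \<subseteq> evaluation T Q ` Q"
proof -
  let ?E = "evaluation T Q ` Q"
  define N where "N = {L \<in> topspace weak_star. integral_evaluation L \<in> ?E} \<inter> states X"
  have "compactin weak_star ?E"
  proof (rule image_compactin)
    show "compactin (subtopology T Q) Q" using Q(1) by (simp add: compactin_subtopology)
    show "continuous_map (subtopology T Q) weak_star (evaluation T Q)"
      using homeomorphic_imp_continuous_map[OF homeomorphic_map_evaluation[OF T Q(1)]]
      by (simp add: continuous_map_in_subtopology)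
  qed
  then have "closedin weak_star ?E"
    using compactin_imp_closedin[OF Hausdorff_weak_star] by blast
  then have "closedin weak_star N"
    unfolding N_def
    by (intro closedin_Int closedin_states closedin_continuous_map_preimage[OF integral_evaluation_continuous])
  moreover have "convex N"
    unfolding convex_alt
  proof (intro ballI allI impI)
    fix L M and t :: real assume LM: "L \<in> N" "M \<in> N" and t: "0 \<le> t \<and> t \<le> 1"
    then obtain p q where p: "p \<in> Q" "integral_evaluation L = evaluation T Q p"
      and q: "q \<in> Q" "integral_evaluation M = evaluation T Q q" by (auto simp: N_def)
    have "integral_evaluation ((1 - t) *\<^sub>R L + t *\<^sub>R M) = evaluation T Q ((1 - t) *\<^sub>R p + t *\<^sub>R q)"
    proof
      fix h
      show "integral_evaluation ((1 - t) *\<^sub>R L + t *\<^sub>R M) h = evaluation T Q ((1 - t) *\<^sub>R p + t *\<^sub>R q) h"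
      proof (cases "h \<in> affine_functions T Q")
        case True
        then have "affine_map_on Q h" by (simp add: affine_functions_def)
        then show ?thesis
          using True fun_cong[OF p(2), of h] fun_cong[OF q(2), of h] affine_map_onD[of Q h p q t] p q t
          by (simp add: integral_evaluation_def evaluation_def)
      qed (simp add: integral_evaluation_def evaluation_def)
    qed
    moreover have "(1 - t) *\<^sub>R p + t *\<^sub>R q \<in> Q"
      using Q(2) p q t unfolding convex_alt by blast
    moreover have "(1 - t) *\<^sub>R L + t *\<^sub>R M \<in> states X"
      using convex_states[of X] LM t unfolding convex_alt N_def by blast
    ultimately show "(1 - t) *\<^sub>R L + t *\<^sub>R M \<in> N" by (simp add: N_def)
  qed
  moreover have "point_mass X x \<in> N" if x: "x \<in> topspace X" for x
  proof -
    have "integral_evaluation (point_mass X x) = evaluation T Q (\<phi> x)"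
    proof
      fix h
      show "integral_evaluation (point_mass X x) h = evaluation T Q (\<phi> x) h"
        using point_mass_apply[OF x continuous_map_affine_compose, of h]
        by (simp add: integral_evaluation_def evaluation_def)
    qed
    then show ?thesis using range[OF x] point_mass_in_states[OF x] by (simp add: N_def)
  qed
  ultimately have "N = states X"
    by (intro states_subset_closed_convex[OF X]) (auto simp: N_def)
  then show ?thesis by (auto simp: N_def)
qed

lemma barycentre:
  assumes L: "L \<in> states X"
  shows "barycentre T Q \<phi> L \<in> Q"
    and "h \<in> affine_functions T Q \<Longrightarrow> h (barycentre T Q \<phi> L) = L (h \<circ> \<phi>)"
proof -
  obtain q where q: "q \<in> Q" "integral_evaluation L = evaluation T Q q"
    using integral_evaluation_states L by blast
  have "h q = L (h \<circ> \<phi>)" if "h \<in> affine_functions T Q" for h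
    using fun_cong[OF q(2), of h] that by (simp add: evaluation_def integral_evaluation_def)
  then have "q \<in> Q \<and> (\<forall>h\<in>affine_functions T Q. h q = L (h \<circ> \<phi>))" using q by blast
  then have *: "barycentre T Q \<phi> L \<in> Q \<and> (\<forall>h\<in>affine_functions T Q. h (barycentre T Q \<phi> L) = L (h \<circ> \<phi>))"
    unfolding barycentre_def by (rule someI)
  show "barycentre T Q \<phi> L \<in> Q" using * by blast
  show "h \<in> affine_functions T Q \<Longrightarrow> h (barycentre T Q \<phi> L) = L (h \<circ> \<phi>)" using * by blast
qed

lemma barycentre_eqI:
  assumes "L \<in> states X" "\<And>h. h \<in> affine_functions T Q \<Longrightarrow> h q = L (h \<circ> \<phi>)"
  shows "barycentre T Q \<phi> L = q"
  using affine_functions_eqI[OF T, of Q] barycentre(2)[OF assms(1)] assms(2) by metis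

text \<open>On states the barycentre is the integral evaluation followed by the inverse of the
  embedding of \<open>Q\<close>, so it is continuous although it is defined by choice.\<close>

lemma continuous_map_barycentre:
  "continuous_map (subtopology weak_star (states X)) (subtopology T Q) (barycentre T Q \<phi>)"
proof -
  let ?E = "subtopology weak_star (evaluation T Q ` Q)"
  obtain e where e: "homeomorphic_maps (subtopology T Q) ?E (evaluation T Q) e"
    using homeomorphic_map_evaluation[OF T Q(1)] homeomorphic_map_maps by blast
  have "continuous_map (subtopology weak_star (states X)) ?E integral_evaluation"
    using continuous_map_from_subtopology[OF integral_evaluation_continuous] integral_evaluation_states
    by (auto simp: continuous_map_in_subtopology)
  then have "continuous_map (subtopology weak_star (states X)) (subtopology T Q) (e \<circ> integral_evaluation)"
    by (rule continuous_map_compose) (use e in \<open>simp add: homeomorphic_maps_def\<close>)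
  then show ?thesis
  proof (rule continuous_map_eq)
    fix L assume "L \<in> topspace (subtopology weak_star (states X))"
    then have L: "L \<in> states X" by simp
    have "integral_evaluation L = evaluation T Q (barycentre T Q \<phi> L)"
      using barycentre(2)[OF L] by (auto simp: integral_evaluation_def evaluation_def)
    moreover have "topspace (subtopology T Q) = Q"
      using T by (simp add: locally_convex_tvs_def)
    ultimately show "(e \<circ> integral_evaluation) L = barycentre T Q \<phi> L"
      using e barycentre(1)[OF L] by (simp add: homeomorphic_maps_def)
  qed
qed

lemma affine_map_on_barycentre: "affine_map_on (states X) (barycentre T Q \<phi>)"
  unfolding affine_map_on_def
proof (intro ballI)
  fix L M and t :: real assume LM: "L \<in> states X" "M \<in> states X" and t: "t \<in> {0..1}"
  have "(1 - t) *\<^sub>R L + t *\<^sub>R M \<in> states X"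
    using convex_states[of X] LM t unfolding convex_alt by simp
  then show "barycentre T Q \<phi> ((1 - t) *\<^sub>R L + t *\<^sub>R M) =
      (1 - t) *\<^sub>R barycentre T Q \<phi> L + t *\<^sub>R barycentre T Q \<phi> M"
  proof (rule barycentre_eqI)
    fix h assume h: "h \<in> affine_functions T Q"
    then have aff: "affine_map_on Q h" by (simp add: affine_functions_def)
    have "h ((1 - t) *\<^sub>R barycentre T Q \<phi> L + t *\<^sub>R barycentre T Q \<phi> M) =
        (1 - t) *\<^sub>R h (barycentre T Q \<phi> L) + t *\<^sub>R h (barycentre T Q \<phi> M)"
      using affine_map_onD[OF aff barycentre(1)[OF LM(1)] barycentre(1)[OF LM(2)]] t by simp
    then show "h ((1 - t) *\<^sub>R barycentre T Q \<phi> L + t *\<^sub>R barycentre T Q \<phi> M) =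
        ((1 - t) *\<^sub>R L + t *\<^sub>R M) (h \<circ> \<phi>)"
      by (simp add: barycentre(2)[OF LM(1) h] barycentre(2)[OF LM(2) h])
  qed
qed

end

lemma affine_system_facts:
  assumes "affine_system metr T Q b"
  shows "locally_convex_tvs T" "convex Q" "dynamical_system metr (subtopology T Q) b"
    "compactin T Q" "Q \<noteq> {}" "topspace (subtopology T Q) = Q" "Hausdorff_space T"
    "\<And>g. continuous_map (subtopology T Q) (subtopology T Q) (b g)" "\<And>g. affine_map_on Q (b g)"
    "\<And>g q. q \<in> Q \<Longrightarrow> b g q \<in> Q"
proof -
  show T: "locally_convex_tvs T" "convex Q" and Q: "dynamical_system metr (subtopology T Q) b"
    and "\<And>g. affine_map_on Q (b g)"
    using assms by (auto simp: affine_system_def)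
  show top: "topspace (subtopology T Q) = Q" and "Hausdorff_space T"
    using T by (auto simp: locally_convex_tvs_def)
  show "compactin T Q" "Q \<noteq> {}"
    using Q T(1) top by (auto simp: dynamical_system_def compactin_subspace locally_convex_tvs_def)
  show "\<And>g. continuous_map (subtopology T Q) (subtopology T Q) (b g)"
    by (rule dynamical_system_continuous[OF Q])
  show "\<And>g q. q \<in> Q \<Longrightarrow> b g q \<in> Q"
    by (rule dynamical_system_in_topspace[OF Q, unfolded top])
qed

lemma affine_hom_barycentre:
  assumes X: "dynamical_system metr X a" and Q: "affine_system metr T Q b"
    and \<phi>: "system_hom X a (subtopology T Q) b \<phi>"
  shows "affine_hom weak_star (states X) (induced_action a) T Q b (barycentre T Q \<phi>)"
  unfolding affine_hom_def system_hom_def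
proof (intro conjI allI ballI)
  note Qf = affine_system_facts[OF Q]
  have c\<phi>: "continuous_map X (subtopology T Q) \<phi>" and eq: "\<And>g x. x \<in> topspace X \<Longrightarrow> \<phi> (a g x) = b g (\<phi> x)"
    using \<phi> by (auto simp: system_hom_def)
  have cX: "compact_space X" "topspace X \<noteq> {}" using X by (auto simp: dynamical_system_def)
  note bary = barycentre[OF Qf(1,4,2) cX c\<phi>]
  show "continuous_map (subtopology weak_star (states X)) (subtopology T Q) (barycentre T Q \<phi>)"
    by (rule continuous_map_barycentre[OF Qf(1,4,2) cX c\<phi>])
  show "affine_map_on (states X) (barycentre T Q \<phi>)"
    by (rule affine_map_on_barycentre[OF Qf(1,4,2) cX c\<phi>])
  fix g L assume "L \<in> topspace (subtopology weak_star (states X))"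
  then have L: "L \<in> states X" by simp
  show "barycentre T Q \<phi> (induced_action a g L) = b g (barycentre T Q \<phi> L)"
  proof (rule barycentre_eqI[OF Qf(1,4,2) cX c\<phi> induced_action_in_states[OF X L]])
    fix h assume h: "h \<in> affine_functions T Q"
    have "h \<circ> b g \<in> affine_functions T Q"
      by (rule affine_functions_compose[OF Qf(8) Qf(9) _ h]) (use Qf(10) in auto)
    from bary(2)[OF L this] have "h (b g (barycentre T Q \<phi> L)) = L ((h \<circ> b g) \<circ> \<phi>)" by simp
    also have "\<dots> = L (h \<circ> \<phi> \<circ> a g)"
      by (rule state_cong[OF L]) (simp add: eq)
    finally show "h (b g (barycentre T Q \<phi> L)) = induced_action a g L (h \<circ> \<phi>)"
      by (simp add: induced_action_def)
  qed
qed

text \<open>With \<open>N = P\<close> this gives surjectivity. With a smaller \<open>N\<close> it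
  provides a preimage of a given extreme point of \<open>Q\<close> inside \<open>N\<close>.\<close>

lemma irreducible_image:
  assumes Q: "irreducible_affine_system metr T Q b" and f: "affine_hom T' P a T Q b f"
    and N: "N \<subseteq> P" "P \<subseteq> topspace T'" "N \<noteq> {}" "compactin T' N" "convex N" "invariant a N"
  shows "f ` N = Q"
proof -
  have aQ: "affine_system metr T Q b"
    and irr: "\<And>Q'. Q' \<subseteq> Q \<Longrightarrow> Q' \<noteq> {} \<Longrightarrow> closedin (subtopology T Q) Q' \<Longrightarrow> convex Q' \<Longrightarrow> invariant b Q' \<Longrightarrow> Q' = Q"
    using Q by (auto simp: irreducible_affine_system_def)
  note Qf = affine_system_facts[OF aQ]
  have top: "topspace (subtopology T' P) = P" using N(2) by (simp add: inf.absorb2)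
  have cf: "continuous_map (subtopology T' P) (subtopology T Q) f"
    and eq: "\<And>g x. x \<in> P \<Longrightarrow> f (a g x) = b g (f x)" and aff: "affine_map_on P f"
    using f top by (auto simp: affine_hom_def system_hom_def)
  show ?thesis
  proof (rule irr)
    show "f ` N \<subseteq> Q" using continuous_map_funspace[OF cf] N(1) top Qf(6) by auto
    show "f ` N \<noteq> {}" using N by simp
    have "compactin (subtopology T' P) N" using N by (simp add: compactin_subtopology)
    then have "compactin (subtopology T Q) (f ` N)" by (rule image_compactin[OF _ cf])
    then show "closedin (subtopology T Q) (f ` N)"
      by (rule compactin_imp_closedin[OF Hausdorff_space_subtopology[OF Qf(7)]])
    have "affine_map_on N f" using aff N(1) by (auto simp: affine_map_on_def)
    then show "convex (f ` N)" by (rule convex_affine_map_image[OF _ N(5)])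
    show "invariant b (f ` N)"
      unfolding invariant_def
    proof (intro allI image_subsetI)
      fix g q assume "q \<in> f ` N"
      then obtain x where x: "x \<in> N" "q = f x" by blast
      then have "b g q = f (a g x)" using eq N(1) by auto
      moreover have "a g x \<in> N" using N(6) x by (auto simp: invariant_def)
      ultimately show "b g q \<in> f ` N" by blast
    qed
  qed
qed

section \<open>Strong proximality of the extreme points\<close>

text \<open>The state of the measure with density \<open>f / L f\<close>.\<close>

lemma weighted_state:
  assumes L: "L \<in> states X" and f: "continuous_map X euclideanreal f" "\<And>x. x \<in> topspace X \<Longrightarrow> 0 \<le> f x" "0 < L f"
  shows "(\<lambda>g. if continuous_map X euclideanreal g then L (\<lambda>x. f x * g x) / L f else 0) \<in> states X"
proof (rule statesI)
  fix g assume g: "continuous_map X euclideanreal g"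
  have fg: "continuous_map X euclideanreal (\<lambda>x. f x * g x)" by (intro continuous_intros f g)
  show "(if continuous_map X euclideanreal (\<lambda>x. g x + k x) then L (\<lambda>x. f x * (g x + k x)) / L f else 0) =
      (if continuous_map X euclideanreal g then L (\<lambda>x. f x * g x) / L f else 0) +
      (if continuous_map X euclideanreal k then L (\<lambda>x. f x * k x) / L f else 0)"
    if k: "continuous_map X euclideanreal k" for k
  proof -
    have "continuous_map X euclideanreal (\<lambda>x. f x * k x)" by (intro continuous_intros f k)
    then show ?thesis
      using g k state_add[OF L fg] by (simp add: continuous_map_add distrib_left add_divide_distrib)
  qed
  show "(if continuous_map X euclideanreal (\<lambda>x. c * g x) then L (\<lambda>x. f x * (c * g x)) / L f else 0) =
      c * (if continuous_map X euclideanreal g then L (\<lambda>x. f x * g x) / L f else 0)" for c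
    using g state_cmult[OF L fg, of c] by (simp add: continuous_map_real_mult_left mult.left_commute)
  show "0 \<le> (if continuous_map X euclideanreal g then L (\<lambda>x. f x * g x) / L f else 0)"
    if "\<And>x. x \<in> topspace X \<Longrightarrow> 0 \<le> g x"
    using state_nonneg[OF L fg] f(2,3) that by simp
qed (use f(3) in auto)

text \<open>
  If the barycentre \<open>q\<close> of \<open>\<nu>\<close> is extreme and \<open>h q = 0\<close>, then the weights \<open>1/2 + h/2B\<close> and
  \<open>1/2 - h/2B\<close> split \<open>\<nu>\<close> into two states with barycentre \<open>q\<close>. Evaluating \<open>h\<close> there gives \<open>\<nu> (h\<^sup>2) = 0\<close>.
\<close>

lemma extreme_barycentre_square:
  assumes T: "locally_convex_tvs T" and Q: "compactin T Q" "convex Q"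
    and X: "compact_space X" "topspace X \<noteq> {}" and \<phi>: "continuous_map X (subtopology T Q) \<phi>"
    and \<nu>: "\<nu> \<in> states X" and ext: "extreme_in (barycentre T Q \<phi> \<nu>) Q"
    and h: "h \<in> affine_functions T Q" "h (barycentre T Q \<phi> \<nu>) = 0"
  shows "\<nu> (\<lambda>x. (h (\<phi> x))\<^sup>2) = 0"
proof -
  note bary = barycentre[OF T Q X \<phi>]
  define q where "q = barycentre T Q \<phi> \<nu>"
  define k where "k = h \<circ> \<phi>"
  have k: "continuous_map X euclideanreal k"
    unfolding k_def by (rule continuous_map_affine_compose[OF T Q X \<phi> h(1)])
  have \<nu>k: "\<nu> k = 0" using bary(2)[OF \<nu> h(1)] h(2) by (simp add: k_def)
  obtain B where B: "B > 0" "\<And>x. x \<in> topspace X \<Longrightarrow> \<bar>k x\<bar> \<le> B"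
    using continuous_map_bounded[OF X(1) k] by blast
  \<comment> \<open>For \<open>s = 1\<close> and \<open>s = - 1\<close> the two weights add up to 1,
    are nonnegative by the choice of \<open>B\<close>, and have mass \<open>1 / 2\<close> each
    because \<open>\<nu> k = 0\<close>. So the mean of the two normalised states is
    \<open>\<nu>\<close>.\<close>
  define f where "f s x = 1 / 2 + s / (2 * B) * k x" for s x
  have f: "continuous_map X euclideanreal (f s)" for s
    unfolding f_def by (intro continuous_intros k)
  have f_nonneg: "0 \<le> f s x" if "x \<in> topspace X" "\<bar>s\<bar> = 1" for s x
    using B(2)[OF that(1)] B(1) that(2) by (auto simp: f_def abs_if field_simps split: if_splits)
  have \<nu>f: "\<nu> (f s) = 1 / 2" for s
  proof -
    have "\<nu> (f s) = \<nu> (\<lambda>_. 1 / 2) + \<nu> (\<lambda>x. s / (2 * B) * k x)"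
      unfolding f_def
      by (rule state_add[OF \<nu> continuous_map_canonical_const continuous_map_real_mult_left[OF k]])
    then show ?thesis by (simp add: state_cmult[OF \<nu> k] state_const[OF \<nu>] \<nu>k del: times_divide_eq_left)
  qed
  define \<nu>' where "\<nu>' s = (\<lambda>g. if continuous_map X euclideanreal g then \<nu> (\<lambda>x. f s x * g x) / \<nu> (f s) else 0)" for s
  have \<nu>': "\<nu>' s \<in> states X" if "\<bar>s\<bar> = 1" for s
    unfolding \<nu>'_def by (rule weighted_state[OF \<nu> f f_nonneg]) (auto simp: that \<nu>f)
  define p where "p s = barycentre T Q \<phi> (\<nu>' s)" for s
  have p: "p 1 \<in> Q" "p (-1) \<in> Q" using bary(1) \<nu>' by (auto simp: p_def)
  have half: "(1/2) *\<^sub>R p 1 + (1/2) *\<^sub>R p (-1) = q"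
  proof (rule affine_functions_eqI[OF T, of Q])
    fix h' assume h': "h' \<in> affine_functions T Q"
    have c: "continuous_map X euclideanreal (h' \<circ> \<phi>)"
      by (rule continuous_map_affine_compose[OF T Q X \<phi> h'])
    have cf: "continuous_map X euclideanreal (\<lambda>x. f s x * (h' \<circ> \<phi>) x)" for s
      by (intro continuous_map_real_mult f c)
    have "affine_map_on Q h'" using h' by (simp add: affine_functions_def)
    from affine_map_onD[OF this p, of "1/2"]
    have "h' ((1/2) *\<^sub>R p 1 + (1/2) *\<^sub>R p (-1)) = 1/2 * h' (p 1) + 1/2 * h' (p (-1))" by simp
    also have "\<dots> = \<nu> (\<lambda>x. f 1 x * (h' \<circ> \<phi>) x) + \<nu> (\<lambda>x. f (-1) x * (h' \<circ> \<phi>) x)"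
      using bary(2)[OF \<nu>' h'] c by (simp add: p_def \<nu>'_def \<nu>f)
    also have "\<dots> = \<nu> (\<lambda>x. f 1 x * (h' \<circ> \<phi>) x + f (-1) x * (h' \<circ> \<phi>) x)"
      by (rule state_add[OF \<nu> cf cf, symmetric])
    also have "\<dots> = \<nu> (h' \<circ> \<phi>)"
      by (rule state_cong[OF \<nu>]) (simp add: f_def algebra_simps)
    also have "\<dots> = h' q" using bary(2)[OF \<nu> h'] by (simp add: q_def)
    finally show "h' ((1/2) *\<^sub>R p 1 + (1/2) *\<^sub>R p (-1)) = h' q" .
  qed
  then have "p 1 = q" using ext p unfolding extreme_in_def q_def by blast
  then have "0 = \<nu>' 1 k" using bary(2)[OF \<nu>', of 1 h] h by (simp add: p_def q_def k_def)
  then have "0 = \<nu> (\<lambda>x. f 1 x * k x)" using k by (simp add: \<nu>'_def \<nu>f)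
  also have "\<dots> = \<nu> (\<lambda>x. 1/2 * k x + 1 / (2 * B) * (k x)\<^sup>2)"
    by (rule state_cong[OF \<nu>]) (simp add: f_def power2_eq_square algebra_simps)
  also have "\<dots> = 1/2 * \<nu> k + 1 / (2 * B) * \<nu> (\<lambda>x. (k x)\<^sup>2)"
    using k by (subst state_add[OF \<nu>]) (auto simp only: state_cmult[OF \<nu>] continuous_map_real_mult_left continuous_map_real_pow)
  finally show ?thesis using \<nu>k B(1) by (simp add: k_def)
qed

text \<open>On the compact set where \<open>u \<ge> e\<close>, finitely many affine functions that
  vanish at \<open>\<phi> y\<close> have a sum of squares \<open>S \<ge> 1\<close>. Extremality
  gives each square the \<open>\<nu>\<close>-value 0, and \<open>u \<le> e + B * S\<close>
  everywhere, so \<open>\<nu> u \<le> e\<close>.\<close>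

lemma extreme_barycentre_vanishes:
  assumes T: "locally_convex_tvs T" and Q: "compactin T Q" "convex Q"
    and X: "compact_space X" and \<phi>: "continuous_map X (subtopology T Q) \<phi>" "inj_on \<phi> (topspace X)"
    and \<nu>: "\<nu> \<in> states X" and ext: "extreme_in (barycentre T Q \<phi> \<nu>) Q"
    and y: "y \<in> topspace X" "barycentre T Q \<phi> \<nu> = \<phi> y"
    and u: "continuous_map X euclideanreal u" "u y = 0"
  shows "\<nu> u \<le> 0"
proof (rule field_le_epsilon)
  fix e :: real assume "0 < e"
  have ne: "topspace X \<noteq> {}" using y by blast
  define K where "K = {x \<in> topspace X. u x \<in> {e..}}"
  have "closedin X K"
    unfolding K_def by (rule closedin_continuous_map_preimage[OF u(1)]) simp
  then have K: "compactin X K" using X closedin_compact_space by blast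
  \<comment> \<open>Any value above 1 at \<open>x\<close> would do: the open sets where the chosen
    functions exceed 1 then cover \<open>K\<close>.\<close>
  have "\<exists>h\<in>affine_functions T Q. h (\<phi> y) = 0 \<and> h (\<phi> x) = 2" if "x \<in> K" for x
  proof -
    have "x \<in> topspace X" "x \<noteq> y" using that u(2) \<open>0 < e\<close> by (auto simp: K_def)
    then have "\<phi> x \<noteq> \<phi> y" using \<phi>(2) y(1) by (meson inj_onD)
    obtain h where h: "h \<in> affine_functions T Q" "h (\<phi> x) \<noteq> h (\<phi> y)"
      by (rule affine_functions_separate[OF T \<open>\<phi> x \<noteq> \<phi> y\<close>])
    define d where "d = h (\<phi> x) - h (\<phi> y)"
    let ?h = "\<lambda>z. 2 / d * (h z - h (\<phi> y))"
    have "?h \<in> affine_functions T Q" by (rule affine_functions_affine[OF h(1)])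
    moreover have "?h (\<phi> x) = 2" using h(2) by (simp add: d_def[symmetric]) (simp add: d_def)
    ultimately show ?thesis by (intro bexI[of _ ?h]) auto
  qed
  then obtain h where h: "\<And>x. x \<in> K \<Longrightarrow> h x \<in> affine_functions T Q" "\<And>x. x \<in> K \<Longrightarrow> h x (\<phi> y) = 0"
    "\<And>x. x \<in> K \<Longrightarrow> h x (\<phi> x) = 2" by metis
  have ch: "continuous_map X euclideanreal (\<lambda>z. h x (\<phi> z))" if "x \<in> K" for x
    using continuous_map_affine_compose[OF T Q X ne \<phi>(1) h(1)[OF that]] by (simp add: comp_def)
  define U where "U x = {z \<in> topspace X. h x (\<phi> z) \<in> {1<..}}" for x
  have U: "openin X (U x)" if "x \<in> K" for x
    unfolding U_def by (rule openin_continuous_map_preimage[OF ch[OF that]]) simp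
  have "K \<subseteq> \<Union>(U ` K)"
  proof
    fix x assume "x \<in> K"
    then show "x \<in> \<Union>(U ` K)" using h(3) by (intro UN_I[of x]) (auto simp: U_def K_def)
  qed
  then obtain \<F> where \<F>: "finite \<F>" "\<F> \<subseteq> U ` K" "K \<subseteq> \<Union>\<F>"
    using K[unfolded compactin_def, THEN conjunct2, rule_format, of "U ` K"] U by auto
  then obtain I where I: "finite I" "I \<subseteq> K" "\<F> = U ` I"
    by (meson finite_subset_image)
  obtain B where B: "B > 0" "\<And>x. x \<in> topspace X \<Longrightarrow> \<bar>u x\<bar> \<le> B"
    using continuous_map_bounded[OF X u(1)] by blast
  define S where "S z = (\<Sum>x\<in>I. (h x (\<phi> z))\<^sup>2)" for z
  have ch2: "continuous_map X euclideanreal (\<lambda>z. (h x (\<phi> z))\<^sup>2)" if "x \<in> I" for x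
    using ch I(2) that by (intro continuous_map_real_pow) auto
  have S: "continuous_map X euclideanreal S"
    unfolding S_def using I(1) ch2 by (intro continuous_map_sum) auto
  have "\<nu> S = (\<Sum>x\<in>I. \<nu> (\<lambda>z. (h x (\<phi> z))\<^sup>2))"
    unfolding S_def by (rule state_sum[OF \<nu> I(1) ch2])
  also have "\<dots> = 0"
  proof (rule sum.neutral, rule ballI)
    fix x assume "x \<in> I"
    then have "x \<in> K" using I(2) by blast
    then show "\<nu> (\<lambda>z. (h x (\<phi> z))\<^sup>2) = 0"
      using extreme_barycentre_square[OF T Q X ne \<phi>(1) \<nu> ext h(1)] h(2) y(2) by simp
  qed
  finally have "\<nu> S = 0" .
  have "\<nu> u \<le> \<nu> (\<lambda>z. e + B * S z)"
  proof (rule state_mono[OF \<nu> u(1)])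
    show "continuous_map X euclideanreal (\<lambda>z. e + B * S z)" by (intro continuous_intros S)
    fix z assume z: "z \<in> topspace X"
    have S_nonneg: "0 \<le> S z" by (simp add: S_def sum_nonneg)
    show "u z \<le> e + B * S z"
    proof (cases "z \<in> K")
      case True
      then obtain x where x: "x \<in> I" "1 < h x (\<phi> z)" using \<F>(3) I(3) by (auto simp: U_def)
      have "1 \<le> (h x (\<phi> z))\<^sup>2" using x(2) by simp
      also have "\<dots> \<le> S z" unfolding S_def using I(1) x(1) by (intro member_le_sum) auto
      finally have "B \<le> B * S z" using B(1) by simp
      then show ?thesis using B(2)[OF z] \<open>0 < e\<close> by linarith
    next
      case False
      then have "u z < e" using z by (simp add: K_def)
      moreover have "0 \<le> B * S z" using B(1) S_nonneg by simp
      ultimately show ?thesis by linarith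
    qed
  qed
  also have "\<dots> = e + B * \<nu> S"
    using S by (subst state_add[OF \<nu>]) (auto simp: state_const[OF \<nu>] state_cmult[OF \<nu>] continuous_map_real_mult_left)
  finally show "\<nu> u \<le> 0 + e" using \<open>\<nu> S = 0\<close> by simp
qed

text \<open>
  The states \<open>\<nu>\<close> with \<open>\<nu> (u \<circ> c g) \<ge> e\<close> for all \<open>g\<close> form a closed convex invariant set, so if there
  is one, then there is one with barycentre \<open>\<phi> y\<close>.
\<close>

lemma extreme_point_attracts:
  assumes Q: "irreducible_affine_system metr T Q b" and Y: "dynamical_system metr Y c"
    and \<phi>: "system_hom Y c (subtopology T Q) b \<phi>" "inj_on \<phi> (topspace Y)"
    and y: "y \<in> topspace Y" "extreme_in (\<phi> y) Q"
    and \<mu>: "\<mu> \<in> states Y" and u: "continuous_map Y euclideanreal u" "u y = 0" and "0 < e"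
  obtains g where "\<mu> (u \<circ> c g) < e"
proof (rule ccontr)
  assume "\<not> thesis"
  then have ge: "e \<le> \<mu> (u \<circ> c g)" for g using that by (meson not_le)
  have aQ: "affine_system metr T Q b" using Q by (simp add: irreducible_affine_system_def)
  note Qf = affine_system_facts[OF aQ]
  have cY: "compact_space Y" using Y by (simp add: dynamical_system_def)
  define N where "N = (\<Inter>g. {\<nu> \<in> topspace weak_star. \<nu> (u \<circ> c g) \<in> {e..}}) \<inter> states Y"
  have cN: "closedin weak_star N"
    unfolding N_def
    by (intro closedin_Int closedin_states closedin_INT closedin_continuous_map_preimage[OF continuous_map_weak_star_apply]) auto
  have NY: "N \<subseteq> states Y" by (simp add: N_def)
  have "barycentre T Q \<phi> ` N = Q"
  proof (rule irreducible_image[OF Q affine_hom_barycentre[OF Y aQ \<phi>(1)] NY])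
    show "N \<noteq> {}" using \<mu> ge by (auto simp: N_def)
    show "compactin weak_star N" by (rule closed_compactin[OF compactin_states[OF cY] NY cN])
    show "convex N"
      unfolding convex_alt
    proof (intro ballI allI impI)
      fix L M and t :: real assume LM: "L \<in> N" "M \<in> N" and t: "0 \<le> t \<and> t \<le> 1"
      have "(1 - t) *\<^sub>R L + t *\<^sub>R M \<in> states Y"
        using convex_states[of Y] LM NY t unfolding convex_alt by blast
      moreover have "e \<le> (1 - t) * L (u \<circ> c g) + t * M (u \<circ> c g)" for g
      proof -
        have "(1 - t) * e + t * e \<le> (1 - t) * L (u \<circ> c g) + t * M (u \<circ> c g)"
          using LM t by (intro add_mono mult_left_mono) (auto simp: N_def)
        then show ?thesis by (simp add: algebra_simps)
      qed
      ultimately show "(1 - t) *\<^sub>R L + t *\<^sub>R M \<in> N" by (simp add: N_def)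
    qed
    show "invariant (induced_action c) N"
      unfolding invariant_def
    proof (intro allI image_subsetI)
      fix g \<nu> assume \<nu>: "\<nu> \<in> N"
      then have \<nu>s: "\<nu> \<in> states Y" using NY by blast
      \<comment> \<open>Acting by \<open>g\<close> turns the condition with index \<open>h\<close>
        into the one with index \<open>h + g\<close>, so it only reindexes the family that defines
        \<open>N\<close>.\<close>
      have "induced_action c g \<nu> (u \<circ> c h) = \<nu> (u \<circ> c (h + g))" for h
        unfolding induced_action_def by (rule state_cong[OF \<nu>s]) (simp add: dynamical_system_add[OF Y])
      then show "induced_action c g \<nu> \<in> N"
        using \<nu> induced_action_in_states[OF Y \<nu>s] by (simp add: N_def)
    qed
  qed simp
  then obtain \<nu> where \<nu>: "\<nu> \<in> N" "barycentre T Q \<phi> \<nu> = \<phi> y"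
    using y(2) by (metis extreme_in_def image_iff)
  have "\<nu> u \<le> 0"
    by (rule extreme_barycentre_vanishes[OF Qf(1,4,2) cY _ \<phi>(2) _ _ y(1) \<nu>(2) u])
      (use \<phi>(1) \<nu> NY y(2) in \<open>auto simp: system_hom_def\<close>)
  moreover have "\<nu> u = \<nu> (u \<circ> c 0)"
    by (rule state_cong[OF subsetD[OF NY \<nu>(1)]]) (simp add: dynamical_system_zero[OF Y])
  moreover have "e \<le> \<nu> (u \<circ> c 0)" using \<nu>(1) by (simp add: N_def)
  ultimately show False using \<open>0 < e\<close> by simp
qed

section \<open>From attraction to strong proximality and minimality\<close>

lemma tendsto_weak_starI:
  assumes "\<And>f. ((\<lambda>n. L n f) \<longlongrightarrow> M f) F"
  shows "limitin weak_star L M F"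
  unfolding weak_star_def limitin_componentwise using assms by simp

text \<open>For a point \<open>y\<close> of the space, this puts the point mass at \<open>y\<close>
  into the orbit closure of every state. One test function suffices: finitely many continuous
  \<open>f\<close> are controlled together by the sum of the functions
  \<open>|f - f y|\<close>.\<close>

definition attracts :: "'x topology \<Rightarrow> ('g \<Rightarrow> 'x \<Rightarrow> 'x) \<Rightarrow> 'x \<Rightarrow> bool"
  where "attracts X a y \<longleftrightarrow> (\<forall>\<mu>\<in>states X. \<forall>u. continuous_map X euclideanreal u \<longrightarrow>
    (\<forall>x\<in>topspace X. 0 \<le> u x) \<longrightarrow> u y = 0 \<longrightarrow> (\<forall>e>0. \<exists>g. \<mu> (u \<circ> a g) < e))"

lemma attractsD:
  assumes "attracts X a y" "\<mu> \<in> states X" "continuous_map X euclideanreal u"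
    "\<And>x. x \<in> topspace X \<Longrightarrow> 0 \<le> u x" "u y = 0" "e > 0"
  obtains g where "\<mu> (u \<circ> a g) < e"
  using assms unfolding attracts_def by blast

lemma state_close_to_point:
  assumes L: "L \<in> states X" and f: "continuous_map X euclideanreal f" and u: "continuous_map X euclideanreal u"
    and le: "\<And>x. x \<in> topspace X \<Longrightarrow> \<bar>f x - d\<bar> \<le> e + c * u x"
  shows "\<bar>L f - d\<bar> \<le> e + c * L u"
proof -
  have eq: "L (\<lambda>x. e + c * u x) = e + c * L u"
    using state_add[OF L continuous_map_canonical_const continuous_map_real_mult_left[OF u], of e c]
    by (simp only: state_const[OF L] state_cmult[OF L u])
  have cu: "continuous_map X euclideanreal (\<lambda>x. e + c * u x)" by (intro continuous_intros u)
  have cf: "continuous_map X euclideanreal (\<lambda>x. f x - d)" by (intro continuous_intros f)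
  have "L (\<lambda>x. f x - d) \<le> L (\<lambda>x. e + c * u x)"
    using le by (intro state_mono[OF L cf cu]) (simp add: abs_le_iff)
  moreover have "L (\<lambda>x. - (f x - d)) \<le> L (\<lambda>x. e + c * u x)"
    using le by (intro state_mono[OF L continuous_map_minus[OF cf] cu]) (simp only: abs_le_iff)
  moreover have "L (\<lambda>x. f x - d) = L f - d"
    using state_diff[OF L f continuous_map_canonical_const, of d] by (simp only: state_const[OF L])
  ultimately show ?thesis
    using eq state_minus[OF L cf] by linarith
qed

text \<open>The filter is generated by the sets of group elements that make
  \<open>\<mu> (u \<circ> a g)\<close> small. Attraction says that none of these sets is empty, so
  the filter is proper.\<close>

lemma strongly_proximalI_net:
  assumes X: "dynamical_system False X a" and y: "y \<in> topspace X" and att: "attracts X a y"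
  shows "strongly_proximal False X a"
  unfolding strongly_proximal_def if_False
proof (intro conjI X ballI bexI)
  fix \<mu> assume "\<mu> \<in> prob_space_of X"
  then have \<mu>: "\<mu> \<in> states X"
    using X prob_space_of_eq_states[of X] by (simp add: dynamical_system_def)
  define B where "B = {u. continuous_map X euclideanreal u \<and> (\<forall>x\<in>topspace X. 0 \<le> u x) \<and> u y = 0} \<times> {0 :: real<..}"
  define S where "S p = {g. \<mu> (fst p \<circ> a g) < snd p}" for p
  define F where "F = (INF p\<in>B. principal (S p))"
  have ev: "eventually P F \<longleftrightarrow> (\<exists>p\<in>B. eventually P (principal (S p)))" for P
    unfolding F_def
  proof (rule eventually_INF_base)
    have "(\<lambda>_. 0, 1) \<in> B" by (simp add: B_def)
    then show "B \<noteq> {}" by blast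
    fix p q assume pq: "p \<in> B" "q \<in> B"
    \<comment> \<open>A common lower bound: both summands are nonnegative, so a small value at the
      sum makes both values small, and the threshold is the smaller of the two.\<close>
    let ?r = "(\<lambda>x. fst p x + fst q x, min (snd p) (snd q))"
    have c: "continuous_map X euclideanreal (fst p \<circ> a g)" "continuous_map X euclideanreal (fst q \<circ> a g)" for g
      using pq by (auto simp: B_def intro!: continuous_map_compose[OF dynamical_system_continuous[OF X]])
    have nn: "0 \<le> \<mu> (fst p \<circ> a g)" "0 \<le> \<mu> (fst q \<circ> a g)" for g
      using pq dynamical_system_in_topspace[OF X]
      by (auto simp: B_def intro!: state_nonneg[OF \<mu> c(1)] state_nonneg[OF \<mu> c(2)])
    have "?r \<in> B" using pq by (auto simp: B_def continuous_map_add)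
    moreover have "S ?r \<subseteq> S p \<inter> S q"
    proof
      fix g assume "g \<in> S ?r"
      then have "\<mu> (fst p \<circ> a g) + \<mu> (fst q \<circ> a g) < min (snd p) (snd q)"
        using state_add[OF \<mu> c] by (simp add: S_def comp_def)
      then show "g \<in> S p \<inter> S q" using nn[of g] by (simp add: S_def)
    qed
    ultimately show "\<exists>r\<in>B. principal (S r) \<le> inf (principal (S p)) (principal (S q))"
      by (intro bexI[of _ ?r]) auto
  qed
  have "F \<noteq> bot"
  proof
    assume "F = bot"
    then have "eventually (\<lambda>_. False) F" by simp
    then obtain p where p: "p \<in> B" "S p = {}" by (auto simp: ev eventually_principal)
    have "\<exists>g. \<mu> (fst p \<circ> a g) < snd p"
      using att \<mu> p(1) unfolding attracts_def B_def by auto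
    then show False using p(2) by (auto simp: S_def)
  qed
  moreover have "limitin weak_star (\<lambda>g. induced_action a g \<mu>) (point_mass X y) F"
  proof (rule tendsto_weak_starI)
    fix f
    show "((\<lambda>g. induced_action a g \<mu> f) \<longlongrightarrow> point_mass X y f) F"
    proof (cases "continuous_map X euclideanreal f")
      case True
      show ?thesis
      proof (rule tendstoI)
        fix e :: real assume "0 < e"
        define u where "u x = \<bar>f x - f y\<bar>" for x
        have u: "continuous_map X euclideanreal u" unfolding u_def by (intro continuous_intros True)
        have "dist (induced_action a g \<mu> f) (point_mass X y f) < e" if "g \<in> S (u, e)" for g
        proof -
          have "\<bar>induced_action a g \<mu> f - f y\<bar> \<le> 0 + 1 * induced_action a g \<mu> u"
            by (rule state_close_to_point[OF induced_action_in_states[OF X \<mu>] True u]) (simp add: u_def)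
          then show ?thesis
            using that by (simp add: S_def induced_action_def point_mass_apply[OF y True] dist_real_def)
        qed
        moreover have "(u, e) \<in> B" using u \<open>0 < e\<close> by (simp add: B_def u_def)
        ultimately show "\<forall>\<^sub>F g in F. dist (induced_action a g \<mu> f) (point_mass X y f) < e"
          unfolding ev by (intro bexI[of _ "(u, e)"]) (auto simp: eventually_principal)
      qed
    next
      case False
      then show ?thesis
        using state_outside[OF induced_action_in_states[OF X \<mu>] False] by (simp add: point_mass_eq[OF y])
    qed
  qed
  ultimately show "\<exists>F. F \<noteq> bot \<and> limitin weak_star (\<lambda>g. induced_action a g \<mu>) (point_mass X y) F" by blast
qed (rule y)

text \<open>The distance from \<open>y\<close> controls every other test function: by uniform
  continuity and boundedness, \<open>|f - f y| \<le> e / 2 + (2 * B / \<delta>) * mdist m y\<close>.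
  So a sequence along which its mean tends to 0 is enough.\<close>

lemma strongly_proximalI_sequence:
  assumes X: "dynamical_system True X a" and y: "y \<in> topspace X" and att: "attracts X a y"
  shows "strongly_proximal True X a"
  unfolding strongly_proximal_def if_True
proof (intro conjI X ballI bexI)
  fix \<mu> assume "\<mu> \<in> prob_space_of X"
  then have \<mu>: "\<mu> \<in> states X"
    using X prob_space_of_eq_states[of X] by (simp add: dynamical_system_def)
  have cX: "compact_space X" using X by (simp add: dynamical_system_def)
  obtain m where m: "X = mtopology_of m"
    using X metrizable_space_obtain_metric[of X] by (auto simp: dynamical_system_def)
  interpret M: Metric_space "mspace m" "mdist m" by (rule Metric_space_mspace_mdist)
  have ym: "y \<in> mspace m" using y by (simp add: m)
  have u: "continuous_map X euclideanreal (mdist m y)"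
    unfolding m by (rule mdist_continuous_map[OF ym])
  have "\<exists>g. \<mu> (mdist m y \<circ> a g) < inverse (real (Suc n))" for n
  proof -
    obtain g where "\<mu> (mdist m y \<circ> a g) < inverse (real (Suc n))"
      by (rule attractsD[OF att \<mu> u]) (use ym in auto)
    then show ?thesis by blast
  qed
  then obtain s where s: "\<And>n. \<mu> (mdist m y \<circ> a (s n)) < inverse (real (Suc n))" by metis
  let ?\<mu> = "\<lambda>n. induced_action a (s n) \<mu>"
  have st: "?\<mu> n \<in> states X" for n by (rule induced_action_in_states[OF X \<mu>])
  have "(\<lambda>n. ?\<mu> n (mdist m y)) \<longlonglongrightarrow> 0"
  proof (rule tendsto_sandwich[OF _ _ tendsto_const LIMSEQ_inverse_real_of_nat])
    show "\<forall>\<^sub>F n in sequentially. 0 \<le> ?\<mu> n (mdist m y)"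
      by (intro always_eventually allI state_nonneg[OF st u]) simp
    show "\<forall>\<^sub>F n in sequentially. ?\<mu> n (mdist m y) \<le> inverse (real (Suc n))"
      using s by (intro always_eventually allI) (simp add: induced_action_def less_imp_le)
  qed
  note lim = this
  have "limitin weak_star ?\<mu> (point_mass X y) sequentially"
  proof (rule tendsto_weak_starI)
    fix f
    show "(\<lambda>n. ?\<mu> n f) \<longlonglongrightarrow> point_mass X y f"
    proof (cases "continuous_map X euclideanreal f")
      case True
      obtain B where B: "B > 0" "\<And>x. x \<in> topspace X \<Longrightarrow> \<bar>f x\<bar> \<le> B"
        using continuous_map_bounded[OF cX True] by blast
      show ?thesis
      proof (rule tendstoI)
        fix e :: real assume "0 < e"
        obtain \<delta> where \<delta>: "\<delta> > 0"
          "\<And>x z. x \<in> mspace m \<Longrightarrow> z \<in> mspace m \<Longrightarrow> mdist m z x < \<delta> \<Longrightarrow> \<bar>f z - f x\<bar> < e / 2"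
          using compact_uniformly_continuous[of m f "e / 2"] cX True \<open>0 < e\<close> m by auto
        have le: "\<bar>f x - f y\<bar> \<le> e / 2 + (2 * B / \<delta>) * mdist m y x" if x: "x \<in> topspace X" for x
        proof (cases "mdist m y x < \<delta>")
          case True
          then have "\<bar>f y - f x\<bar> < e / 2" using \<delta>(2)[of x y] x ym by (simp add: m)
          moreover have "0 \<le> (2 * B / \<delta>) * mdist m y x" using B(1) \<delta>(1) by simp
          ultimately show ?thesis by linarith
        next
          case False
          then have "(2 * B / \<delta>) * \<delta> \<le> (2 * B / \<delta>) * mdist m y x"
            using B(1) \<delta>(1) by (intro mult_left_mono) auto
          then have "2 * B \<le> (2 * B / \<delta>) * mdist m y x" using \<delta>(1) by simp
          moreover have "\<bar>f x\<bar> \<le> B" "\<bar>f y\<bar> \<le> B" using B(2) x y by auto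
          ultimately show ?thesis using \<open>0 < e\<close> by linarith
        qed
        have "(\<lambda>n. (2 * B / \<delta>) * ?\<mu> n (mdist m y)) \<longlonglongrightarrow> (2 * B / \<delta>) * 0"
          by (intro tendsto_mult_left lim)
        then have "\<forall>\<^sub>F n in sequentially. (2 * B / \<delta>) * ?\<mu> n (mdist m y) < e / 2"
          by (rule order_tendstoD(2)) (use \<open>0 < e\<close> in simp)
        then show "\<forall>\<^sub>F n in sequentially. dist (?\<mu> n f) (point_mass X y f) < e"
        proof (rule eventually_mono)
          fix n assume "(2 * B / \<delta>) * ?\<mu> n (mdist m y) < e / 2"
          moreover have "\<bar>?\<mu> n f - f y\<bar> \<le> e / 2 + (2 * B / \<delta>) * ?\<mu> n (mdist m y)"
            by (rule state_close_to_point[OF st True u le])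
          ultimately show "dist (?\<mu> n f) (point_mass X y f) < e"
            by (simp add: point_mass_apply[OF y True] dist_real_def)
        qed
      qed
    next
      case False
      then show ?thesis using state_outside[OF st False] by (simp add: point_mass_eq[OF y])
    qed
  qed
  then show "\<exists>s::nat \<Rightarrow> _. limitin weak_star (\<lambda>n. induced_action a (s n) \<mu>) (point_mass X y) sequentially"
    by blast
qed (rule y)

text \<open>Attraction is applied to the point mass at some \<open>z\<close> in \<open>C\<close>. If
  \<open>y\<close> were outside \<open>C\<close>, a function that is 0 at \<open>y\<close> and 1 on
  \<open>C\<close> would keep the value 1 along the orbit of \<open>z\<close>. Once \<open>y\<close>
  is in \<open>C\<close>, density of its orbit gives the rest.\<close>

lemma minimal_systemI:
  assumes X: "dynamical_system metr X a" and y: "y \<in> topspace X" and att: "attracts X a y"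
    and dense: "X closure_of (range (\<lambda>g. a g y)) = topspace X"
  shows "minimal_system metr X a"
  unfolding minimal_system_def
proof (intro conjI X allI impI)
  fix C assume C: "closedin X C \<and> C \<noteq> {} \<and> invariant a C"
  have cX: "compact_space X" "Hausdorff_space X" using X by (auto simp: dynamical_system_def)
  obtain z where z: "z \<in> C" "z \<in> topspace X" using C closedin_subset by blast
  have "y \<in> C"
  proof (rule ccontr)
    assume "y \<notin> C"
    then have yC: "{y} \<inter> C = {}" and cC: "closedin X C" using C by auto
    obtain u where u: "continuous_map X euclideanreal u" "\<And>x. x \<in> topspace X \<Longrightarrow> 0 \<le> u x \<and> u x \<le> (1 :: real)"
      "\<And>x. x \<in> {y} \<Longrightarrow> u x = 0" "\<And>x. x \<in> C \<Longrightarrow> u x = 1"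
      using Urysohn_01[OF cX closedin_Hausdorff_singleton[OF cX(2) y] cC yC] by blast
    obtain g where g: "point_mass X z (u \<circ> a g) < 1"
      by (rule attractsD[OF att point_mass_in_states[OF z(2)] u(1)]) (use u in auto)
    have "a g z \<in> C" using C z by (auto simp: invariant_def)
    then have "point_mass X z (u \<circ> a g) = 1"
      using u(4) point_mass_apply[OF z(2) continuous_map_compose[OF dynamical_system_continuous[OF X] u(1)]]
      by simp
    then show False using g by simp
  qed
  then have "range (\<lambda>g. a g y) \<subseteq> C" using C by (auto simp: invariant_def)
  then have "topspace X \<subseteq> C" using dense C closure_of_minimal by metis
  then show "C = topspace X" using C closedin_subset by blast
qed

lemma minimal_strongly_proximalI:
  assumes "dynamical_system metr X a" "y \<in> topspace X" "attracts X a y"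
    "X closure_of (range (\<lambda>g. a g y)) = topspace X"
  shows "minimal_strongly_proximal metr X a"
  using minimal_systemI[OF assms] strongly_proximalI_net[of X a y] strongly_proximalI_sequence[of X a y] assms
  unfolding minimal_strongly_proximal_def by (cases metr) auto

text \<open>
  The orbit closure of \<open>x\<close>, transported to \<^typ>\<open>'g set set\<close> by sending \<open>z\<close> to the set of all \<open>A\<close> with
  \<open>z\<close> in the closure of \<open>A x\<close>.
\<close>

lemma orbit_closure_system:
  fixes a :: "'g::topological_group_add \<Rightarrow> 'x \<Rightarrow> 'x"
  assumes X: "dynamical_system metr X a" and x: "x \<in> topspace X"
  obtains Y :: "'g set set topology" and c \<phi> y
  where "dynamical_system metr Y c" "system_hom Y c X a \<phi>" "inj_on \<phi> (topspace Y)"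
    "y \<in> topspace Y" "\<phi> y = x" "Y closure_of (range (\<lambda>g. c g y)) = topspace Y"
proof -
  define C where "C = X closure_of (range (\<lambda>g. a g x))"
  have haus: "Hausdorff_space X" using X by (simp add: dynamical_system_def)
  have orb: "range (\<lambda>g. a g x) \<subseteq> topspace X" using dynamical_system_in_topspace[OF X x] by blast
  have CX: "C \<subseteq> topspace X" by (simp add: C_def closure_of_subset_topspace)
  have orbC: "range (\<lambda>g. a g x) \<subseteq> C" unfolding C_def by (rule closure_of_subset[OF orb])
  have xC: "x \<in> C" using orbC dynamical_system_zero[OF X x] by (metis rangeI subsetD)
  have inv: "invariant a C"
    unfolding invariant_def
  proof
    fix g
    have "a g ` C \<subseteq> X closure_of (a g ` range (\<lambda>g. a g x))"
      unfolding C_def by (rule continuous_map_image_closure_subset[OF dynamical_system_continuous[OF X]])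
    also have "\<dots> \<subseteq> C"
      unfolding C_def by (rule closure_of_mono) (auto simp: dynamical_system_add[OF X x, symmetric])
    finally show "a g ` C \<subseteq> C" .
  qed
  let ?S = "subtopology X C"
  have topS: "topspace ?S = C" using CX by auto
  have S: "dynamical_system metr ?S a"
    using xC by (intro dynamical_system_subtopology[OF X _ _ inv]) (auto simp: C_def)
  define i where "i z = {A. z \<in> X closure_of ((\<lambda>g. a g x) ` A)}" for z
  have inj: "inj_on i C"
  proof (rule inj_onI, rule ccontr)
    fix z w assume zw: "z \<in> C" "w \<in> C" "i z = i w" "z \<noteq> w"
    have "z \<in> topspace X" "w \<in> topspace X" using zw CX by auto
    then obtain U V where UV: "openin X U" "openin X V" "z \<in> U" "w \<in> V" "disjnt U V"
      using haus[unfolded Hausdorff_space_def, rule_format, of z w] zw(4) by auto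
    \<comment> \<open>The visiting times to \<open>U\<close> tell the two points apart:
      \<open>z\<close> is a limit of orbit points in \<open>U\<close>, whereas \<open>V\<close> is a
      neighbourhood of \<open>w\<close> free of them.\<close>
    define A where "A = {g. a g x \<in> U}"
    have "A \<in> i z"
      unfolding i_def mem_Collect_eq in_closure_of
    proof (intro conjI allI impI)
      show "z \<in> topspace X" using zw CX by blast
      fix W assume "z \<in> W \<and> openin X W"
      then have "z \<in> U \<inter> W \<and> openin X (U \<inter> W)" using UV by blast
      then obtain v where "v \<in> range (\<lambda>g. a g x)" "v \<in> U \<inter> W"
        using zw(1) unfolding C_def in_closure_of by blast
      then show "\<exists>v. v \<in> (\<lambda>g. a g x) ` A \<and> v \<in> W" by (auto simp: A_def)
    qed
    then have "A \<in> i w" using zw(3) by (rule subst[rotated])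
    then have "w \<in> X closure_of ((\<lambda>g. a g x) ` A)" by (simp add: i_def)
    then obtain v where "v \<in> (\<lambda>g. a g x) ` A" "v \<in> V"
      using UV unfolding in_closure_of by blast
    then show False using UV(5) by (auto simp: A_def disjnt_iff)
  qed
  define j where "j = inv_into C i"
  have ji: "j (i z) = z" if "z \<in> C" for z using inj that by (simp add: j_def)
  \<comment> \<open>The codes carry the topology pulled back along \<open>j\<close>, which makes
    \<open>i\<close> and \<open>j\<close> mutually inverse homeomorphisms.\<close>
  define Y where "Y = pullback_topology (i ` C) j ?S"
  have topY: "topspace Y = i ` C"
    unfolding Y_def topspace_pullback_topology topS using ji by auto
  have ci: "continuous_map ?S Y i"
    unfolding Y_def
  proof (rule continuous_map_pullback')
    show "continuous_map ?S ?S (j \<circ> i)"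
      by (rule continuous_map_eq[OF continuous_map_id]) (simp add: topS ji)
  qed (use topS in auto)
  have cj: "continuous_map Y ?S j"
    using continuous_map_pullback[OF continuous_map_id, of "i ` C" j ?S] by (simp add: Y_def)
  have ij: "homeomorphic_maps ?S Y i j"
    unfolding homeomorphic_maps_def using ci cj ji topS topY by auto
  define c where "c g y = i (a g (j y))" for g y
  have Yc: "dynamical_system metr Y c"
    by (rule dynamical_system_transport[OF S ij]) (simp add: c_def)
  show ?thesis
  proof (rule that[OF Yc])
    have "j (c g y) = a g (j y)" if "y \<in> topspace Y" for g y
      using that ji inv unfolding topY c_def invariant_def image_subset_iff by auto
    then show "system_hom Y c X a j"
      using cj by (simp add: system_hom_def continuous_map_in_subtopology)
    show "inj_on j (topspace Y)" unfolding topY by (rule inj_onI) (auto simp: ji)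
    show "i x \<in> topspace Y" using xC topY by simp
    show "j (i x) = x" by (rule ji[OF xC])
    have "range (\<lambda>g. c g (i x)) = i ` range (\<lambda>g. a g x)"
      by (auto simp: c_def ji[OF xC])
    then have "Y closure_of range (\<lambda>g. c g (i x)) = i ` (?S closure_of range (\<lambda>g. a g x))"
      using homeomorphic_map_closure_of[of ?S Y i "range (\<lambda>g. a g x)"] ij homeomorphic_map_maps orbC topS
      by metis
    also have "?S closure_of range (\<lambda>g. a g x) = C"
      using orbC by (simp add: closure_of_subtopology_subset closure_of_subtopology C_def[symmetric] inf.absorb2)
    finally show "Y closure_of range (\<lambda>g. c g (i x)) = topspace Y" by (simp add: topY)
  qed
qed

section \<open>Universality\<close>

lemma universal_hom_exists:
  fixes a :: "'g::topological_group_add \<Rightarrow> 'x \<Rightarrow> 'x" and T :: "'v::real_vector topology"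
  assumes X: "universal_minimal_strongly_proximal metr X a"
    and Q: "irreducible_affine_system metr T Q b"
  obtains \<phi> where "system_hom X a (subtopology T Q) b \<phi>"
proof -
  have aQ: "affine_system metr T Q b" using Q by (simp add: irreducible_affine_system_def)
  note Qf = affine_system_facts[OF aQ]
  obtain q where q: "extreme_in q Q" by (rule extreme_point_exists[OF Qf(1,4,5)])
  have qQ: "q \<in> topspace (subtopology T Q)" using q Qf(6) by (simp only: extreme_in_def)
  obtain Y :: "'g set set topology" and c \<phi> y
    where Y: "dynamical_system metr Y c" "system_hom Y c (subtopology T Q) b \<phi>" "inj_on \<phi> (topspace Y)"
    "y \<in> topspace Y" "\<phi> y = q" "Y closure_of (range (\<lambda>g. c g y)) = topspace Y"
    by (rule orbit_closure_system[OF Qf(3) qQ])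
  have "attracts Y c y"
    unfolding attracts_def
  proof (intro ballI allI impI)
    fix \<mu> u and e :: real
    assume "\<mu> \<in> states Y" "continuous_map Y euclideanreal u" "u y = 0" "0 < e"
    then show "\<exists>g. \<mu> (u \<circ> c g) < e"
      using extreme_point_attracts[OF Q Y(1,2,3,4)] q Y(5) by metis
  qed
  then have "minimal_strongly_proximal metr Y c"
    using Y by (intro minimal_strongly_proximalI)
  then obtain f where "factor_map X a Y c f"
    using X unfolding universal_minimal_strongly_proximal_def by blast
  then have f: "continuous_map X Y f" "\<And>g x. x \<in> topspace X \<Longrightarrow> f (a g x) = c g (f x)"
    by (auto simp: factor_map_def system_hom_def)
  have "f x \<in> topspace Y" if "x \<in> topspace X" for x
    using continuous_map_funspace[OF f(1)] that by blast
  then have "system_hom X a (subtopology T Q) b (\<phi> \<circ> f)"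
    using Y(2) f continuous_map_compose[OF f(1), of "subtopology T Q" \<phi>] by (auto simp: system_hom_def)
  then show ?thesis by (rule that)
qed

lemma affine_hom_facts:
  assumes "affine_hom T Q a T' Q' a' f" "affine_system metr T Q a" "affine_system metr T' Q' a'"
  shows "continuous_map (subtopology T Q) (subtopology T' Q') f" "affine_map_on Q f"
    "\<And>g x. x \<in> Q \<Longrightarrow> f (a g x) = a' g (f x)" "\<And>x. x \<in> Q \<Longrightarrow> f x \<in> Q'"
proof -
  note Qf = affine_system_facts[OF assms(2)] and Qf' = affine_system_facts[OF assms(3)]
  show c: "continuous_map (subtopology T Q) (subtopology T' Q') f" and "affine_map_on Q f"
    and "\<And>g x. x \<in> Q \<Longrightarrow> f (a g x) = a' g (f x)"
    using assms(1) Qf(6) by (auto simp: affine_hom_def system_hom_def)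
  show "\<And>x. x \<in> Q \<Longrightarrow> f x \<in> Q'"
    using continuous_map_funspace[OF c] Qf(6) Qf'(6) by (auto simp del: topspace_subtopology)
qed

text \<open>
  The mean of two homomorphisms is onto and therefore hits an extreme point. At its preimage the two
  homomorphisms agree.
\<close>

lemma affine_hom_unique:
  assumes P: "irreducible_affine_system metr T' P a" and Q: "irreducible_affine_system metr T Q b"
    and f: "affine_hom T' P a T Q b f" and h: "affine_hom T' P a T Q b h" and x: "x \<in> P"
  shows "f x = h x"
proof -
  have aP: "affine_system metr T' P a" and aQ: "affine_system metr T Q b"
    using P Q by (auto simp: irreducible_affine_system_def)
  note Pf = affine_system_facts[OF aP] and Qf = affine_system_facts[OF aQ]
  note ff = affine_hom_facts[OF f aP aQ] and hf = affine_hom_facts[OF h aP aQ]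
  define k where "k x = (1/2) *\<^sub>R f x + (1/2) *\<^sub>R h x" for x
  have kQ: "k x \<in> Q" if "x \<in> P" for x
    unfolding k_def using ff(4) hf(4) that by (intro convexD[OF Qf(2)]) auto
  have "affine_hom T' P a T Q b k"
    unfolding affine_hom_def system_hom_def
  proof (intro conjI allI ballI)
    have "continuous_map (subtopology T' P) T k"
      unfolding k_def using ff(1) hf(1)
      by (intro lctvs_continuous_add[OF Qf(1)] lctvs_continuous_scaleR[OF Qf(1)])
        (auto simp: continuous_map_in_subtopology)
    then show "continuous_map (subtopology T' P) (subtopology T Q) k"
      using kQ Pf(6) by (auto simp: continuous_map_in_subtopology)
    show "affine_map_on P k"
      unfolding affine_map_on_def
    proof (intro ballI)
      fix x y and t :: real assume "x \<in> P" "y \<in> P" "t \<in> {0..1}"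
      then have k: "k ((1 - t) *\<^sub>R x + t *\<^sub>R y) =
          (1/2) *\<^sub>R ((1 - t) *\<^sub>R f x + t *\<^sub>R f y) + (1/2) *\<^sub>R ((1 - t) *\<^sub>R h x + t *\<^sub>R h y)"
        using affine_map_onD[OF ff(2), of x y t] affine_map_onD[OF hf(2), of x y t] by (simp add: k_def)
      show "k ((1 - t) *\<^sub>R x + t *\<^sub>R y) = (1 - t) *\<^sub>R k x + t *\<^sub>R k y"
        unfolding k by (simp add: k_def scaleR_add_right mult.commute)
    qed
    fix g x assume "x \<in> topspace (subtopology T' P)"
    then have x: "x \<in> P" by simp
    have "b g (k x) = (1/2) *\<^sub>R b g (f x) + (1/2) *\<^sub>R b g (h x)"
      using affine_map_onD[OF Qf(9) ff(4)[OF x] hf(4)[OF x], of "1/2" g] by (simp add: k_def)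
    then show "k (a g x) = b g (k x)"
      using ff(3)[OF x] hf(3)[OF x] by (simp add: k_def)
  qed
  then have "k ` P = Q"
    using Pf by (intro irreducible_image[OF Q]) (auto simp: invariant_def locally_convex_tvs_def)
  moreover obtain q where q: "extreme_in q Q" by (rule extreme_point_exists[OF Qf(1,4,5)])
  ultimately obtain z where z: "z \<in> P" "k z = q" by (metis extreme_in_def imageE)
  define E where "E = {x \<in> topspace (subtopology T' P). f x = h x}"
  have "f z = q \<and> h z = q"
    using q ff(4)[OF z(1)] hf(4)[OF z(1)] z(2) unfolding extreme_in_def k_def by blast
  then have "E \<noteq> {}" using z(1) Pf(6) by (auto simp: E_def simp del: topspace_subtopology)
  moreover have "closedin (subtopology T' P) E"
    unfolding E_def
    by (rule closedin_continuous_maps_eq[OF Hausdorff_space_subtopology[OF Qf(7)] ff(1) hf(1)])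
  moreover have E: "E = {x \<in> P. f x = h x}" unfolding E_def Pf(6) ..
  moreover have "convex E"
    unfolding convex_alt
  proof (intro ballI allI impI)
    fix u w and t :: real assume uw: "u \<in> E" "w \<in> E" and t: "0 \<le> t \<and> t \<le> 1"
    then have "f ((1 - t) *\<^sub>R u + t *\<^sub>R w) = h ((1 - t) *\<^sub>R u + t *\<^sub>R w)"
      using affine_map_onD[OF ff(2), of u w t] affine_map_onD[OF hf(2), of u w t] by (simp add: E)
    moreover have "(1 - t) *\<^sub>R u + t *\<^sub>R w \<in> P"
      using Pf(2) uw t unfolding convex_alt E by blast
    ultimately show "(1 - t) *\<^sub>R u + t *\<^sub>R w \<in> E" by (simp add: E)
  qed
  moreover have "invariant a E"
    using ff(3) hf(3) Pf(10) by (auto simp: invariant_def E)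
  moreover have "E \<subseteq> P" unfolding E by blast
  ultimately have "E = P"
    using P[unfolded irreducible_affine_system_def, THEN conjunct2, rule_format, of E] by simp
  then show ?thesis using x E by blast
qed


section \<open>Affinely prime systems\<close>

text \<open>Affine primeness tests factors in one fixed vector space type. An injective continuous
  affine map carries a system there, with the action conjugated by it; compactness makes the map a
  homeomorphism onto its image.\<close>

lemma affine_system_embedding:
  assumes Q: "affine_system metr T Q b" and T': "locally_convex_tvs T'"
    and e: "continuous_map (subtopology T Q) T' e" "affine_map_on Q e" "inj_on e Q"
  defines "b' \<equiv> \<lambda>g. e \<circ> b g \<circ> inv_into Q e"
  shows "affine_system metr T' (e ` Q) b'" "affine_hom T Q b T' (e ` Q) b' e"
proof -
  note Qf = affine_system_facts[OF Q]
  let ?S = "subtopology T Q" and ?S' = "subtopology T' (e ` Q)"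
  have top': "topspace ?S' = e ` Q" using T' by (simp add: locally_convex_tvs_def)
  have ce: "continuous_map ?S ?S' e"
    using e(1) Qf(6) by (auto simp: continuous_map_in_subtopology)
  have inv: "inv_into Q e (e x) = x" if "x \<in> Q" for x using e(3) that by simp
  have "homeomorphic_map ?S ?S' e"
  proof (rule continuous_imp_homeomorphic_map[OF ce])
    show "compact_space ?S" using Qf(4) by (simp add: compact_space_subtopology)
    show "Hausdorff_space ?S'" using T' by (simp add: Hausdorff_space_subtopology locally_convex_tvs_def)
    show "e ` topspace ?S = topspace ?S'" unfolding Qf(6) top' ..
    show "inj_on e (topspace ?S)" unfolding Qf(6) by (rule e(3))
  qed
  then obtain e' where e': "homeomorphic_maps ?S ?S' e e'" using homeomorphic_map_maps by blast
  have hom: "homeomorphic_maps ?S ?S' e (inv_into Q e)"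
  proof (rule homeomorphic_maps_eq[OF e'])
    fix y assume "y \<in> topspace ?S'"
    then obtain x where x: "x \<in> Q" "y = e x" unfolding top' by blast
    then have "x \<in> topspace ?S" unfolding Qf(6) by blast
    then have "e' (e x) = x" using e' unfolding homeomorphic_maps_def by blast
    then show "e' y = inv_into Q e y" using x inv by simp
  qed simp
  have comb: "(1 - t) *\<^sub>R x + t *\<^sub>R y \<in> Q" if "x \<in> Q" "y \<in> Q" "0 \<le> t" "t \<le> 1" for x y and t :: real
    using Qf(2) that unfolding convex_alt by blast
  show "affine_system metr T' (e ` Q) b'"
    unfolding affine_system_def
  proof (intro conjI allI T')
    show "dynamical_system metr ?S' b'"
      by (rule dynamical_system_transport[OF Qf(3) hom]) (simp add: b'_def)
    show "convex (e ` Q)" by (rule convex_affine_map_image[OF e(2) Qf(2)])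
    fix g
    show "affine_map_on (e ` Q) (b' g)"
      unfolding affine_map_on_def
    proof (intro ballI)
      fix p r and t :: real assume "p \<in> e ` Q" "r \<in> e ` Q" and t: "t \<in> {0..1}"
      then obtain x y where xy: "x \<in> Q" "y \<in> Q" "p = e x" "r = e y" by blast
      have "(1 - t) *\<^sub>R p + t *\<^sub>R r = e ((1 - t) *\<^sub>R x + t *\<^sub>R y)"
        using affine_map_onD[OF e(2) xy(1,2), of t] xy t by simp
      then show "b' g ((1 - t) *\<^sub>R p + t *\<^sub>R r) = (1 - t) *\<^sub>R b' g p + t *\<^sub>R b' g r"
        using xy t inv comb affine_map_onD[OF Qf(9) xy(1,2), of t g]
          affine_map_onD[OF e(2) Qf(10)[OF xy(1)] Qf(10)[OF xy(2)], of t g g]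
        by (simp add: b'_def)
    qed
  qed
  show "affine_hom T Q b T' (e ` Q) b' e"
    using ce e(2) inv Qf(6) by (simp add: affine_hom_def system_hom_def b'_def)
qed

lemma affine_hom_compose:
  assumes "affine_hom T Q a T' Q' a' f" "affine_hom T' Q' a' T'' Q'' a'' h"
    and P: "affine_system metr T Q a" "affine_system metr T' Q' a'"
  shows "affine_hom T Q a T'' Q'' a'' (h \<circ> f)"
proof -
  note ff = affine_hom_facts[OF assms(1) P]
  have h: "continuous_map (subtopology T' Q') (subtopology T'' Q'') h" "affine_map_on Q' h"
    "\<And>g x. x \<in> Q' \<Longrightarrow> h (a' g x) = a'' g (h x)"
    using assms(2) affine_system_facts(6)[OF P(2)] by (auto simp: affine_hom_def system_hom_def)
  show ?thesis
    unfolding affine_hom_def system_hom_def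
  proof (intro conjI allI ballI)
    show "continuous_map (subtopology T Q) (subtopology T'' Q'') (h \<circ> f)"
      by (rule continuous_map_compose[OF ff(1) h(1)])
    show "affine_map_on Q (h \<circ> f)"
      using ff(2,4) h(2) by (simp add: affine_map_on_def)
    show "(h \<circ> f) (a g x) = a'' g ((h \<circ> f) x)" if "x \<in> topspace (subtopology T Q)" for g x
      using that ff(3,4) h(3) by simp
  qed
qed

text \<open>
  To apply primeness of \<open>P\<close>, the factor \<open>Q\<close> is embedded into the functions on
  \<^typ>\<open>'w \<Rightarrow> real\<close> by evaluating continuous affine functions on \<open>Q\<close>, each encoded by its pullback to \<open>P\<close>.
\<close>

lemma affinely_prime_factor_inj:
  fixes T :: "'v::real_vector topology" and T' :: "'w::real_vector topology"
  assumes prime: "affinely_prime_affine_system metr T' P a"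
    and Q: "affine_system metr T Q b" "nontrivial Q"
    and f: "affine_hom T' P a T Q b f" "f ` P = Q"
  shows "inj_on f P"
proof -
  have aP: "affine_system metr T' P a" using prime by (simp add: affinely_prime_affine_system_def)
  note Qf = affine_system_facts[OF Q(1)]
  define A where "A = {u. \<exists>h\<in>affine_functions T Q. \<forall>p\<in>P. u p = h (f p)}"
  \<comment> \<open>The preimage picked by \<open>inv_into\<close> does not matter for
    \<open>u\<close> in \<open>A\<close>, because on \<open>P\<close> such a \<open>u\<close>
    factors through \<open>f\<close>.\<close>
  define e where "e q = (\<lambda>u. if u \<in> A then u (inv_into P f q) else (0 :: real))" for q
  have inv: "inv_into P f q \<in> P" "f (inv_into P f q) = q" if "q \<in> Q" for q
    using that f(2) inv_into_into[of q f P] f_inv_into_f[of q f P] by auto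
  have e_eq: "\<exists>h\<in>affine_functions T Q. \<forall>q\<in>Q. e q u = h q" if "u \<in> A" for u
    using that inv by (fastforce simp: A_def e_def)
  have "affine_map_on Q e"
    unfolding affine_map_on_def
  proof (intro ballI ext)
    fix x y and t :: real and u assume xy: "x \<in> Q" "y \<in> Q" and t: "t \<in> {0..1}"
    show "e ((1 - t) *\<^sub>R x + t *\<^sub>R y) u = ((1 - t) *\<^sub>R e x + t *\<^sub>R e y) u"
    proof (cases "u \<in> A")
      case True
      then obtain h where h: "h \<in> affine_functions T Q" "\<forall>q\<in>Q. e q u = h q" using e_eq by blast
      moreover have "(1 - t) *\<^sub>R x + t *\<^sub>R y \<in> Q"
        using Qf(2) xy t unfolding convex_alt by auto
      moreover have "affine_map_on Q h" using h by (simp add: affine_functions_def)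
      ultimately show ?thesis using affine_map_onD[of Q h x y t] xy t by simp
    qed (simp add: e_def)
  qed
  moreover have "inj_on e Q"
  proof (rule inj_onI)
    fix x y assume xy: "x \<in> Q" "y \<in> Q" and eq: "e x = e y"
    show "x = y"
    proof (rule affine_functions_eqI[OF Qf(1), of Q])
      fix h assume "h \<in> affine_functions T Q"
      then have "h \<circ> f \<in> A" by (auto simp: A_def)
      then show "h x = h y" using fun_cong[OF eq, of "h \<circ> f"] xy inv by (simp add: e_def)
    qed
  qed
  moreover have "continuous_map (subtopology T Q) weak_star e"
    unfolding continuous_map_weak_star_iff
  proof
    fix u
    show "continuous_map (subtopology T Q) euclideanreal (\<lambda>q. e q u)"
    proof (cases "u \<in> A")
      case True
      then obtain h where h: "h \<in> affine_functions T Q" "\<forall>q\<in>Q. e q u = h q" using e_eq by blast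
      then have "continuous_map (subtopology T Q) euclideanreal h" by (simp add: affine_functions_def)
      then show ?thesis by (rule continuous_map_eq) (use h in auto)
    qed (simp add: e_def)
  qed
  ultimately have e: "affine_system metr weak_star (e ` Q) (\<lambda>g. e \<circ> b g \<circ> inv_into Q e)"
    "affine_hom T Q b weak_star (e ` Q) (\<lambda>g. e \<circ> b g \<circ> inv_into Q e) e" "inj_on e Q"
    using affine_system_embedding[OF Q(1) locally_convex_tvs_weak_star] by auto
  have "affine_hom T' P a weak_star (e ` Q) (\<lambda>g. e \<circ> b g \<circ> inv_into Q e) (e \<circ> f)"
    by (rule affine_hom_compose[OF f(1) e(2) aP Q(1)])
  moreover have "nontrivial (e ` Q)"
    using Q(2) e(3) unfolding nontrivial_def inj_on_def by blast
  moreover have "(e \<circ> f) ` P = e ` Q" unfolding image_comp[symmetric] f(2) ..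
  ultimately have "inj_on (e \<circ> f) P"
    using prime e(1) unfolding affinely_prime_affine_system_def by blast
  then show ?thesis by (rule inj_on_imageI2)
qed

lemma nontrivial_states:
  assumes X: "compact_space X" "Hausdorff_space X" and "nontrivial (topspace X)"
  shows "nontrivial (states X)"
proof -
  obtain x y where xy: "x \<in> topspace X" "y \<in> topspace X" "x \<noteq> y"
    using assms(3) by (auto simp: nontrivial_def)
  obtain f where f: "continuous_map X euclideanreal f" "f x = 0" "f y = (1 :: real)"
    by (rule point_separation[OF X xy])
  have "point_mass X x f \<noteq> point_mass X y f"
    using f point_mass_apply[OF xy(1) f(1)] point_mass_apply[OF xy(2) f(1)] by simp
  then show ?thesis
    using point_mass_in_states[OF xy(1)] point_mass_in_states[OF xy(2)] unfolding nontrivial_def by metis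
qed

theorem corollary1p7:
  fixes metr :: bool
    and X :: "'x topology"
    and a :: "'g::topological_group_add \<Rightarrow> 'x \<Rightarrow> 'x"
  assumes "universal_minimal_strongly_proximal metr X a"
  shows "irreducible_affine_system metr weak_star (prob_space_of X) (induced_action a) \<and>
    (\<forall>(T::'v::real_vector topology) Q b.
      irreducible_affine_system metr T Q b \<longrightarrow>
      (\<exists>!\<Theta>. \<Theta> \<in> extensional (prob_space_of X) \<and>
        affine_hom weak_star (prob_space_of X) (induced_action a) T Q b \<Theta> \<and>
        \<Theta> ` prob_space_of X = Q)) \<and>
    (affinely_prime metr X a \<longrightarrow>
      (nontrivial (topspace X) \<longrightarrow> nontrivial (prob_space_of X)) \<and>
      (\<forall>(T::'v topology) Q b.
        irreducible_affine_system metr T Q b \<and> nontrivial Q \<longrightarrow>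
        (\<exists>\<Theta>. affine_isomorphism weak_star (prob_space_of X) (induced_action a) T Q b \<Theta>)))"
proof -
  have msp: "minimal_strongly_proximal metr X a"
    using assms by (simp add: universal_minimal_strongly_proximal_def)
  then have X: "dynamical_system metr X a"
    by (simp add: minimal_strongly_proximal_def minimal_system_def)
  then have cX: "compact_space X" "Hausdorff_space X" by (auto simp: dynamical_system_def)
  have M: "prob_space_of X = states X" by (rule prob_space_of_eq_states[OF cX])
  have irr: "irreducible_affine_system metr weak_star (states X) (induced_action a)"
    by (rule irreducible_affine_system_states[OF msp])
  note aX = affine_system_states[OF X]
  note Xf = affine_system_facts[OF aX]
  have ex: "\<exists>\<Theta>. \<Theta> \<in> extensional (states X) \<and>
      affine_hom weak_star (states X) (induced_action a) T Q b \<Theta> \<and> \<Theta> ` states X = Q"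
    if Q: "irreducible_affine_system metr T Q b" for T :: "'v topology" and Q b
  proof -
    have aQ: "affine_system metr T Q b" using Q by (simp add: irreducible_affine_system_def)
    obtain \<phi> where \<phi>: "system_hom X a (subtopology T Q) b \<phi>"
      by (rule universal_hom_exists[OF assms Q])
    \<comment> \<open>Functions are total, so uniqueness requires fixed values outside the states;
      the restriction makes \<open>\<Theta>\<close> extensional.\<close>
    define \<Theta> where "\<Theta> = restrict (barycentre T Q \<phi>) (states X)"
    note hom = affine_hom_barycentre[OF X aQ \<phi>]
    note hf = affine_hom_facts[OF hom aX aQ]
    have "affine_hom weak_star (states X) (induced_action a) T Q b \<Theta>"
      unfolding affine_hom_def system_hom_def
    proof (intro conjI allI ballI)
      show "continuous_map (subtopology weak_star (states X)) (subtopology T Q) \<Theta>"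
        by (rule continuous_map_eq[OF hf(1)]) (simp add: \<Theta>_def)
      have "(1 - t) *\<^sub>R L + t *\<^sub>R N \<in> states X" if "L \<in> states X" "N \<in> states X" "t \<in> {0..1}" for L N and t :: real
        using convex_states[of X] that unfolding convex_alt by simp
      then show "affine_map_on (states X) \<Theta>"
        using hf(2) by (simp add: affine_map_on_def \<Theta>_def)
      show "\<Theta> (induced_action a g L) = b g (\<Theta> L)" if "L \<in> topspace (subtopology weak_star (states X))" for g L
        using that hf(3) Xf(10) by (simp add: \<Theta>_def)
    qed
    \<comment> \<open>Irreducibility of \<open>Q\<close> is used here with the whole space of states
      as the invariant convex set.\<close>
    moreover from this have "\<Theta> ` states X = Q"
      by (rule irreducible_image[OF Q])
        (use Xf(2,4,5,10) in \<open>auto simp: invariant_def\<close>)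
    moreover have "\<Theta> \<in> extensional (states X)" by (simp add: \<Theta>_def)
    ultimately show ?thesis by blast
  qed
  have uniq: "\<Theta> = \<Theta>'"
    if Q: "irreducible_affine_system metr T Q b"
      and \<Theta>: "\<Theta> \<in> extensional (states X)" "affine_hom weak_star (states X) (induced_action a) T Q b \<Theta>"
      and \<Theta>': "\<Theta>' \<in> extensional (states X)" "affine_hom weak_star (states X) (induced_action a) T Q b \<Theta>'"
    for T :: "'v topology" and Q b \<Theta> \<Theta>'
    using \<Theta>(1) \<Theta>'(1) by (rule extensionalityI) (rule affine_hom_unique[OF irr Q \<Theta>(2) \<Theta>'(2)])
  have iso: "\<exists>\<Theta>. affine_isomorphism weak_star (states X) (induced_action a) T Q b \<Theta>"
    if prime: "affinely_prime metr X a" and Q: "irreducible_affine_system metr T Q b" "nontrivial Q"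
    for T :: "'v topology" and Q b
  proof -
    obtain \<Theta> where \<Theta>: "affine_hom weak_star (states X) (induced_action a) T Q b \<Theta>" "\<Theta> ` states X = Q"
      using ex[OF Q(1)] by blast
    have "affinely_prime_affine_system metr weak_star (states X) (induced_action a)"
      using prime by (simp add: affinely_prime_def M)
    then have "inj_on \<Theta> (states X)"
      by (rule affinely_prime_factor_inj) (use Q \<Theta> in \<open>auto simp: irreducible_affine_system_def\<close>)
    then show ?thesis using \<Theta> by (auto simp: affine_isomorphism_def bij_betw_def)
  qed
  show ?thesis
    unfolding M
  proof (intro conjI allI impI irr)
    show "\<exists>!\<Theta>. \<Theta> \<in> extensional (states X) \<and>
        affine_hom weak_star (states X) (induced_action a) T Q b \<Theta> \<and> \<Theta> ` states X = Q"
      if "irreducible_affine_system metr T Q b" for T :: "'v topology" and Q b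
      using ex[OF that] uniq[OF that] by (intro ex_ex1I) auto
    show "nontrivial (states X)" if "nontrivial (topspace X)"
      by (rule nontrivial_states[OF cX that])
  qed (use iso in auto)
qed

end
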